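(* Suppose $\tau$ is in the limit-circle case at $a$ and in the limit-point case at $b$. Then an operator $S$ is a self-adjoint restriction of $T_{\max}$ if and only if there is some $\varphi_a\in[0,\pi)$ such that $Sf=\tau f$ for $f\in\operatorname{dom}(S)$, where $$\operatorname{dom}(S)=\big\{g\in\operatorname{dom}(T_{\max})\,\big|\, BC_a^1(g)\cos\varphi_a-BC_a^2(g)\sin\varphi_a=0\big\}.$$ A similar result (with $BC_b^1,BC_b^2$) holds if $\tau$ is in the limit-circle case at $b$ and in the limit-point case at $a$.
   Context: Setting. $(a,b)\subseteq\mathbb R$ is an open interval (possibly unbounded); $p,q,r,s$ are Lebesgue measurable and real-valued a.e. on $(a,b)$, with $p^{-1},q,r,s\in L^1_{\mathrm{loc}}((a,b);dx)$, $r>0$ and $p\neq0$ a.e. For $f\in AC_{\mathrm{loc}}((a,b))$ put $f^{[1]}=p(f'+sf)$, $\mathfrak D_\tau=\{f\in AC_{\mathrm{loc}}((a,b)) : f^{[1]}\in AC_{\mathrm{loc}}((a,b))\}$, and $\tau f=\frac1r\big(-(f^{[1]})'+sf^{[1]}+qf\big)$ for $f\in\mathfrak D_\tau$. The Wronskian is $W(f,g)=fg^{[1]}-f^{[1]}g$. In $L^2((a,b);r(x)dx)$ the maximal operator is $T_{\max}f=\tau f$, $\operatorname{dom}(T_{\max})=\{g\in L^2((a,b);r\,dx): g\in\mathfrak D_\tau,\ \tau g\in L^2((a,b);r\,dx)\}$. For $f,g\in\operatorname{dom}(T_{\max})$ the limits $W(f,g)(a)=\lim_{x\downarrow a}W(f,g)(x)$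 and $W(f,g)(b)=\lim_{x\uparrow b}W(f,g)(x)$ exist. $\tau$ is in the limit-circle case at $a$ if for each $z\in\mathbb C$ all solutions of $(\tau-z)u=0$ lie in $L^2$ near $a$ (i.e. in $L^2((a,c);r\,dx)$ for every $c\in(a,b)$), and in the limit-point case at $a$ if for each $z\in\mathbb C$ some solution does not lie in $L^2$ near $a$; similarly at $b$. Boundary functionals. If $\tau$ is limit-circle at the endpoint $c\in\{a,b\}$, fix $w_1,w_2\in\operatorname{dom}(T_{\max})$ with $W(w_1,\overline{w_2})(c)=1$ and $W(w_1,\overline{w_1})(c)=W(w_2,\overline{w_2})(c)=0$ (such functions exist), and set $BC_c^1(f)=W(f,\overline{w_2})(c)$, $BC_c^2(f)=W(\overline{w_1},f)(c)$ for $f\in\operatorname{dom}(T_{\max})$. *)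

theory Defs
  imports "HOL-Analysis.Analysis"
begin

section \<open>Local absolute continuity and local integrability\<close>

text \<open>A family of non-overlapping compact subintervals of \<open>{c..d}\<close> is a division \<open>\<D>\<close> of its
  own union; the endpoints of a member \<open>K\<close> are \<open>Inf K\<close> and \<open>Sup K\<close>.\<close>

definition abs_cont_on :: "real \<Rightarrow> real \<Rightarrow> (real \<Rightarrow> complex) \<Rightarrow> bool" where
  "abs_cont_on c d f \<longleftrightarrow>
     (\<forall>\<epsilon>>0. \<exists>\<delta>>0. \<forall>\<D>. \<D> division_of \<Union>\<D> \<and> \<Union>\<D> \<subseteq> {c..d} \<and> (\<Sum>K\<in>\<D>. Sup K - Inf K) < \<delta>
        \<longrightarrow> (\<Sum>K\<in>\<D>. norm (f (Sup K) - f (Inf K))) < \<epsilon>)"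

definition AC_loc :: "real set \<Rightarrow> (real \<Rightarrow> complex) set" where
  "AC_loc I = {f. \<forall>c d. c \<le> d \<and> {c..d} \<subseteq> I \<longrightarrow> abs_cont_on c d f}"

definition L1_loc :: "real set \<Rightarrow> (real \<Rightarrow> real) set" where
  "L1_loc I = {f. \<forall>K. compact K \<and> K \<subseteq> I \<longrightarrow> f absolutely_integrable_on K}"


section \<open>Unbounded operators in \<open>L\<^sup>2\<close>\<close>

text \<open>An element of the Hilbert space \<open>L\<^sup>2\<close> of a measure \<open>M\<close> is represented by the
  square-integrable functions in its class, and an operator by the set of all pairs of
  representatives of the points of its graph.  Such a set is invariant under changes of
  either component on \<open>M\<close>-null sets; these sets correspond exactly to sets of pairs of
  classes, and equality of such sets is equality of graphs.\<close>

definition L2 :: "real measure \<Rightarrow> (real \<Rightarrow> complex) set" where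
  "L2 M = {f. f \<in> borel_measurable M \<and> integrable M (\<lambda>x. (norm (f x))\<^sup>2)}"

definition L2_inner :: "real measure \<Rightarrow> (real \<Rightarrow> complex) \<Rightarrow> (real \<Rightarrow> complex) \<Rightarrow> complex" where
  "L2_inner M f g = integral\<^sup>L M (\<lambda>x. cnj (f x) * g x)"

definition L2_norm :: "real measure \<Rightarrow> (real \<Rightarrow> complex) \<Rightarrow> real" where
  "L2_norm M f = sqrt (integral\<^sup>L M (\<lambda>x. (norm (f x))\<^sup>2))"

type_synonym op_graph = "((real \<Rightarrow> complex) \<times> (real \<Rightarrow> complex)) set"

definition linear_operator :: "real measure \<Rightarrow> op_graph \<Rightarrow> bool" where
  "linear_operator M S \<longleftrightarrow>
     S \<subseteq> L2 M \<times> L2 M \<and>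
     (\<forall>f h f' h'. (f, h) \<in> S \<and> f' \<in> L2 M \<and> h' \<in> L2 M \<and>
        (AE x in M. f' x = f x) \<and> (AE x in M. h' x = h x) \<longrightarrow> (f', h') \<in> S) \<and>
     (\<lambda>x. 0, \<lambda>x. 0) \<in> S \<and>
     (\<forall>f h f' h'. (f, h) \<in> S \<and> (f', h') \<in> S \<longrightarrow> (\<lambda>x. f x + f' x, \<lambda>x. h x + h' x) \<in> S) \<and>
     (\<forall>\<alpha> f h. (f, h) \<in> S \<longrightarrow> (\<lambda>x. \<alpha> * f x, \<lambda>x. \<alpha> * h x) \<in> S) \<and>
     (\<forall>f h h'. (f, h) \<in> S \<and> (f, h') \<in> S \<longrightarrow> (AE x in M. h x = h' x))"

definition densely_defined :: "real measure \<Rightarrow> op_graph \<Rightarrow> bool" where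
  "densely_defined M S \<longleftrightarrow>
     (\<forall>f\<in>L2 M. \<forall>\<epsilon>>0. \<exists>(g, h)\<in>S. L2_norm M (\<lambda>x. f x - g x) < \<epsilon>)"

definition adjoint_op :: "real measure \<Rightarrow> op_graph \<Rightarrow> op_graph" where
  "adjoint_op M S = {(g, k). g \<in> L2 M \<and> k \<in> L2 M \<and>
     (\<forall>(f, h)\<in>S. L2_inner M g h = L2_inner M k f)}"

definition self_adjoint :: "real measure \<Rightarrow> op_graph \<Rightarrow> bool" where
  "self_adjoint M S \<longleftrightarrow> linear_operator M S \<and> densely_defined M S \<and> adjoint_op M S = S"


section \<open>The differential expression\<close>

record sl_expr =
  sl_a :: ereal
  sl_b :: ereal
  sl_p :: "real \<Rightarrow> real"
  sl_q :: "real \<Rightarrow> real"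
  sl_r :: "real \<Rightarrow> real"
  sl_s :: "real \<Rightarrow> real"

definition sl_int :: "sl_expr \<Rightarrow> real set" where
  "sl_int C = einterval (sl_a C) (sl_b C)"

definition sturm_liouville :: "sl_expr \<Rightarrow> bool" where
  "sturm_liouville C \<longleftrightarrow>
     sl_a C < sl_b C \<and>
     sl_p C \<in> borel_measurable (lebesgue_on (sl_int C)) \<and>
     sl_q C \<in> borel_measurable (lebesgue_on (sl_int C)) \<and>
     sl_r C \<in> borel_measurable (lebesgue_on (sl_int C)) \<and>
     sl_s C \<in> borel_measurable (lebesgue_on (sl_int C)) \<and>
     (\<lambda>x. inverse (sl_p C x)) \<in> L1_loc (sl_int C) \<and>
     sl_q C \<in> L1_loc (sl_int C) \<and>
     sl_r C \<in> L1_loc (sl_int C) \<and>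
     sl_s C \<in> L1_loc (sl_int C) \<and>
     (AE x in lebesgue_on (sl_int C). sl_r C x > 0) \<and>
     (AE x in lebesgue_on (sl_int C). sl_p C x \<noteq> 0)"

text \<open>The measure \<open>r(x) dx\<close> on the open interval with endpoints \<open>u\<close> and \<open>v\<close>.\<close>

definition weight :: "sl_expr \<Rightarrow> ereal \<Rightarrow> ereal \<Rightarrow> real measure" where
  "weight C u v = density (lebesgue_on (einterval u v)) (\<lambda>x. ennreal (sl_r C x))"

abbreviation sl_measure :: "sl_expr \<Rightarrow> real measure" where
  "sl_measure C \<equiv> weight C (sl_a C) (sl_b C)"

text \<open>The expression \<open>p(f' + sf)\<close> is defined almost everywhere only.  The first quasi-derivative
  is its locally absolutely continuous representative, whose values on the interval are unique.\<close>

definition is_quasi_deriv :: "sl_expr \<Rightarrow> (real \<Rightarrow> complex) \<Rightarrow> (real \<Rightarrow> complex) \<Rightarrow> bool" where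
  "is_quasi_deriv C f g \<longleftrightarrow> g \<in> AC_loc (sl_int C) \<and>
     (AE x in lebesgue_on (sl_int C).
        g x = of_real (sl_p C x) * (vector_derivative f (at x) + of_real (sl_s C x) * f x))"

definition dom_tau :: "sl_expr \<Rightarrow> (real \<Rightarrow> complex) set" where
  "dom_tau C = {f \<in> AC_loc (sl_int C). \<exists>g. is_quasi_deriv C f g}"

definition quasi_deriv :: "sl_expr \<Rightarrow> (real \<Rightarrow> complex) \<Rightarrow> real \<Rightarrow> complex" where
  "quasi_deriv C f = (SOME g. is_quasi_deriv C f g)"

definition tau :: "sl_expr \<Rightarrow> (real \<Rightarrow> complex) \<Rightarrow> real \<Rightarrow> complex" where
  "tau C f x =
     (- vector_derivative (quasi_deriv C f) (at x)
      + of_real (sl_s C x) * quasi_deriv C f x + of_real (sl_q C x) * f x) / of_real (sl_r C x)"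

definition wronskian ::
    "sl_expr \<Rightarrow> (real \<Rightarrow> complex) \<Rightarrow> (real \<Rightarrow> complex) \<Rightarrow> real \<Rightarrow> complex" where
  "wronskian C f g x = f x * quasi_deriv C g x - quasi_deriv C f x * g x"


section \<open>The maximal operator and its restrictions\<close>

definition dom_T_max :: "sl_expr \<Rightarrow> (real \<Rightarrow> complex) set" where
  "dom_T_max C = {g. g \<in> L2 (sl_measure C) \<and> g \<in> dom_tau C \<and> tau C g \<in> L2 (sl_measure C)}"

text \<open>The operator \<open>f \<mapsto> \<tau> f\<close> with domain \<open>D\<close>, as a set of pairs of representatives.\<close>

definition tau_op :: "sl_expr \<Rightarrow> (real \<Rightarrow> complex) set \<Rightarrow> op_graph" where
  "tau_op C D = {(f, h). f \<in> L2 (sl_measure C) \<and> h \<in> L2 (sl_measure C) \<and>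
     (\<exists>g\<in>D. (AE x in sl_measure C. f x = g x) \<and> (AE x in sl_measure C. h x = tau C g x))}"

definition T_max :: "sl_expr \<Rightarrow> op_graph" where
  "T_max C = tau_op C (dom_T_max C)"


section \<open>Limit-circle and limit-point endpoints\<close>

definition solutions :: "sl_expr \<Rightarrow> complex \<Rightarrow> (real \<Rightarrow> complex) set" where
  "solutions C z = {u \<in> dom_tau C. AE x in lebesgue_on (sl_int C). tau C u x - z * u x = 0}"

definition L2_near_a :: "sl_expr \<Rightarrow> (real \<Rightarrow> complex) \<Rightarrow> bool" where
  "L2_near_a C u \<longleftrightarrow> (\<forall>c\<in>sl_int C. u \<in> L2 (weight C (sl_a C) (ereal c)))"

definition L2_near_b :: "sl_expr \<Rightarrow> (real \<Rightarrow> complex) \<Rightarrow> bool" where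
  "L2_near_b C u \<longleftrightarrow> (\<forall>c\<in>sl_int C. u \<in> L2 (weight C (ereal c) (sl_b C)))"

definition limit_circle_a :: "sl_expr \<Rightarrow> bool" where
  "limit_circle_a C \<longleftrightarrow> (\<forall>z. \<forall>u\<in>solutions C z. L2_near_a C u)"

definition limit_circle_b :: "sl_expr \<Rightarrow> bool" where
  "limit_circle_b C \<longleftrightarrow> (\<forall>z. \<forall>u\<in>solutions C z. L2_near_b C u)"

definition limit_point_a :: "sl_expr \<Rightarrow> bool" where
  "limit_point_a C \<longleftrightarrow> (\<forall>z. \<exists>u\<in>solutions C z. \<not> L2_near_a C u)"

definition limit_point_b :: "sl_expr \<Rightarrow> bool" where
  "limit_point_b C \<longleftrightarrow> (\<forall>z. \<exists>u\<in>solutions C z. \<not> L2_near_b C u)"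


section \<open>Boundary functionals\<close>

text \<open>One-sided approach to an endpoint, which may be infinite, as a filter on the reals.\<close>

definition to_a :: "sl_expr \<Rightarrow> real filter" where
  "to_a C = filtermap real_of_ereal (at_right (sl_a C))"

definition to_b :: "sl_expr \<Rightarrow> real filter" where
  "to_b C = filtermap real_of_ereal (at_left (sl_b C))"

definition cnj_fun :: "(real \<Rightarrow> complex) \<Rightarrow> real \<Rightarrow> complex" where
  "cnj_fun f = (\<lambda>x. cnj (f x))"

text \<open>The boundary value of the Wronskian at the endpoint given by the filter \<open>F\<close>; the limit
  exists for \<open>f\<close> and \<open>g\<close> in the domain of the maximal operator.\<close>

definition wronskian_lim ::
    "sl_expr \<Rightarrow> real filter \<Rightarrow> (real \<Rightarrow> complex) \<Rightarrow> (real \<Rightarrow> complex) \<Rightarrow> complex" where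
  "wronskian_lim C F f g = Lim F (wronskian C f g)"

definition boundary_pair ::
    "sl_expr \<Rightarrow> real filter \<Rightarrow> (real \<Rightarrow> complex) \<Rightarrow> (real \<Rightarrow> complex) \<Rightarrow> bool" where
  "boundary_pair C F w1 w2 \<longleftrightarrow>
     w1 \<in> dom_T_max C \<and> w2 \<in> dom_T_max C \<and>
     wronskian_lim C F w1 (cnj_fun w2) = 1 \<and>
     wronskian_lim C F w1 (cnj_fun w1) = 0 \<and>
     wronskian_lim C F w2 (cnj_fun w2) = 0"

definition BC1 ::
    "sl_expr \<Rightarrow> real filter \<Rightarrow> (real \<Rightarrow> complex) \<Rightarrow> (real \<Rightarrow> complex) \<Rightarrow> complex" where
  "BC1 C F w2 f = wronskian_lim C F f (cnj_fun w2)"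

definition BC2 ::
    "sl_expr \<Rightarrow> real filter \<Rightarrow> (real \<Rightarrow> complex) \<Rightarrow> (real \<Rightarrow> complex) \<Rightarrow> complex" where
  "BC2 C F w1 f = wronskian_lim C F (cnj_fun w1) f"

definition dom_BC ::
    "sl_expr \<Rightarrow> real filter \<Rightarrow> (real \<Rightarrow> complex) \<Rightarrow> (real \<Rightarrow> complex) \<Rightarrow> real \<Rightarrow>
     (real \<Rightarrow> complex) set" where
  "dom_BC C F w1 w2 \<phi> =
     {g \<in> dom_T_max C. BC1 C F w2 g * of_real (cos \<phi>) - BC2 C F w1 g * of_real (sin \<phi>) = 0}"

end

theory Submission
  imports Defs
begin

text \<open>
  Green's formula turns the self-adjointness of a restriction of the maximal operator into a question
  about the form \<open>W(f, cnj g)\<close> at the two endpoints.  At the limit-point endpoint the form vanishes: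
  from \<open>u W(f,g) = f W(u,g) - g W(u,f)\<close>, and since \<open>W(u,f)\<close> and \<open>W(u,g)\<close> are primitives of \<open>u\<close>
  times square-integrable functions, a nonzero limit of \<open>W(f,g)\<close> would yield a Gronwall-type bound
  making every solution \<open>u\<close> of \<open>\<tau>u = zu\<close> square-integrable there.  At the other endpoint
  Pluecker's identity gives \<open>W(f, cnj g) = BC1 f * cnj (BC2 g) - BC2 f * cnj (BC1 g)\<close>.  Hence the
  boundary values of a self-adjoint restriction form a subspace of \<open>\<complex>\<^sup>2\<close> that equals its own
  complement for this symplectic form, that is, a line spanned by some \<open>(sin \<phi>, cos \<phi>)\<close>.
  Conversely, a pair in the adjoint of such a restriction is a weak solution of \<open>\<tau>g = k\<close>; testing
  with compactly supported functions obtained by variation of constants shows that it is a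
  strong one.  Density of the domain follows by applying this to the pair \<open>(0, v)\<close> with \<open>v\<close>
  orthogonal to the domain.
\<close>

section \<open>Differentiation of indefinite integrals\<close>

text \<open>The coefficients are only locally integrable, so nothing here is differentiable in the
  classical sense. The calculus of locally absolutely continuous functions is therefore derived from
  the epsilon-delta definition, and the equation is treated as a first-order system for a function
  and its quasi-derivative, in which \<open>p\<close> enters only through its inverse. For the same
  reason smooth functions of compact support need not lie in the domain, and density is not
  immediate. Homogeneous solutions need not be square-integrable on the whole interval; a weak
  solution is compared with them on compact subintervals, and the local constants are matched
  afterwards. At the limit-point endpoint the bound needs no exponential: far enough out the
  integral of the known factors is small against the limit of the Wronskian, and the unknown term is
  absorbed. The angle is real because a vector \<open>(b1, b2)\<close> that pairs to zero with
  itself has \<open>b1 * cnj b2\<close> real.\<close>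

lemma negligible_indefinite_integral_not_differentiable:
  fixes f :: "real \<Rightarrow> 'a::euclidean_space"
  assumes f: "f integrable_on {c..d}"
  shows "negligible {x \<in> {c<..<d}.
           \<not> ((\<lambda>y. integral {c..y} f) has_vector_derivative f x) (at x)}"
proof -
  let ?F = "\<lambda>y. integral {c..y} f"
  \<comment> \<open>\<open>E n\<close> holds the points where difference quotients over arbitrarily
    short distances miss \<open>f x\<close> by at least \<open>1 / Suc n\<close>. The offending
    intervals form a Vitali cover of \<open>E n\<close>; disjoint ones chosen inside the gauge are a
    tagged partial division, and the Henstock lemma, which needs no absolute integrability, bounds
    their total length.\<close>
  define E where "E n = {x \<in> {c<..<d}. \<forall>\<delta>>0. \<exists>y\<in>{c..d}. y \<noteq> x \<and> \<bar>y - x\<bar> < \<delta> \<and>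
      \<bar>y - x\<bar> \<le> real (Suc n) * norm (?F y - ?F x - (y - x) *\<^sub>R f x)}" for n
  have neg: "negligible (E n)" for n
    unfolding negligible_outer_le
  proof (intro allI impI)
    fix e :: real assume "e > 0"
    \<comment> \<open>A chosen interval is at most \<open>Suc n\<close> times as long as its
      Henstock error, so errors summing to less than \<open>e'\<close> give total length at most
      \<open>e / 2\<close>. The other half of \<open>e\<close> is spent on the null set that the
      intervals leave uncovered.\<close>
    define e' where "e' = e / (2 * Suc n)"
    have "e' > 0" using \<open>e > 0\<close> by (simp add: e'_def)
    obtain \<gamma> where "gauge \<gamma>" and \<gamma>: "\<And>p. \<lbrakk>p tagged_partial_division_of (cbox c d); \<gamma> fine p\<rbrakk> \<Longrightarrow>
        (\<Sum>(x,k)\<in>p. norm (measure lborel k *\<^sub>R f x - integral k f)) < e'"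
      using Henstock_lemma[of f c d e'] f \<open>e' > 0\<close> by (auto simp: cbox_interval)
    define lo hi where "lo = (\<lambda>(x,y). min x y :: real)" and "hi = (\<lambda>(x,y). max x y :: real)"
    define K where "K = {(x,y). x \<in> E n \<and> y \<in> {c..d} \<and> y \<noteq> x \<and> {min x y..max x y} \<subseteq> \<gamma> x \<and>
        \<bar>y - x\<bar> \<le> real (Suc n) * norm (?F y - ?F x - (y - x) *\<^sub>R f x)}"
    define a r where "a = (\<lambda>i. (lo i + hi i) / 2)" and "r = (\<lambda>i. (hi i - lo i) / 2)"
    have cball: "cball (a i) (r i) = {lo i..hi i}" for i
      by (auto simp: cball_eq_atLeastAtMost a_def r_def field_simps)
    have lohi: "lo i < hi i" "lo i \<in> {c..d}" "hi i \<in> {c..d}" "fst i \<in> {lo i..hi i}"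
       "{lo i..hi i} \<subseteq> \<gamma> (fst i)"
       "hi i - lo i \<le> Suc n * norm (measure lborel {lo i..hi i} *\<^sub>R f (fst i) - integral {lo i..hi i} f)"
       if "i \<in> K" for i
    proof -
      obtain x y where i: "i = (x,y)" by (cases i)
      have x: "x \<in> {c<..<d}" and y: "y \<in> {c..d}" "y \<noteq> x"
        and le: "\<bar>y - x\<bar> \<le> real (Suc n) * norm (?F y - ?F x - (y - x) *\<^sub>R f x)"
        and sub: "{min x y..max x y} \<subseteq> \<gamma> x"
        using that by (auto simp: K_def i E_def)
      show "lo i < hi i" "lo i \<in> {c..d}" "hi i \<in> {c..d}" "fst i \<in> {lo i..hi i}"
       "{lo i..hi i} \<subseteq> \<gamma> (fst i)"
        using x y sub by (auto simp: i lo_def hi_def)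
      have comb: "integral {u..v} f = ?F v - ?F u" if "u \<in> {c..d}" "v \<in> {c..d}" "u \<le> v" for u v
      proof -
        have "integral {c..u} f + integral {u..v} f = integral {c..v} f"
          using that by (intro Henstock_Kurzweil_Integration.integral_combine
              integrable_on_subinterval[OF f]) auto
        then show ?thesis by (simp add: algebra_simps)
      qed
      have "norm (?F y - ?F x - (y - x) *\<^sub>R f x)
          = norm (measure lborel {lo i..hi i} *\<^sub>R f x - integral {lo i..hi i} f)"
      proof (cases "x < y")
        case True
        then show ?thesis using comb[of x y] x y
          by (simp add: i lo_def hi_def norm_minus_commute)
      next
        case False
        then have "integral {y..x} f = ?F x - ?F y" using comb[of y x] x y by simp
        then have "?F y - ?F x - (y - x) *\<^sub>R f x = measure lborel {y..x} *\<^sub>R f x - integral {y..x} f"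
          using False by (simp add: algebra_simps)
        then show ?thesis using False y
          by (simp add: i lo_def hi_def min_absorb2 max_absorb1)
      qed
      then show "hi i - lo i \<le> Suc n * norm (measure lborel {lo i..hi i} *\<^sub>R f (fst i) - integral {lo i..hi i} f)"
        using le by (simp add: i lo_def hi_def abs_if max_def min_def split: if_splits)
    qed
    obtain C where "countable C" "C \<subseteq> K"
      and disj: "pairwise (\<lambda>i j. disjnt (cball (a i) (r i)) (cball (a j) (r j))) C"
      and negC: "negligible (E n - (\<Union>i \<in> C. cball (a i) (r i)))"
    proof (rule Vitali_covering_theorem_cballs[of K r "E n" a])
      show "0 < r i" if "i \<in> K" for i using lohi[OF that] by (simp add: r_def)
      fix x \<delta> :: real assume x: "x \<in> E n" and "\<delta> > 0"
      from \<open>gauge \<gamma>\<close> have "open (\<gamma> x)" "x \<in> \<gamma> x" by (auto simp: gauge_def)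
      then obtain \<eta> where "\<eta> > 0" and \<eta>: "ball x \<eta> \<subseteq> \<gamma> x" by (meson openE)
      have "min \<delta> \<eta> > 0" using \<open>\<delta> > 0\<close> \<open>\<eta> > 0\<close> by simp
      with x obtain y where y: "y \<in> {c..d}" "y \<noteq> x" "\<bar>y - x\<bar> < min \<delta> \<eta>"
        "\<bar>y - x\<bar> \<le> real (Suc n) * norm (?F y - ?F x - (y - x) *\<^sub>R f x)"
        unfolding E_def by blast
      have "{min x y..max x y} \<subseteq> ball x \<eta>" using y(3) by (auto simp: dist_real_def)
      then have "(x, y) \<in> K" using x y \<eta> by (auto simp: K_def)
      moreover have "x \<in> cball (a (x,y)) (r (x,y))" unfolding cball by (simp add: lo_def hi_def)
      moreover have "r (x,y) < \<delta>" using y(3) \<open>\<delta> > 0\<close> by (auto simp: r_def lo_def hi_def)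
      ultimately show "\<exists>i. i \<in> K \<and> x \<in> cball (a i) (r i) \<and> r i < \<delta>" by blast
    qed
    have fin: "measure lebesgue (\<Union>i\<in>I. cball (a i) (r i)) \<le> e / 2" if I: "I \<subseteq> C" "finite I" for I
    proof -
      let ?p = "(\<lambda>i. (fst i, {lo i..hi i})) ` I"
      have IK: "i \<in> K" if "i \<in> I" for i using that I \<open>C \<subseteq> K\<close> by auto
      have dj: "{lo i..hi i} \<inter> {lo j..hi j} = {}" if "i \<in> I" "j \<in> I" "i \<noteq> j" for i j
        using disj that I unfolding pairwise_def cball disjnt_def by blast
      have ne: "{lo i..hi i} \<noteq> {}" if "i \<in> I" for i using lohi[OF IK[OF that]] by auto
      have inj: "inj_on (\<lambda>i. (fst i, {lo i..hi i})) I"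
        by (rule inj_onI) (use dj ne in \<open>metis Int_absorb snd_conv\<close>)
      have "?p tagged_partial_division_of (cbox c d)"
        unfolding tagged_partial_division_of_def
      proof (intro conjI allI impI)
        show "finite ?p" using I by simp
        fix x k
        assume "(x, k) \<in> ?p"
        then obtain i where i: "i \<in> I" "x = fst i" "k = {lo i..hi i}" by auto
        show "x \<in> k" "k \<subseteq> cbox c d" using lohi[OF IK[OF i(1)]] i by auto
        show "\<exists>a b. k = cbox a b" using i by (metis cbox_interval)
      next
        fix x k x' k' assume xk: "(x, k) \<in> ?p \<and> (x', k') \<in> ?p \<and> (x, k) \<noteq> (x', k')"
        then obtain i where i: "i \<in> I" "x = fst i" "k = {lo i..hi i}" by auto
        from xk have xk': "(x', k') \<in> ?p" and "(x, k) \<noteq> (x', k')" by auto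
        then obtain j where j: "j \<in> I" "x' = fst j" "k' = {lo j..hi j}" "i \<noteq> j" using i by auto
        then show "interior k \<inter> interior k' = {}" using dj[OF i(1) j(1)] i j interior_subset by blast
      qed
      moreover have "\<gamma> fine ?p" using lohi(5)[OF IK] by (auto simp: fine_def)
      ultimately have "(\<Sum>(x,k)\<in>?p. norm (measure lborel k *\<^sub>R f x - integral k f)) < e'" by (rule \<gamma>)
      then have sum: "(\<Sum>i\<in>I. norm (measure lborel {lo i..hi i} *\<^sub>R f (fst i) - integral {lo i..hi i} f)) < e'"
        by (subst (asm) sum.reindex[OF inj]) (simp add: o_def)
      have "measure lebesgue (\<Union>i\<in>I. cball (a i) (r i)) \<le> (\<Sum>i\<in>I. measure lebesgue (cball (a i) (r i)))"
        by (rule measure_UNION_le) (use I in auto)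
      also have "\<dots> = (\<Sum>i\<in>I. hi i - lo i)"
        unfolding cball by (intro sum.cong refl) (use lohi(1)[OF IK] in \<open>force simp: less_imp_le\<close>)
      also have "\<dots> \<le> (\<Sum>i\<in>I. Suc n * norm (measure lborel {lo i..hi i} *\<^sub>R f (fst i) - integral {lo i..hi i} f))"
        by (intro sum_mono lohi IK)
      also have "\<dots> \<le> Suc n * e'"
        unfolding sum_distrib_left[symmetric] using sum by (intro mult_left_mono) auto
      also have "\<dots> = e / 2" by (simp add: e'_def field_simps)
      finally show ?thesis .
    qed
    have meas: "(\<Union>i\<in>C. cball (a i) (r i)) \<in> lmeasurable"
      and le: "measure lebesgue (\<Union>i\<in>C. cball (a i) (r i)) \<le> e / 2"
      using fmeasurable_UN_bound[OF \<open>countable C\<close>, of "\<lambda>i. cball (a i) (r i)" lebesgue "e/2"]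
        measure_UN_bound[OF \<open>countable C\<close>, of "\<lambda>i. cball (a i) (r i)" lebesgue "e/2"] fin by auto
    obtain T where T: "E n - (\<Union>i \<in> C. cball (a i) (r i)) \<subseteq> T" "T \<in> lmeasurable" "measure lebesgue T \<le> e / 2"
      using negC \<open>e > 0\<close> unfolding negligible_outer_le by (metis half_gt_zero)
    show "\<exists>T. E n \<subseteq> T \<and> T \<in> lmeasurable \<and> measure lebesgue T \<le> e"
    proof (intro exI conjI)
      show "E n \<subseteq> T \<union> (\<Union>i\<in>C. cball (a i) (r i))" using T by auto
      show "T \<union> (\<Union>i\<in>C. cball (a i) (r i)) \<in> lmeasurable" using T meas by auto
      show "measure lebesgue (T \<union> (\<Union>i\<in>C. cball (a i) (r i))) \<le> e"
        using measure_Un_le[of T lebesgue "\<Union>i\<in>C. cball (a i) (r i)"] T meas le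
        by (auto simp: fmeasurableD)
    qed
  qed
  have "{x \<in> {c<..<d}. \<not> (?F has_vector_derivative f x) (at x)} \<subseteq> (\<Union>n. E n)"
  proof (clarsimp)
    fix x assume x: "c < x" "x < d" and nd: "\<not> (?F has_vector_derivative f x) (at x)"
    show "\<exists>n. x \<in> E n"
    proof (rule ccontr)
      assume neg: "\<nexists>n. x \<in> E n"
      have "(?F has_vector_derivative f x) (at x)"
        unfolding has_vector_derivative_def has_derivative_at_alt
      proof (intro conjI allI impI bounded_linear_scaleR_left)
        fix e :: real assume "e > 0"
        obtain n where n: "1 / Suc n < e" using \<open>e > 0\<close> nat_approx_posE by blast
        have "x \<notin> E n" using neg by blast
        then have "\<exists>\<delta>>0. \<forall>y. y \<in> {c..d} \<and> y \<noteq> x \<and> \<bar>y - x\<bar> < \<delta> \<longrightarrow>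
           \<not> \<bar>y - x\<bar> \<le> real (Suc n) * norm (?F y - ?F x - (y - x) *\<^sub>R f x)"
          unfolding E_def using x by force
        then obtain \<delta> where "\<delta> > 0" and \<delta>: "\<And>y. \<lbrakk>y \<in> {c..d}; y \<noteq> x; \<bar>y - x\<bar> < \<delta>\<rbrakk> \<Longrightarrow>
           \<not> \<bar>y - x\<bar> \<le> real (Suc n) * norm (?F y - ?F x - (y - x) *\<^sub>R f x)"
          by blast
        show "\<exists>\<delta>>0. \<forall>y. norm (y - x) < \<delta> \<longrightarrow> norm (?F y - ?F x - (y - x) *\<^sub>R f x) \<le> e * norm (y - x)"
        proof (intro exI[of _ "min \<delta> (min (x - c) (d - x))"] conjI allI impI)
          show "min \<delta> (min (x - c) (d - x)) > 0" using \<open>\<delta> > 0\<close> x by simp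
          fix y assume y: "norm (y - x) < min \<delta> (min (x - c) (d - x))"
          show "norm (?F y - ?F x - (y - x) *\<^sub>R f x) \<le> e * norm (y - x)"
          proof (cases "y = x")
            case False
            have "real (Suc n) * norm (?F y - ?F x - (y - x) *\<^sub>R f x) \<le> \<bar>y - x\<bar>"
            proof -
              have "y \<in> {c..d}" using y by (auto simp: abs_if split: if_splits)
              then show ?thesis using \<delta>[of y] y False by (auto simp: not_le)
            qed
            then have "norm (?F y - ?F x - (y - x) *\<^sub>R f x) \<le> (1 / Suc n) * \<bar>y - x\<bar>"
              by (simp add: field_simps)
            also have "\<dots> \<le> e * \<bar>y - x\<bar>" using n by (intro mult_right_mono) auto
            finally show ?thesis by simp
          qed simp
        qed
      qed
      with nd show False by simp
    qed
  qed
  moreover have "negligible (\<Union>n. E n)" using neg by (rule negligible_Union_nat)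
  ultimately show ?thesis by (rule negligible_subset[rotated])
qed

section \<open>Absolutely continuous functions are indefinite integrals\<close>

text \<open>The function \<open>norm (f x)\<close> is cut at a height \<open>n\<close> so large that
  the part above the cut has integral below \<open>\<epsilon> / 2\<close>; the part below
  contributes at most \<open>n\<close> times the total length of the intervals.\<close>

lemma abs_cont_on_indefinite_integral:
  fixes f :: "real \<Rightarrow> complex"
  assumes f: "f absolutely_integrable_on {c..d}"
  shows "abs_cont_on c d (\<lambda>x. integral {c..x} f)"
  unfolding abs_cont_on_def
proof (intro allI impI)
  fix \<epsilon> :: real assume "\<epsilon> > 0"
  define g where "g = (\<lambda>x. norm (f x))"
  have g: "g absolutely_integrable_on {c..d}"
    unfolding g_def by (rule set_integrable_norm[OF f])
  have gm: "(\<lambda>x. min (g x) (real n)) absolutely_integrable_on {c..d}" for n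
    by (intro absolutely_integrable_min_1 g absolutely_integrable_on_const) auto
  have h: "(\<lambda>x. g x - min (g x) (real n)) absolutely_integrable_on {c..d}" for n
    by (intro set_integral_diff g gm)
  have "(\<lambda>n. integral {c..d} (\<lambda>x. g x - min (g x) (real n))) \<longlonglongrightarrow> integral {c..d} (\<lambda>x. 0::real)"
  proof (rule dominated_convergence(2))
    show "(\<lambda>x. g x - min (g x) (real n)) integrable_on {c..d}" for n
      using h set_lebesgue_integral_eq_integral(1) by blast
    show "g integrable_on {c..d}" using g set_lebesgue_integral_eq_integral(1) by blast
    show "norm (g x - min (g x) (real n)) \<le> g x" for n x by (auto simp: g_def min_def)
    show "(\<lambda>n. g x - min (g x) (real n)) \<longlonglongrightarrow> 0" for x
    proof (rule tendsto_eventually)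
      obtain N where "g x \<le> real N" using real_arch_simple by blast
      then show "\<forall>\<^sub>F n in sequentially. g x - min (g x) (real n) = 0"
        unfolding eventually_sequentially by (intro exI[of _ N]) auto
    qed
  qed
  then have "(\<lambda>n. integral {c..d} (\<lambda>x. g x - min (g x) (real n))) \<longlonglongrightarrow> 0" by simp
  from order_tendstoD(2)[OF this, of "\<epsilon>/2"] \<open>\<epsilon> > 0\<close>
  obtain n where n: "integral {c..d} (\<lambda>x. g x - min (g x) (real n)) < \<epsilon>/2"
    by (auto simp: eventually_sequentially)
  show "\<exists>\<delta>>0. \<forall>\<D>. \<D> division_of \<Union> \<D> \<and> \<Union> \<D> \<subseteq> {c..d} \<and> (\<Sum>K\<in>\<D>. Sup K - Inf K) < \<delta> \<longrightarrow>
           (\<Sum>K\<in>\<D>. norm (integral {c..Sup K} f - integral {c..Inf K} f)) < \<epsilon>"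
  proof (intro exI[of _ "\<epsilon> / (2 * Suc n)"] conjI allI impI)
    show "\<epsilon> / (2 * Suc n) > 0" using \<open>\<epsilon> > 0\<close> by simp
    fix \<D> :: "real set set" assume *: "\<D> division_of \<Union> \<D> \<and> \<Union> \<D> \<subseteq> {c..d} \<and> (\<Sum>K\<in>\<D>. Sup K - Inf K) < \<epsilon> / (2 * Suc n)"
    then have D: "\<D> division_of \<Union> \<D>" "\<Union> \<D> \<subseteq> {c..d}" and le: "(\<Sum>K\<in>\<D>. Sup K - Inf K) < \<epsilon> / (2 * Suc n)" by auto
    have K: "K = {Inf K..Sup K} \<and> Inf K \<le> Sup K \<and> c \<le> Inf K \<and> Sup K \<le> d" if "K \<in> \<D>" for K
    proof -
      obtain a b where K: "K = cbox a b" "K \<noteq> {}" "K \<subseteq> \<Union>\<D>"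
        using division_ofD[OF D(1)] \<open>K \<in> \<D>\<close> by (metis)
      then have "a \<le> b" "K = {a..b}" by auto
      moreover have "K \<subseteq> {c..d}" using K(3) D(2) by simp
      ultimately show ?thesis by auto
    qed
    have intK: "F integrable_on K" if "F absolutely_integrable_on {c..d}" "K \<in> \<D>" for F :: "real \<Rightarrow> 'b::euclidean_space" and K
      using that K[OF that(2)] set_lebesgue_integral_eq_integral(1) integrable_on_subinterval
      by (metis atLeastatMost_subset_iff)
    let ?h = "\<lambda>x. g x - min (g x) (real n)"
    have "(\<Sum>K\<in>\<D>. norm (integral {c..Sup K} f - integral {c..Inf K} f)) = (\<Sum>K\<in>\<D>. norm (integral K f))"
    proof (intro sum.cong refl arg_cong[where f = norm])
      fix K assume KD: "K \<in> \<D>"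
      note k = K[OF KD]
      have "integral {c..Inf K} f + integral {Inf K..Sup K} f = integral {c..Sup K} f"
        using k f by (intro Henstock_Kurzweil_Integration.integral_combine)
          (auto intro: integrable_on_subinterval[OF set_lebesgue_integral_eq_integral(1)[OF f]])
      then show "integral {c..Sup K} f - integral {c..Inf K} f = integral K f"
        using k by (metis add_diff_cancel_left')
    qed
    also have "\<dots> \<le> (\<Sum>K\<in>\<D>. integral K ?h + n * (Sup K - Inf K))"
    proof (intro sum_mono)
      fix K assume KD: "K \<in> \<D>"
      note k = K[OF KD]
      have "norm (integral K f) \<le> integral K g"
        by (rule integral_norm_bound_integral[OF intK[OF f KD] intK[OF g KD]]) (simp add: g_def)
      also have "\<dots> = integral K ?h + integral K (\<lambda>x. min (g x) (real n))"
        using Henstock_Kurzweil_Integration.integral_add[OF intK[OF h[of n] KD] intK[OF gm[of n] KD]] by simp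
      also have "integral K (\<lambda>x. min (g x) (real n)) \<le> integral K (\<lambda>x. real n)"
        by (rule integral_le[OF intK[OF gm KD]]) (use k in \<open>metis integrable_const_ivl\<close>, simp)
      also have "integral K (\<lambda>x. real n) = n * (Sup K - Inf K)"
        using k by (metis integral_const_real measure_lborel_Icc mult.commute real_scaleR_def)
      finally show "norm (integral K f) \<le> integral K ?h + n * (Sup K - Inf K)" by simp
    qed
    also have "\<dots> = (\<Sum>K\<in>\<D>. integral K ?h) + n * (\<Sum>K\<in>\<D>. Sup K - Inf K)"
      by (simp add: sum.distrib sum_distrib_left)
    also have "(\<Sum>K\<in>\<D>. integral K ?h) \<le> integral {c..d} ?h"
    proof -
      have 1: "?h absolutely_integrable_on \<Union>\<D>"
        by (rule set_integrable_subset[OF h]) (use D division_of_finite[OF D(1)] intK in \<open>auto intro!: sets.finite_Union dest: division_ofD(4)\<close>)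
      have "(\<Sum>K\<in>\<D>. integral K ?h) = integral (\<Union>\<D>) ?h"
        using integral_combine_division_topdown[OF set_lebesgue_integral_eq_integral(1)[OF 1] D(1)] by simp
      also have "\<dots> \<le> integral {c..d} ?h"
        by (rule integral_subset_le[OF D(2) set_lebesgue_integral_eq_integral(1)[OF 1] set_lebesgue_integral_eq_integral(1)[OF h]]) (simp add: min_def)
      finally show ?thesis .
    qed
    also have "n * (\<Sum>K\<in>\<D>. Sup K - Inf K) \<le> n * (\<epsilon> / (2 * Suc n))"
      using le by (intro mult_left_mono) auto
    also have "n * (\<epsilon> / (2 * Suc n)) \<le> \<epsilon>/2"
      using \<open>\<epsilon> > 0\<close> by (simp add: field_simps)
    finally show "(\<Sum>K\<in>\<D>. norm (integral {c..Sup K} f - integral {c..Inf K} f)) < \<epsilon>" using n by simp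
  qed
qed

text \<open>Indexed families rather than sets of intervals, so that families with degenerate or
  coinciding members can be clipped and combined.\<close>

definition nonoverlapping :: "'i set \<Rightarrow> ('i \<Rightarrow> real) \<Rightarrow> ('i \<Rightarrow> real) \<Rightarrow> bool" where
  "nonoverlapping T l u \<longleftrightarrow> finite T \<and> (\<forall>i\<in>T. l i \<le> u i) \<and>
     (\<forall>i\<in>T. \<forall>j\<in>T. i \<noteq> j \<longrightarrow> {l i<..<u i} \<inter> {l j<..<u j} = {})"

lemma nonoverlappingD:
  assumes "nonoverlapping T l u"
  shows "finite T" "i \<in> T \<Longrightarrow> l i \<le> u i"
    "i \<in> T \<Longrightarrow> j \<in> T \<Longrightarrow> i \<noteq> j \<Longrightarrow> {l i<..<u i} \<inter> {l j<..<u j} = {}"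
  using assms unfolding nonoverlapping_def by blast+

text \<open>Degenerate members add nothing to either sum and are dropped. On the rest the passage to
  closed intervals is injective, since two equal intervals of positive length would overlap; so no
  increment is lost when the family becomes the set of intervals required by
  \<open>abs_cont_on\<close>.\<close>

lemma abs_cont_on_indexed:
  assumes f: "abs_cont_on c d f" and "\<epsilon> > 0"
  shows "\<exists>\<delta>>0. \<forall>(T::'i set) l u. nonoverlapping T l u \<longrightarrow> (\<forall>i\<in>T. c \<le> l i \<and> u i \<le> d) \<longrightarrow>
    (\<Sum>i\<in>T. u i - l i) < \<delta> \<longrightarrow> (\<Sum>i\<in>T. norm (f (u i) - f (l i))) < \<epsilon>"
proof -
  from f \<open>\<epsilon> > 0\<close> obtain \<delta> where "\<delta> > 0"
    and ac: "\<forall>\<D>. \<D> division_of \<Union>\<D> \<and> \<Union>\<D> \<subseteq> {c..d} \<and> (\<Sum>K\<in>\<D>. Sup K - Inf K) < \<delta>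
        \<longrightarrow> (\<Sum>K\<in>\<D>. norm (f (Sup K) - f (Inf K))) < \<epsilon>"
    unfolding abs_cont_on_def by meson
  note \<delta> = ac[rule_format, OF conjI, OF _ conjI]
  show ?thesis
  proof (intro exI[of _ \<delta>] conjI allI impI \<open>\<delta> > 0\<close>)
    fix T :: "'i set" and l u
    assume no: "nonoverlapping T l u" and sub: "\<forall>i\<in>T. c \<le> l i \<and> u i \<le> d"
      and small: "(\<Sum>i\<in>T. u i - l i) < \<delta>"
    define T' where "T' = {i \<in> T. l i < u i}"
    define K where "K i = {l i..u i}" for i
    have fin: "finite T" "finite T'" using nonoverlappingD(1)[OF no] by (simp_all add: T'_def)
    have dj: "{l i<..<u i} \<inter> {l j<..<u j} = {}" if "i \<in> T'" "j \<in> T'" "i \<noteq> j" for i j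
      using nonoverlappingD(3)[OF no] that by (simp add: T'_def)
    have inj: "inj_on K T'"
    proof (rule inj_onI)
      fix i j assume ij: "i \<in> T'" "j \<in> T'" "K i = K j"
      then have "l i = l j" "u i = u j" by (auto simp: K_def T'_def)
      moreover have "l i < u i" using ij by (simp add: T'_def)
      ultimately show "i = j" using dj[OF ij(1,2)] by auto
    qed
    have eq: "(\<Sum>i\<in>T. F (u i) (l i)) = (\<Sum>L\<in>K ` T'. F (Sup L) (Inf L))" if "\<And>x. F x x = 0"
      for F :: "real \<Rightarrow> real \<Rightarrow> real"
    proof -
      have "(\<Sum>i\<in>T. F (u i) (l i)) = (\<Sum>i\<in>T'. F (u i) (l i))"
      proof (rule sum.mono_neutral_right)
        show "\<forall>i\<in>T - T'. F (u i) (l i) = 0"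
        proof
          fix i assume "i \<in> T - T'"
          then have "l i = u i" using nonoverlappingD(2)[OF no, of i] by (simp add: T'_def)
          then show "F (u i) (l i) = 0" by (simp add: that)
        qed
      qed (use fin in \<open>auto simp: T'_def\<close>)
      also have "\<dots> = (\<Sum>L\<in>K ` T'. F (Sup L) (Inf L))"
        by (subst sum.reindex[OF inj]) (auto intro!: sum.cong simp: K_def T'_def)
      finally show ?thesis .
    qed
    have "(K ` T') division_of \<Union>(K ` T')"
    proof (rule division_ofI)
      show "finite (K ` T')" using fin by simp
      fix L assume "L \<in> K ` T'"
      then show "L \<subseteq> \<Union>(K ` T')" by blast
      show "L \<noteq> {}" "\<exists>a b. L = cbox a b"
        using \<open>L \<in> K ` T'\<close> by (auto simp: K_def T'_def)
      fix L' assume "L' \<in> K ` T'" "L \<noteq> L'"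
      with \<open>L \<in> K ` T'\<close> obtain i j where "i \<in> T'" "j \<in> T'" "i \<noteq> j" "L = K i" "L' = K j" by blast
      then show "interior L \<inter> interior L' = {}" using dj[of i j] by (simp add: K_def)
    qed simp
    moreover have "K i \<subseteq> {c..d}" if "i \<in> T'" for i
      using sub that by (auto simp: K_def T'_def)
    then have "\<Union>(K ` T') \<subseteq> {c..d}" by blast
    moreover have "(\<Sum>L\<in>K ` T'. Sup L - Inf L) < \<delta>"
      using small eq[of "\<lambda>x y. x - y"] by simp
    ultimately have "(\<Sum>L\<in>K ` T'. norm (f (Sup L) - f (Inf L))) < \<epsilon>"
      by (rule \<delta>)
    then show "(\<Sum>i\<in>T. norm (f (u i) - f (l i))) < \<epsilon>"
      using eq[of "\<lambda>x y. norm (f x - f y)"] by simp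
  qed
qed

section \<open>The positive variation of an absolutely continuous function\<close>

definition variation_sums :: "(real \<Rightarrow> real) \<Rightarrow> real \<Rightarrow> real \<Rightarrow> real set" where
  "variation_sums g x y = {\<Sum>i\<in>T. g (u i) - g (l i) |T l u.
      nonoverlapping (T::nat set) l u \<and> (\<forall>i\<in>T. x \<le> l i \<and> u i \<le> y)}"

text \<open>The increments in \<open>variation_sums\<close> carry their sign, so the supremum is the
  positive and not the total variation.\<close>

definition pos_variation :: "(real \<Rightarrow> real) \<Rightarrow> real \<Rightarrow> real \<Rightarrow> real" where
  "pos_variation g x y = Sup (variation_sums g x y)"

lemma variation_sums_mono: "x' \<le> x \<Longrightarrow> y \<le> y' \<Longrightarrow> variation_sums g x y \<subseteq> variation_sums g x' y'"
  unfolding variation_sums_def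
proof (clarify, intro exI conjI ballI)
  fix T :: "nat set" and l u i
  assume "x' \<le> x" "y \<le> y'" "\<forall>i\<in>T. x \<le> l i \<and> u i \<le> y" "i \<in> T"
  then have "x \<le> l i" "u i \<le> y" by auto
  then show "x' \<le> l i" "u i \<le> y'" using \<open>x' \<le> x\<close> \<open>y \<le> y'\<close> by linarith+
qed (rule refl, assumption)

lemma zero_in_variation_sums: "0 \<in> variation_sums g x y"
  unfolding variation_sums_def nonoverlapping_def
  by (intro CollectI exI[of _ "{}"] exI[of _ "\<lambda>_. 0"]) auto

lemma nonoverlapping_clamp:
  assumes "nonoverlapping T l u"
  shows "nonoverlapping T (\<lambda>i. max x (min y (l i))) (\<lambda>i. max x (min y (u i)))"
proof -
  have "{max x (min y (l i))<..<max x (min y (u i))} \<subseteq> {l i<..<u i}" for i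
    by auto
  then have "{max x (min y (l i))<..<max x (min y (u i))} \<inter> {max x (min y (l j))<..<max x (min y (u j))}
     \<subseteq> {l i<..<u i} \<inter> {l j<..<u j}" for i j
    by (intro Int_mono)
  moreover have "max x (min y (l i)) \<le> max x (min y (u i))" if "l i \<le> u i" for i
    using that by (auto simp: max_def min_def)
  ultimately show ?thesis
    using assms unfolding nonoverlapping_def
    by (intro conjI ballI impI) (simp, simp, rule subset_empty[THEN iffD1], rule order_trans, assumption, simp)
qed

text \<open>Every interval is clamped to both sides of \<open>y\<close>. At each endpoint
  \<open>g\<close> is the sum of its values at the two clamped points minus \<open>g y\<close>, and
  this constant cancels in the increments.\<close>

lemma variation_sums_split:
  assumes "v \<in> variation_sums g x z" "x \<le> y" "y \<le> z"
  obtains v1 v2 where "v = v1 + v2" "v1 \<in> variation_sums g x y" "v2 \<in> variation_sums g y z"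
proof -
  obtain T :: "nat set" and l u where v: "v = (\<Sum>i\<in>T. g (u i) - g (l i))" and no: "nonoverlapping T l u"
    and sub: "\<And>i. i \<in> T \<Longrightarrow> x \<le> l i \<and> u i \<le> z" using assms(1) by (auto simp: variation_sums_def)
  let ?c = "\<lambda>t. max x (min y t)" and ?d = "\<lambda>t. max y (min z t)"
  have lu: "l i \<le> u i" if "i \<in> T" for i using nonoverlappingD(2)[OF no that] .
  have g: "g t = g (?c t) + g (?d t) - g y" if "x \<le> t" "t \<le> z" for t
  proof (cases "t \<le> y")
    case True then have "?c t = t" "?d t = y" using that assms(2,3) by simp_all
    then show ?thesis by simp
  next
    case False then have "?c t = y" "?d t = t" using that assms(2,3) by simp_all
    then show ?thesis by simp
  qed
  have "v = (\<Sum>i\<in>T. g (?c (u i)) - g (?c (l i))) + (\<Sum>i\<in>T. g (?d (u i)) - g (?d (l i)))"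
    unfolding v sum.distrib[symmetric]
  proof (intro sum.cong refl)
    fix i assume "i \<in> T"
    then have "x \<le> l i" "l i \<le> u i" "u i \<le> z" using sub lu by simp_all
    then have "x \<le> l i" "l i \<le> z" "x \<le> u i" "u i \<le> z" by simp_all
    then show "g (u i) - g (l i) = g (?c (u i)) - g (?c (l i)) + (g (?d (u i)) - g (?d (l i)))"
      using g[of "u i"] g[of "l i"] by simp
  qed
  moreover have "(\<Sum>i\<in>T. g (?c (u i)) - g (?c (l i))) \<in> variation_sums g x y"
    unfolding variation_sums_def
    by (intro CollectI exI[of _ T] exI[of _ "\<lambda>i. ?c (l i)"] exI[of _ "\<lambda>i. ?c (u i)"] conjI, rule refl, rule nonoverlapping_clamp[OF no]) (use assms in \<open>simp add: max_def min_def\<close>)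
  moreover have "(\<Sum>i\<in>T. g (?d (u i)) - g (?d (l i))) \<in> variation_sums g y z"
    unfolding variation_sums_def
    by (intro CollectI exI[of _ T] exI[of _ "\<lambda>i. ?d (l i)"] exI[of _ "\<lambda>i. ?d (u i)"] conjI, rule refl, rule nonoverlapping_clamp[OF no]) (use assms in \<open>simp add: max_def min_def\<close>)
  ultimately show thesis by (rule that)
qed

lemma variation_sums_insert:
  assumes "v \<in> variation_sums g x y" "x \<le> y" "y \<le> z"
  shows "v + (g z - g y) \<in> variation_sums g x z"
proof -
  obtain T :: "nat set" and l u where v: "v = (\<Sum>i\<in>T. g (u i) - g (l i))" and no: "nonoverlapping T l u"
    and sub: "\<And>i. i \<in> T \<Longrightarrow> x \<le> l i \<and> u i \<le> y" using assms(1) by (auto simp: variation_sums_def)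
  have "finite T" using nonoverlappingD(1)[OF no] .
  then obtain m where m: "m \<notin> T" using ex_new_if_finite infinite_UNIV_nat by blast
  let ?T = "insert m T" and ?l = "l(m := y)" and ?u = "u(m := z)"
  have "nonoverlapping ?T ?l ?u"
    unfolding nonoverlapping_def
  proof (intro conjI ballI impI)
    have *: "{l i<..<u i} \<inter> {y<..<z} = {}" if "i \<in> T" for i
      using sub[OF that] by auto
    fix i j assume ij: "i \<in> ?T" "j \<in> ?T" "i \<noteq> j"
    consider "i = m" "j \<in> T" "j \<noteq> m" | "j = m" "i \<in> T" "i \<noteq> m" | "i \<noteq> m" "j \<noteq> m" "i \<in> T" "j \<in> T"
      using ij by blast
    then show "{?l i<..<?u i} \<inter> {?l j<..<?u j} = {}"
    proof cases
      case 1 then show ?thesis using *[of j] by (simp add: Int_commute)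
    next
      case 2 then show ?thesis using *[of i] by simp
    next
      case 3 then show ?thesis using nonoverlappingD(3)[OF no] ij by simp
    qed
  qed (use nonoverlappingD(2)[OF no] m assms(3) \<open>finite T\<close> in auto)
  moreover have "\<forall>i\<in>?T. x \<le> ?l i \<and> ?u i \<le> z"
  proof
    fix i assume "i \<in> ?T"
    then show "x \<le> ?l i \<and> ?u i \<le> z"
      using sub[of i] assms(2,3) by (cases "i = m") auto
  qed
  moreover have "v + (g z - g y) = (\<Sum>i\<in>?T. g (?u i) - g (?l i))"
  proof -
    have "(\<Sum>i\<in>T. g (?u i) - g (?l i)) = v" unfolding v using m by (intro sum.cong) auto
    then show ?thesis using \<open>finite T\<close> m by simp
  qed
  ultimately show ?thesis
    unfolding variation_sums_def by (intro CollectI exI[of _ ?T] exI[of _ ?l] exI[of _ ?u] conjI)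
qed

lemma nonoverlapping_length_le:
  assumes no: "nonoverlapping T l u" and sub: "\<And>i. i \<in> T \<Longrightarrow> x \<le> l i \<and> u i \<le> y" and "x \<le> y"
  shows "(\<Sum>i\<in>T. u i - l i) \<le> y - x"
proof -
  note no' = nonoverlappingD[OF no]
  have "(\<Sum>i\<in>T. u i - l i) = (\<Sum>i\<in>T. measure lebesgue {l i<..<u i})"
    using no'(2) by (intro sum.cong) auto
  also have "\<dots> = measure lebesgue (\<Union>i\<in>T. {l i<..<u i})"
    by (rule measure_finite_Union[symmetric]) (use no' in \<open>auto simp: disjoint_family_on_def\<close>)
  also have "\<dots> \<le> measure lebesgue {x..y}"
    by (rule measure_mono_fmeasurable) (use sub no'(1) in \<open>force+\<close>)
  also have "\<dots> = y - x" using \<open>x \<le> y\<close> by simp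
  finally show ?thesis .
qed

lemma pos_variation_le:
  assumes "\<And>v. v \<in> variation_sums g x y \<Longrightarrow> v \<le> K"
  shows "pos_variation g x y \<le> K"
  unfolding pos_variation_def by (rule cSup_least[OF _ assms]) (use zero_in_variation_sums in blast)

context
  fixes g :: "real \<Rightarrow> real" and c d B :: real
  assumes ac: "abs_cont_on c d (\<lambda>x. of_real (g x))"
    and bounded: "\<And>v. v \<in> variation_sums g c d \<Longrightarrow> v \<le> B"
begin

lemma variation_sums_le_pos_variation:
  assumes "c \<le> x" "y \<le> d" "v \<in> variation_sums g x y"
  shows "v \<le> pos_variation g x y"
  unfolding pos_variation_def
proof (rule cSup_upper[OF assms(3)])
  show "bdd_above (variation_sums g x y)"
    by (rule bdd_aboveI[of _ B]) (use variation_sums_mono[OF assms(1,2)] bounded in blast)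
qed

lemma pos_variation_add_le:
  assumes "c \<le> x" "x \<le> y" "y \<le> d"
  shows "pos_variation g c y \<le> pos_variation g c x + pos_variation g x y"
proof (rule pos_variation_le)
  fix v assume "v \<in> variation_sums g c y"
  then obtain v1 v2 where "v = v1 + v2" "v1 \<in> variation_sums g c x" "v2 \<in> variation_sums g x y"
    using variation_sums_split assms by blast
  then show "v \<le> pos_variation g c x + pos_variation g x y"
    using assms by (auto intro!: add_mono variation_sums_le_pos_variation)
qed

lemma pos_variation_mono:
  assumes "c \<le> x" "x \<le> y" "y \<le> d"
  shows "pos_variation g c x \<le> pos_variation g c y"
  by (rule pos_variation_le, rule variation_sums_le_pos_variation)
    (use assms variation_sums_mono[of c c x y] in auto)

text \<open>The interval from \<open>x\<close> to \<open>y\<close> is appended to each family left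
  of it. Rearranged, this is the monotonicity of \<open>pos_variation g c x - g x\<close>, which up
  to a constant is the negative variation.\<close>

lemma pos_variation_add_diff_le:
  assumes "c \<le> x" "x \<le> y" "y \<le> d"
  shows "pos_variation g c x + (g y - g x) \<le> pos_variation g c y"
proof -
  have "pos_variation g c x \<le> pos_variation g c y - (g y - g x)"
  proof (rule pos_variation_le)
    fix v assume "v \<in> variation_sums g c x"
    then have "v + (g y - g x) \<in> variation_sums g c y"
      using assms by (intro variation_sums_insert) auto
    then show "v \<le> pos_variation g c y - (g y - g x)"
      using variation_sums_le_pos_variation[of c y] assms by fastforce
  qed
  then show ?thesis by simp
qed

text \<open>Inside every interval of the family a subfamily is chosen that nearly attains the
  positive variation there. Together they form one non-overlapping family of no greater total
  length, so the absolute continuity of \<open>g\<close> controls the sum of all the suprema at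
  once.\<close>

lemma pos_variation_small:
  assumes "\<epsilon> > 0"
  shows "\<exists>\<delta>>0. \<forall>(T::'i set) l u. nonoverlapping T l u \<longrightarrow> (\<forall>i\<in>T. c \<le> l i \<and> u i \<le> d) \<longrightarrow>
    (\<Sum>i\<in>T. u i - l i) < \<delta> \<longrightarrow> (\<Sum>i\<in>T. pos_variation g (l i) (u i)) \<le> \<epsilon>"
proof -
  \<comment> \<open>The index type is a product because a member of the refined family is named by
    an interval and a member of the subfamily inside it.\<close>
  from abs_cont_on_indexed[OF ac \<open>\<epsilon> > 0\<close>] obtain \<delta> where "\<delta> > 0"
    and \<delta>: "\<forall>(T::('i \<times> nat) set) l u. nonoverlapping T l u \<longrightarrow> (\<forall>i\<in>T. c \<le> l i \<and> u i \<le> d) \<longrightarrow>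
     (\<Sum>i\<in>T. u i - l i) < \<delta> \<longrightarrow>
     (\<Sum>i\<in>T. norm (of_real (g (u i)) - of_real (g (l i)) :: complex)) < \<epsilon>"
    by blast
  show ?thesis
  proof (intro exI[of _ \<delta>] conjI allI impI \<open>\<delta> > 0\<close>)
    fix T :: "'i set" and l u
    assume no: "nonoverlapping T l u" and sub: "\<forall>i\<in>T. c \<le> l i \<and> u i \<le> d"
      and small: "(\<Sum>i\<in>T. u i - l i) < \<delta>"
    note no' = nonoverlappingD[OF no]
    have *: "(\<Sum>i\<in>T. pos_variation g (l i) (u i)) \<le> \<epsilon> + card T * \<eta>" if "\<eta> > 0" for \<eta> :: real
    proof -
      have "\<exists>v. v \<in> variation_sums g (l i) (u i) \<and> pos_variation g (l i) (u i) < v + \<eta>" for i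
      proof (rule ccontr)
        assume "\<nexists>v. v \<in> variation_sums g (l i) (u i) \<and> pos_variation g (l i) (u i) < v + \<eta>"
        then have "\<And>v. v \<in> variation_sums g (l i) (u i) \<Longrightarrow> v \<le> pos_variation g (l i) (u i) - \<eta>"
          by (force simp: not_less le_diff_eq)
        then have "pos_variation g (l i) (u i) \<le> pos_variation g (l i) (u i) - \<eta>"
          by (rule pos_variation_le)
        with \<open>\<eta> > 0\<close> show False by simp
      qed
      then obtain v where v0: "\<And>i. v i \<in> variation_sums g (l i) (u i)"
          "\<And>i. pos_variation g (l i) (u i) < v i + \<eta>"
        by metis
      have "\<forall>i. \<exists>S a b. v i = (\<Sum>j\<in>S. g (b j) - g (a j)) \<and>
         nonoverlapping (S::nat set) a b \<and> (\<forall>j\<in>S. l i \<le> a j \<and> b j \<le> u i)"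
        using v0(1) by (simp add: variation_sums_def)
      from choice[OF this] obtain S where "\<forall>i. \<exists>a b. v i = (\<Sum>j\<in>S i. g (b j) - g (a j)) \<and>
         nonoverlapping (S i::nat set) a b \<and> (\<forall>j\<in>S i. l i \<le> a j \<and> b j \<le> u i)" ..
      from choice[OF this] obtain a where "\<forall>i. \<exists>b. v i = (\<Sum>j\<in>S i. g (b j) - g (a i j)) \<and>
         nonoverlapping (S i) (a i) b \<and> (\<forall>j\<in>S i. l i \<le> a i j \<and> b j \<le> u i)" ..
      from choice[OF this] obtain b where "\<forall>i. v i = (\<Sum>j\<in>S i. g (b i j) - g (a i j)) \<and>
         nonoverlapping (S i) (a i) (b i) \<and> (\<forall>j\<in>S i. l i \<le> a i j \<and> b i j \<le> u i)" ..
      with v0(2) have v: "\<And>i. pos_variation g (l i) (u i) < (\<Sum>j\<in>S i. g (b i j) - g (a i j)) + \<eta>"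
        and S: "\<And>i. nonoverlapping (S i) (a i) (b i)" "\<And>i j. j \<in> S i \<Longrightarrow> l i \<le> a i j \<and> b i j \<le> u i"
        by simp_all
      note S' = nonoverlappingD[OF S(1)]
      have no2: "nonoverlapping (Sigma T S) (\<lambda>(i,j). a i j) (\<lambda>(i,j). b i j)"
        unfolding nonoverlapping_def
      proof (intro conjI ballI impI)
        show "finite (Sigma T S)" using no'(1) S'(1) by auto
        show "(case p of (i, j) \<Rightarrow> a i j) \<le> (case p of (i, j) \<Rightarrow> b i j)" if "p \<in> Sigma T S" for p
          using that S'(2) by auto
        fix p q assume pq: "p \<in> Sigma T S" "q \<in> Sigma T S" "p \<noteq> q"
        obtain i j where p: "p = (i,j)" "i \<in> T" "j \<in> S i" using pq by auto
        obtain i' j' where q: "q = (i',j')" "i' \<in> T" "j' \<in> S i'" using pq by auto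
        have "{a i j<..<b i j} \<inter> {a i' j'<..<b i' j'} = {}"
        proof (cases "i = i'")
          case True
          then show ?thesis using S'(3)[of j i j'] p q pq by auto
        next
          case False
          have "{a i j<..<b i j} \<subseteq> {l i<..<u i}" "{a i' j'<..<b i' j'} \<subseteq> {l i'<..<u i'}"
            using S(2) p q by force+
          then show ?thesis using no'(3)[OF p(2) q(2) False] by blast
        qed
        then show "{(case p of (i, j) \<Rightarrow> a i j)<..<(case p of (i, j) \<Rightarrow> b i j)} \<inter>
           {(case q of (i, j) \<Rightarrow> a i j)<..<(case q of (i, j) \<Rightarrow> b i j)} = {}" by (simp add: p q)
      qed
      have tot: "(\<Sum>p\<in>Sigma T S. (case p of (i, j) \<Rightarrow> b i j) - (case p of (i, j) \<Rightarrow> a i j)) < \<delta>"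
      proof -
        have "(\<Sum>p\<in>Sigma T S. (case p of (i, j) \<Rightarrow> b i j) - (case p of (i, j) \<Rightarrow> a i j))
            = (\<Sum>i\<in>T. \<Sum>j\<in>S i. b i j - a i j)"
          by (subst sum.Sigma) (use no'(1) S'(1) in \<open>auto intro!: sum.cong\<close>)
        also have "\<dots> \<le> (\<Sum>i\<in>T. u i - l i)"
          by (intro sum_mono nonoverlapping_length_le[OF S(1)] S(2) no'(2))
        finally show ?thesis using small by simp
      qed
      have bnd: "c \<le> (case p of (i, j) \<Rightarrow> a i j) \<and> (case p of (i, j) \<Rightarrow> b i j) \<le> d" if "p \<in> Sigma T S" for p
      proof -
        obtain i j where p: "p = (i,j)" "i \<in> T" "j \<in> S i" using \<open>p \<in> Sigma T S\<close> by auto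
        then show ?thesis using bspec[OF sub p(2)] S(2)[OF p(3)] by simp
      qed
      have "(\<Sum>i\<in>T. pos_variation g (l i) (u i)) \<le> (\<Sum>i\<in>T. (\<Sum>j\<in>S i. g (b i j) - g (a i j)) + \<eta>)"
        using v by (intro sum_mono less_imp_le)
      also have "\<dots> = (\<Sum>i\<in>T. \<Sum>j\<in>S i. g (b i j) - g (a i j)) + card T * \<eta>"
        by (simp add: sum.distrib)
      also have "(\<Sum>i\<in>T. \<Sum>j\<in>S i. g (b i j) - g (a i j)) \<le> (\<Sum>i\<in>T. \<Sum>j\<in>S i. \<bar>g (b i j) - g (a i j)\<bar>)"
        by (intro sum_mono) simp
      also have "\<dots> = (\<Sum>p\<in>Sigma T S. norm (of_real (g (case p of (i, j) \<Rightarrow> b i j))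
          - of_real (g (case p of (i, j) \<Rightarrow> a i j)) :: complex))"
        by (subst sum.Sigma) (use no'(1) S'(1) in \<open>auto intro!: sum.cong simp flip: of_real_diff\<close>)
      also have "\<dots> < \<epsilon>" using \<delta> no2 bnd tot by blast
      finally show ?thesis by simp
    qed
    show "(\<Sum>i\<in>T. pos_variation g (l i) (u i)) \<le> \<epsilon>"
    proof (rule field_le_epsilon)
      fix e :: real assume "e > 0"
      \<comment> \<open>The admissible error is shared among the intervals; the \<open>+ 1\<close>
        covers the empty family.\<close>
      have "card T * (e / (card T + 1)) \<le> e" using \<open>e > 0\<close> by (simp add: field_simps)
      then show "(\<Sum>i\<in>T. pos_variation g (l i) (u i)) \<le> \<epsilon> + e"
        using *[of "e / (card T + 1)"] \<open>e > 0\<close> by simp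
    qed
  qed
qed

end

section \<open>Monotone absolutely continuous functions and their densities\<close>

definition ac_monotone :: "real \<Rightarrow> real \<Rightarrow> (real \<Rightarrow> real) \<Rightarrow> bool" where
  "ac_monotone c d G \<longleftrightarrow> (\<forall>x y. c \<le> x \<and> x \<le> y \<and> y \<le> d \<longrightarrow> G x \<le> G y) \<and>
     (\<forall>\<epsilon>>0. \<exists>\<delta>>0. \<forall>(T::real set set) l u. nonoverlapping T l u \<longrightarrow> (\<forall>i\<in>T. c \<le> l i \<and> u i \<le> d) \<longrightarrow>
        (\<Sum>i\<in>T. u i - l i) < \<delta> \<longrightarrow> (\<Sum>i\<in>T. G (u i) - G (l i)) \<le> \<epsilon>)"

text \<open>This is the Jordan decomposition: \<open>g\<close> is the difference of the two
  functions. The second inherits small increments from the first and from \<open>g\<close>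
  itself.\<close>

lemma ac_monotone_decomposition:
  assumes ac: "abs_cont_on c d (\<lambda>x. of_real (g x))"
    and bounded: "\<And>v. v \<in> variation_sums g c d \<Longrightarrow> v \<le> B"
  shows "ac_monotone c d (pos_variation g c)" "ac_monotone c d (\<lambda>x. pos_variation g c x - g x)"
proof -
  let ?P = "pos_variation g c"
  note pv = pos_variation_add_le[OF ac bounded] pos_variation_mono[OF ac bounded] pos_variation_add_diff_le[OF ac bounded]
  have small: "\<exists>\<delta>>0. \<forall>(T::real set set) l u. nonoverlapping T l u \<longrightarrow> (\<forall>i\<in>T. c \<le> l i \<and> u i \<le> d) \<longrightarrow>
        (\<Sum>i\<in>T. u i - l i) < \<delta> \<longrightarrow> (\<Sum>i\<in>T. ?P (u i) - ?P (l i)) \<le> \<epsilon>" if "\<epsilon> > 0" for \<epsilon> :: real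
  proof -
    from pos_variation_small[OF ac bounded \<open>\<epsilon> > 0\<close>] obtain \<delta> where "\<delta> > 0"
      and \<delta>: "\<forall>(T::real set set) l u. nonoverlapping T l u \<longrightarrow> (\<forall>i\<in>T. c \<le> l i \<and> u i \<le> d) \<longrightarrow>
        (\<Sum>i\<in>T. u i - l i) < \<delta> \<longrightarrow> (\<Sum>i\<in>T. pos_variation g (l i) (u i)) \<le> \<epsilon>"
      by blast
    show ?thesis
    proof (intro exI conjI allI impI, rule \<open>\<delta> > 0\<close>)
      fix T :: "real set set" and l u
      assume no: "nonoverlapping T l u" and sub: "\<forall>i\<in>T. c \<le> l i \<and> u i \<le> d" and sm: "(\<Sum>i\<in>T. u i - l i) < \<delta>"
      have "(\<Sum>i\<in>T. ?P (u i) - ?P (l i)) \<le> (\<Sum>i\<in>T. pos_variation g (l i) (u i))"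
      proof (intro sum_mono)
        fix i assume "i \<in> T"
        then show "?P (u i) - ?P (l i) \<le> pos_variation g (l i) (u i)"
          using pv(1)[of "l i" "u i"] sub nonoverlappingD(2)[OF no] by auto
      qed
      also have "\<dots> \<le> \<epsilon>" using \<delta> no sm sub by blast
      finally show "(\<Sum>i\<in>T. ?P (u i) - ?P (l i)) \<le> \<epsilon>" .
    qed
  qed
  show 1: "ac_monotone c d ?P"
    unfolding ac_monotone_def using pv(2) small by auto
  show "ac_monotone c d (\<lambda>x. ?P x - g x)"
    unfolding ac_monotone_def
  proof (intro conjI allI impI)
    fix x y assume "c \<le> x \<and> x \<le> y \<and> y \<le> d"
    then show "?P x - g x \<le> ?P y - g y" using pv(3)[of x y] by simp
  next
    fix \<epsilon> :: real assume "\<epsilon> > 0"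
    from abs_cont_on_indexed[OF ac half_gt_zero[OF \<open>\<epsilon> > 0\<close>]] obtain \<delta>1 where "\<delta>1 > 0"
      and \<delta>1: "\<forall>(T::real set set) l u. nonoverlapping T l u \<longrightarrow> (\<forall>i\<in>T. c \<le> l i \<and> u i \<le> d) \<longrightarrow>
        (\<Sum>i\<in>T. u i - l i) < \<delta>1 \<longrightarrow>
        (\<Sum>i\<in>T. norm (of_real (g (u i)) - of_real (g (l i)) :: complex)) < \<epsilon>/2"
      by blast
    from small[OF half_gt_zero[OF \<open>\<epsilon> > 0\<close>]] obtain \<delta>2 where "\<delta>2 > 0"
      and \<delta>2: "\<forall>(T::real set set) l u. nonoverlapping T l u \<longrightarrow> (\<forall>i\<in>T. c \<le> l i \<and> u i \<le> d) \<longrightarrow>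
        (\<Sum>i\<in>T. u i - l i) < \<delta>2 \<longrightarrow> (\<Sum>i\<in>T. ?P (u i) - ?P (l i)) \<le> \<epsilon>/2"
      by blast
    show "\<exists>\<delta>>0. \<forall>(T::real set set) l u. nonoverlapping T l u \<longrightarrow> (\<forall>i\<in>T. c \<le> l i \<and> u i \<le> d) \<longrightarrow>
        (\<Sum>i\<in>T. u i - l i) < \<delta> \<longrightarrow> (\<Sum>i\<in>T. (?P (u i) - g (u i)) - (?P (l i) - g (l i))) \<le> \<epsilon>"
    proof (intro exI[of _ "min \<delta>1 \<delta>2"] conjI allI impI)
      fix T :: "real set set" and l u
      assume no: "nonoverlapping T l u" and sub: "\<forall>i\<in>T. c \<le> l i \<and> u i \<le> d"
        and sm: "(\<Sum>i\<in>T. u i - l i) < min \<delta>1 \<delta>2"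
      have "(\<Sum>i\<in>T. (?P (u i) - g (u i)) - (?P (l i) - g (l i)))
          = (\<Sum>i\<in>T. ?P (u i) - ?P (l i)) + (\<Sum>i\<in>T. g (l i) - g (u i))"
        by (simp add: sum.distrib[symmetric] algebra_simps)
      also have "(\<Sum>i\<in>T. g (l i) - g (u i)) \<le> (\<Sum>i\<in>T. norm (of_real (g (u i)) - of_real (g (l i)) :: complex))"
        by (intro sum_mono) (simp flip: of_real_diff)
      also have "\<dots> < \<epsilon>/2" using \<delta>1 no sub sm by simp
      also have "(\<Sum>i\<in>T. ?P (u i) - ?P (l i)) \<le> \<epsilon>/2" using \<delta>2 no sub sm by simp
      finally show "(\<Sum>i\<in>T. (?P (u i) - g (u i)) - (?P (l i) - g (l i))) \<le> \<epsilon>" by simp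
    qed (use \<open>\<delta>1 > 0\<close> \<open>\<delta>2 > 0\<close> in simp)
  qed
qed

text \<open>The Stieltjes measure of \<open>G\<close> is absolutely continuous with respect to
  Lebesgue measure, and its Radon-Nikodym density is the integrand sought. A null set lies in an
  open set of small measure; that set is exhausted by finite unions of boxes, and each finite union
  is redivided into non-overlapping intervals to which \<open>ac_monotone\<close> applies.\<close>

lemma ac_monotone_imp_indefinite_integral:
  assumes G: "ac_monotone c d G" and "c < d"
  shows "\<exists>h. h absolutely_integrable_on {c..d} \<and> (\<forall>x\<in>{c..d}. integral {c..x} h = G x - G c)"
proof -
  \<comment> \<open>\<open>interval_measure\<close> expects a monotone function on the whole line,
    so \<open>G\<close> is continued by constants.\<close>
  define G' where "G' x = G (max c (min d x))" for x
  have mono: "G x \<le> G y" if "c \<le> x" "x \<le> y" "y \<le> d" for x y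
    using G that unfolding ac_monotone_def by blast
  have mono': "G' x \<le> G' y" if "x \<le> y" for x y
    unfolding G'_def using that \<open>c < d\<close> by (intro mono) auto
  have small: "\<exists>\<delta>>0. \<forall>(T::real set set) l u. nonoverlapping T l u \<longrightarrow>
        (\<Sum>i\<in>T. u i - l i) < \<delta> \<longrightarrow> (\<Sum>i\<in>T. G' (u i) - G' (l i)) \<le> \<epsilon>" if \<epsilon>: "\<epsilon> > 0" for \<epsilon> :: real
  proof -
    obtain \<delta> where "\<delta> > 0" and \<delta>: "\<forall>(T::real set set) l u. nonoverlapping T l u \<longrightarrow> (\<forall>i\<in>T. c \<le> l i \<and> u i \<le> d) \<longrightarrow>
        (\<Sum>i\<in>T. u i - l i) < \<delta> \<longrightarrow> (\<Sum>i\<in>T. G (u i) - G (l i)) \<le> \<epsilon>"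
      using G \<epsilon> unfolding ac_monotone_def by blast
    show ?thesis
    proof (intro exI[of _ \<delta>] conjI allI impI \<open>\<delta> > 0\<close>)
      fix T :: "real set set" and l u
      assume no: "nonoverlapping T l u" and sm: "(\<Sum>i\<in>T. u i - l i) < \<delta>"
      have "(\<Sum>i\<in>T. max c (min d (u i)) - max c (min d (l i))) \<le> (\<Sum>i\<in>T. u i - l i)"
      proof (rule sum_mono)
        fix i assume "i \<in> T"
        then have "l i \<le> u i" using nonoverlappingD(2)[OF no] by blast
        then show "max c (min d (u i)) - max c (min d (l i)) \<le> u i - l i" by linarith
      qed
      then show "(\<Sum>i\<in>T. G' (u i) - G' (l i)) \<le> \<epsilon>"
        unfolding G'_def
        using \<delta>[rule_format, OF nonoverlapping_clamp[OF no, of c d]] \<open>c < d\<close> sm by simp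
    qed
  qed
  have small1: "\<exists>\<delta>>0. \<forall>x y. x \<le> y \<longrightarrow> y - x < \<delta> \<longrightarrow> G' y - G' x \<le> \<epsilon>" if \<epsilon>: "\<epsilon> > 0" for \<epsilon> :: real
  proof -
    obtain \<delta> where "\<delta> > 0" and \<delta>: "\<forall>(T::real set set) l u. nonoverlapping T l u \<longrightarrow>
        (\<Sum>i\<in>T. u i - l i) < \<delta> \<longrightarrow> (\<Sum>i\<in>T. G' (u i) - G' (l i)) \<le> \<epsilon>"
      using small[OF \<epsilon>] by blast
    \<comment> \<open>A family with one member; the empty set serves merely as its index.\<close>
    have "nonoverlapping {{}} (\<lambda>_. x) (\<lambda>_. y)" if "x \<le> y" for x y
      using that by (simp add: nonoverlapping_def)
    then show ?thesis using \<delta> \<open>\<delta> > 0\<close> by (intro exI[of _ \<delta>] conjI allI impI) (fastforce+)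
  qed
  have cont: "isCont G' x" for x
    unfolding continuous_at_eps_delta
  proof (intro allI impI)
    fix e :: real assume "e > 0"
    then obtain \<delta> where "\<delta> > 0" and \<delta>: "\<forall>x y. x \<le> y \<longrightarrow> y - x < \<delta> \<longrightarrow> G' y - G' x \<le> e/2"
      using small1[of "e/2"] by auto
    have "dist (G' y) (G' x) < e" if "dist y x < \<delta>" for y
    proof (cases "x \<le> y")
      case True then show ?thesis using \<delta>[rule_format, of x y] that mono'[of x y] \<open>e > 0\<close> by (simp add: dist_real_def)
    next
      case False then show ?thesis using \<delta>[rule_format, of y x] that mono'[of y x] \<open>e > 0\<close> by (simp add: dist_real_def)
    qed
    then show "\<exists>d>0. \<forall>x'. dist x' x < d \<longrightarrow> dist (G' x') (G' x) < e" using \<open>\<delta> > 0\<close> by blast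
  qed
  have rcont: "continuous (at_right x) G'" for x
    using cont continuous_at_imp_continuous_at_within by blast
  define \<mu> where "\<mu> = interval_measure G'"
  have sets[simp]: "sets \<mu> = sets borel" by (simp add: \<mu>_def)
  have Icc: "emeasure \<mu> {x..y} = ennreal (G' y - G' x)" if "x \<le> y" for x y
    unfolding \<mu>_def
    by (rule emeasure_interval_measure_Icc[OF that mono' continuous_at_imp_continuous_on]) (simp_all add: cont)
  have ac: "absolutely_continuous (lborel :: real measure) \<mu>"
    unfolding absolutely_continuous_def
  proof
    fix N :: "real set" assume N: "N \<in> null_sets lborel"
    then have Nb: "N \<in> sets borel" by auto
    have "emeasure \<mu> N \<le> ennreal \<epsilon>" if "\<epsilon> > 0" for \<epsilon> :: real
    proof -
      obtain \<delta> where "\<delta> > 0" and \<delta>: "\<forall>(T::real set set) l u. nonoverlapping T l u \<longrightarrow>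
        (\<Sum>i\<in>T. u i - l i) < \<delta> \<longrightarrow> (\<Sum>i\<in>T. G' (u i) - G' (l i)) \<le> \<epsilon>"
        using small[OF \<open>\<epsilon> > 0\<close>] by blast
      obtain U where U: "open U" "N \<subseteq> U" "emeasure lborel (U - N) < ennreal \<delta>"
        using outer_regular_lborel[OF Nb \<open>\<delta> > 0\<close>] by blast
      have "emeasure lborel U = emeasure lborel (U - N)"
        using N U by (intro emeasure_Diff_null_set[symmetric]) auto
      then have Um: "emeasure lborel U < ennreal \<delta>" using U by simp
      obtain \<F> where F: "countable \<F>" "\<And>X. X \<in> \<F> \<Longrightarrow> \<exists>a b. X = cbox a b" "\<Union>\<F> = U"
        by (rule open_countable_Union_open_cbox[OF \<open>open U\<close>]) blast
      have fin: "emeasure \<mu> (\<Union>\<H>) \<le> ennreal \<epsilon>" if H: "finite \<H>" "\<H> \<subseteq> \<F>" for \<H>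
      proof -
        obtain \<D> where D: "\<D> division_of \<Union>\<H>"
          using elementary_unions_intervals[OF H(1)] F(2) H(2) by blast
        note D' = division_ofD[OF D]
        have K: "K = {Inf K..Sup K}" "Inf K \<le> Sup K" if KD: "K \<in> \<D>" for K
        proof -
          obtain a b where "K = cbox a b" "K \<noteq> {}" using D'(3)[OF KD] D'(4)[OF KD] by blast
          then show "K = {Inf K..Sup K}" "Inf K \<le> Sup K" by auto
        qed
        \<comment> \<open>The division is indexed by its own intervals, which is why
          \<open>ac_monotone\<close> speaks of families indexed by sets of reals.\<close>
        have no: "nonoverlapping \<D> Inf Sup"
          unfolding nonoverlapping_def
        proof (intro conjI ballI impI D'(1) K(2))
          fix i j assume "i \<in> \<D>" "j \<in> \<D>" "i \<noteq> j"
          then have "interior {Inf i..Sup i} \<inter> interior {Inf j..Sup j} = {}"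
            using D'(5)[of i j] K(1)[of i] K(1)[of j] by simp
          then show "{Inf i<..<Sup i} \<inter> {Inf j<..<Sup j} = {}" by simp
        qed assumption
        have "(\<Sum>K\<in>\<D>. Sup K - Inf K) = (\<Sum>K\<in>\<D>. measure lebesgue K)"
          by (intro sum.cong refl) (metis K measure_completion measure_lborel_Icc sets_lborel borel_closed closed_atLeastAtMost)
        also have "\<dots> = measure lebesgue (\<Union>\<H>)" by (rule content_division[OF D])
        finally have "ennreal (\<Sum>K\<in>\<D>. Sup K - Inf K) = emeasure lebesgue (\<Union>\<H>)"
          using lmeasurable_division[OF D] by (simp add: emeasure_eq_measure2)
        also have "\<dots> \<le> emeasure lebesgue U"
          by (rule emeasure_mono) (use H F U(1) in auto)
        also have "\<dots> = emeasure lborel U" using U(1) by simp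
        also have "\<dots> < ennreal \<delta>" by (rule Um)
        finally have "ennreal (\<Sum>K\<in>\<D>. Sup K - Inf K) < ennreal \<delta>" .
        moreover have "0 \<le> (\<Sum>K\<in>\<D>. Sup K - Inf K)" using K(2) by (intro sum_nonneg) simp
        ultimately have "(\<Sum>K\<in>\<D>. Sup K - Inf K) < \<delta>" by (simp add: ennreal_less_iff)
        then have "(\<Sum>K\<in>\<D>. G' (Sup K) - G' (Inf K)) \<le> \<epsilon>" using \<delta> no by blast
        moreover have "emeasure \<mu> (\<Union>\<H>) \<le> (\<Sum>K\<in>\<D>. emeasure \<mu> K)"
        proof -
          have "K \<in> sets borel" if "K \<in> \<D>" for K
            using K(1)[OF that] by (metis borel_closed closed_atLeastAtMost)
          then have "emeasure \<mu> (\<Union>K\<in>\<D>. K) \<le> (\<Sum>K\<in>\<D>. emeasure \<mu> K)"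
            by (intro emeasure_subadditive_finite D'(1)) auto
          then show ?thesis using D'(6) by simp
        qed
        moreover have "(\<Sum>K\<in>\<D>. emeasure \<mu> K) = (\<Sum>K\<in>\<D>. ennreal (G' (Sup K) - G' (Inf K)))"
          by (intro sum.cong refl) (metis Icc K)
        moreover have "\<dots> = ennreal (\<Sum>K\<in>\<D>. G' (Sup K) - G' (Inf K))"
          by (intro sum_ennreal) (use K(2) mono' in auto)
        ultimately show ?thesis by (simp add: order_trans[OF _ ennreal_leI])
      qed
      have "emeasure \<mu> U \<le> ennreal \<epsilon>"
      proof (cases "\<F> = {}")
        case False
        have "(\<Union>n. \<Union>i\<le>n. from_nat_into \<F> i) = \<Union>(range (from_nat_into \<F>))" by blast
        then have "U = (\<Union>n. \<Union>i\<le>n. from_nat_into \<F> i)"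
          using range_from_nat_into[OF False F(1)] F(3) by simp
        moreover have "emeasure \<mu> (\<Union>n. \<Union>i\<le>n. from_nat_into \<F> i) = (SUP n. emeasure \<mu> (\<Union>i\<le>n. from_nat_into \<F> i))"
        proof (rule SUP_emeasure_incseq[symmetric])
          have "from_nat_into \<F> i \<in> sets borel" for i
            using F(2)[OF from_nat_into[OF False, of i]] by auto
          then show "range (\<lambda>n. \<Union>i\<le>n. from_nat_into \<F> i) \<subseteq> sets \<mu>" by auto
          show "incseq (\<lambda>n. \<Union>i\<le>n. from_nat_into \<F> i)"
            unfolding incseq_def by (intro allI impI UN_mono) auto
        qed
        moreover have "\<dots> \<le> ennreal \<epsilon>"
          by (intro SUP_least fin) (use from_nat_into[OF False] in auto)
        ultimately show ?thesis by simp
      qed (use F(3) in simp)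
      moreover have "emeasure \<mu> N \<le> emeasure \<mu> U"
        using U by (intro emeasure_mono) auto
      ultimately show ?thesis by simp
    qed
    then have "emeasure \<mu> N \<le> 0"
      by - (rule ennreal_le_epsilon, simp)
    then show "N \<in> null_sets \<mu>" using Nb by auto
  qed
  obtain h where h: "h \<in> borel_measurable lborel" "density lborel h = \<mu>"
    using sigma_finite_measure.Radon_Nikodym[OF sigma_finite_lborel ac] by auto
  have nn: "(\<integral>\<^sup>+t. h t * indicator {c..x} t \<partial>lborel) = ennreal (G x - G c)" if "x \<in> {c..d}" for x
  proof -
    have "emeasure (density lborel h) {c..x} = (\<integral>\<^sup>+t. h t * indicator {c..x} t \<partial>lborel)"
      by (rule emeasure_density) (use h in auto)
    then show ?thesis using Icc[of c x] that h(2) by (simp add: G'_def)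
  qed
  \<comment> \<open>The density has values in \<open>ennreal\<close>. It is finite almost everywhere
    on the interval, so \<open>enn2real\<close> changes no integral over it.\<close>
  have "AE t in lborel. h t * indicator {c..d} t \<noteq> \<infinity>"
    by (rule nn_integral_noteq_infinite) (use h nn[of d] \<open>c < d\<close> in auto)
  then have fin: "AE t in lborel. t \<in> {c..d} \<longrightarrow> h t \<noteq> \<infinity>"
    by eventually_elim (auto simp: indicator_def)
  have hint: "((\<lambda>t. enn2real (h t) * indicator {c..x} t) has_integral (G x - G c)) UNIV" if x: "x \<in> {c..d}" for x
  proof (rule nn_integral_has_integral)
    show "(\<lambda>t. enn2real (h t) * indicator {c..x} t) \<in> borel_measurable borel" using h by auto
    have "(\<integral>\<^sup>+t. ennreal (enn2real (h t) * indicator {c..x} t) \<partial>lborel) = (\<integral>\<^sup>+t. h t * indicator {c..x} t \<partial>lborel)"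
    proof (rule nn_integral_cong_AE)
      show "AE t in lborel. ennreal (enn2real (h t) * indicator {c..x} t) = h t * indicator {c..x} t"
        using fin by eventually_elim (use x in \<open>auto simp: indicator_def less_top[symmetric]\<close>)
    qed
    then show "(\<integral>\<^sup>+t. ennreal (enn2real (h t) * indicator {c..x} t) \<partial>lborel) = ennreal (G x - G c)" using nn[OF x] by simp
    show "0 \<le> G x - G c" using mono[of c x] x by simp
  qed auto
  have hint': "((\<lambda>t. enn2real (h t)) has_integral (G x - G c)) {c..x}" if x: "x \<in> {c..d}" for x
  proof -
    have "(\<lambda>t. enn2real (h t) * indicator {c..x} t) = (\<lambda>t. if t \<in> {c..x} then enn2real (h t) else 0)"
      by (auto simp: indicator_def)
    then show ?thesis using hint[OF x] by (simp only: has_integral_restrict_UNIV)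
  qed
  have "(\<lambda>t. enn2real (h t)) absolutely_integrable_on {c..d}"
    by (rule nonnegative_absolutely_integrable_1) (use hint'[of d] \<open>c < d\<close> in auto)
  then show ?thesis using hint' by (intro exI[of _ "\<lambda>t. enn2real (h t)"]) (auto simp: integral_unique)
qed

section \<open>Permanence properties of absolute continuity\<close>

lemma abs_cont_on_subinterval:
  assumes "abs_cont_on c d f" "c \<le> c'" "d' \<le> d"
  shows "abs_cont_on c' d' f"
proof -
  have "{c'..d'} \<subseteq> {c..d}" using assms by auto
  then show ?thesis
    using assms(1) unfolding abs_cont_on_def by (meson order_trans)
qed

text \<open>The common source of permanence under real and imaginary parts, sums, multiples,
  conjugation and products. Two dominating functions are allowed because a sum or product needs both
  of its constituents.\<close>

lemma abs_cont_on_dominated: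
  assumes f1: "abs_cont_on c d f1" and f2: "abs_cont_on c d f2" and "K > 0"
    and le: "\<And>x y. x \<in> {c..d} \<Longrightarrow> y \<in> {c..d} \<Longrightarrow>
              norm (g y - g x) \<le> K * norm (f1 y - f1 x) + K * norm (f2 y - f2 x)"
  shows "abs_cont_on c d g"
  unfolding abs_cont_on_def
proof (intro allI impI)
  fix \<epsilon> :: real assume "\<epsilon> > 0"
  define e where "e = \<epsilon> / (2 * K)"
  have "e > 0" using \<open>\<epsilon> > 0\<close> \<open>K > 0\<close> by (simp add: e_def)
  obtain \<delta>1 where \<delta>1: "\<delta>1 > 0" "\<forall>\<D>. \<D> division_of \<Union>\<D> \<and> \<Union>\<D> \<subseteq> {c..d} \<and> (\<Sum>K\<in>\<D>. Sup K - Inf K) < \<delta>1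
        \<longrightarrow> (\<Sum>K\<in>\<D>. norm (f1 (Sup K) - f1 (Inf K))) < e"
    using f1 \<open>e > 0\<close> unfolding abs_cont_on_def by meson
  obtain \<delta>2 where \<delta>2: "\<delta>2 > 0" "\<forall>\<D>. \<D> division_of \<Union>\<D> \<and> \<Union>\<D> \<subseteq> {c..d} \<and> (\<Sum>K\<in>\<D>. Sup K - Inf K) < \<delta>2
        \<longrightarrow> (\<Sum>K\<in>\<D>. norm (f2 (Sup K) - f2 (Inf K))) < e"
    using f2 \<open>e > 0\<close> unfolding abs_cont_on_def by meson
  show "\<exists>\<delta>>0. \<forall>\<D>. \<D> division_of \<Union>\<D> \<and> \<Union>\<D> \<subseteq> {c..d} \<and> (\<Sum>K\<in>\<D>. Sup K - Inf K) < \<delta>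
        \<longrightarrow> (\<Sum>K\<in>\<D>. norm (g (Sup K) - g (Inf K))) < \<epsilon>"
  proof (intro exI[of _ "min \<delta>1 \<delta>2"] conjI allI impI)
    fix \<D> :: "real set set"
    assume D: "\<D> division_of \<Union>\<D> \<and> \<Union>\<D> \<subseteq> {c..d} \<and> (\<Sum>K\<in>\<D>. Sup K - Inf K) < min \<delta>1 \<delta>2"
    then have l: "(\<Sum>K\<in>\<D>. norm (f1 (Sup K) - f1 (Inf K))) < e" "(\<Sum>K\<in>\<D>. norm (f2 (Sup K) - f2 (Inf K))) < e"
      using \<delta>1(2) \<delta>2(2) by simp_all
    have "(\<Sum>L\<in>\<D>. norm (g (Sup L) - g (Inf L))) \<le>
        (\<Sum>L\<in>\<D>. K * norm (f1 (Sup L) - f1 (Inf L)) + K * norm (f2 (Sup L) - f2 (Inf L)))"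
    proof (intro sum_mono le)
      fix L assume L: "L \<in> \<D>"
      from D have D1: "\<D> division_of \<Union>\<D>" and sub: "\<Union>\<D> \<subseteq> {c..d}" by auto
      obtain a b where ab: "L = cbox a b" "L \<noteq> {}" using division_ofD(3,4)[OF D1 L] by (metis)
      have "L \<subseteq> {c..d}" using L sub by (meson Union_upper order_trans)
      then show "Inf L \<in> {c..d}" "Sup L \<in> {c..d}" using ab by auto
    qed
    also have "\<dots> = K * (\<Sum>L\<in>\<D>. norm (f1 (Sup L) - f1 (Inf L))) + K * (\<Sum>L\<in>\<D>. norm (f2 (Sup L) - f2 (Inf L)))"
      by (simp add: sum.distrib sum_distrib_left)
    also have "\<dots> < K * e + K * e" using l \<open>K > 0\<close> by (intro add_strict_mono mult_strict_left_mono)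
    also have "\<dots> = \<epsilon>" using \<open>K > 0\<close> by (simp add: e_def)
    finally show "(\<Sum>K\<in>\<D>. norm (g (Sup K) - g (Inf K))) < \<epsilon>" .
  qed (use \<delta>1(1) \<delta>2(1) in simp)
qed

lemma abs_cont_on_imp_continuous_on:
  assumes "abs_cont_on c d f"
  shows "continuous_on {c..d} f"
  unfolding continuous_on_iff
proof (intro ballI allI impI)
  fix x \<epsilon> :: real assume x: "x \<in> {c..d}" and "\<epsilon> > 0"
  obtain \<delta> where "\<delta> > 0" and \<delta>: "\<forall>(T::nat set) l u. nonoverlapping T l u \<longrightarrow> (\<forall>i\<in>T. c \<le> l i \<and> u i \<le> d) \<longrightarrow>
    (\<Sum>i\<in>T. u i - l i) < \<delta> \<longrightarrow> (\<Sum>i\<in>T. norm (f (u i) - f (l i))) < \<epsilon>"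
    using abs_cont_on_indexed[OF assms \<open>\<epsilon> > 0\<close>] by blast
  have *: "norm (f v - f u) < \<epsilon>" if "c \<le> u" "u \<le> v" "v \<le> d" "v - u < \<delta>" for u v
    using \<delta>[rule_format, of "{0}" "\<lambda>_. u" "\<lambda>_. v"] that by (simp add: nonoverlapping_def)
  have "dist (f y) (f x) < \<epsilon>" if "y \<in> {c..d}" "dist y x < \<delta>" for y
    using *[of x y] *[of y x] x that by (cases "x \<le> y") (auto simp: dist_norm norm_minus_commute)
  then show "\<exists>d'>0. \<forall>y\<in>{c..d}. dist y x < d' \<longrightarrow> dist (f y) (f x) < \<epsilon>" using \<open>\<delta> > 0\<close> by blast
qed

section \<open>Absolutely continuous functions as indefinite integrals\<close>

definition indefinite_integral_on :: "real \<Rightarrow> real \<Rightarrow> (real \<Rightarrow> complex) \<Rightarrow> bool" where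
  "indefinite_integral_on x y f \<longleftrightarrow> (\<exists>h. h absolutely_integrable_on {x..y} \<and>
      (\<forall>t\<in>{x..y}. integral {x..t} h = f t - f x))"

lemma indefinite_integral_on_glue:
  assumes "indefinite_integral_on x y f" "indefinite_integral_on y z f" "x \<le> y" "y \<le> z"
  shows "indefinite_integral_on x z f"
proof -
  obtain h1 where h1: "h1 absolutely_integrable_on {x..y}" "\<And>t. t \<in> {x..y} \<Longrightarrow> integral {x..t} h1 = f t - f x"
    using assms(1) unfolding indefinite_integral_on_def by auto
  obtain h2 where h2: "h2 absolutely_integrable_on {y..z}" "\<And>t. t \<in> {y..z} \<Longrightarrow> integral {y..t} h2 = f t - f y"
    using assms(2) unfolding indefinite_integral_on_def by auto
  define h where "h t = (if t \<le> y then h1 t else h2 t)" for t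
  have a1: "h absolutely_integrable_on {x..y}"
    by (rule absolutely_integrable_spike[OF h1(1) negligible_empty]) (simp add: h_def)
  have a2: "h absolutely_integrable_on {y..z}"
    by (rule absolutely_integrable_spike[OF h2(1) negligible_sing[of y]]) (simp add: h_def)
  have a: "h absolutely_integrable_on {x..z}"
    by (rule absolutely_integrable_on_combine[OF a1 a2 assms(3,4)])
  have i1: "integral {x..t} h = f t - f x" if "t \<in> {x..y}" for t
  proof -
    have "integral {x..t} h = integral {x..t} h1"
      by (rule Henstock_Kurzweil_Integration.integral_cong) (use that in \<open>simp add: h_def\<close>)
    then show ?thesis using h1(2)[OF that] by simp
  qed
  have "integral {x..t} h = f t - f x" if t: "t \<in> {x..z}" for t
  proof (cases "t \<le> y")
    case True then show ?thesis using i1[of t] t by simp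
  next
    case False
    have "h integrable_on {x..z}" using a set_lebesgue_integral_eq_integral(1) by blast
    then have "integral {x..y} h + integral {y..t} h = integral {x..t} h"
      using False assms(3) t by (intro Henstock_Kurzweil_Integration.integral_combine)
        (auto intro: integrable_on_subinterval)
    moreover have "integral {y..t} h = integral {y..t} h2"
      by (rule integral_spike[OF negligible_sing[of y]]) (simp add: h_def)
    ultimately show ?thesis using h2(2)[of t] i1[of y] False t assms(3) by simp
  qed
  with a show ?thesis unfolding indefinite_integral_on_def by blast
qed

lemma abs_cont_on_bounded_variation_imp_indefinite_integral:
  assumes ac: "abs_cont_on c d (\<lambda>x. of_real (g x))" and "c < d"
    and bounded: "\<And>v. v \<in> variation_sums g c d \<Longrightarrow> v \<le> B"
  shows "\<exists>h. h absolutely_integrable_on {c..d} \<and> (\<forall>x\<in>{c..d}. integral {c..x} h = g x - g c)"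
proof -
  obtain h1 where h1: "h1 absolutely_integrable_on {c..d}"
      "\<forall>x\<in>{c..d}. integral {c..x} h1 = pos_variation g c x - pos_variation g c c"
    using ac_monotone_imp_indefinite_integral[OF ac_monotone_decomposition(1)[OF ac bounded] \<open>c < d\<close>] by blast
  obtain h2 where h2: "h2 absolutely_integrable_on {c..d}"
      "\<forall>x\<in>{c..d}. integral {c..x} h2 = (pos_variation g c x - g x) - (pos_variation g c c - g c)"
    using ac_monotone_imp_indefinite_integral[OF ac_monotone_decomposition(2)[OF ac bounded] \<open>c < d\<close>] by blast
  have int: "h1 integrable_on {c..x}" "h2 integrable_on {c..x}" if "x \<in> {c..d}" for x
    using that set_lebesgue_integral_eq_integral(1)[OF h1(1)] set_lebesgue_integral_eq_integral(1)[OF h2(1)]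
    by (auto intro: integrable_on_subinterval)
  show ?thesis
  proof (intro exI conjI ballI)
    show "(\<lambda>x. h1 x - h2 x) absolutely_integrable_on {c..d}" by (intro set_integral_diff h1 h2)
    fix x assume x: "x \<in> {c..d}"
    show "integral {c..x} (\<lambda>x. h1 x - h2 x) = g x - g c"
      using Henstock_Kurzweil_Integration.integral_diff[OF int[OF x]] h1(2) h2(2) x by simp
  qed
qed

lemma abs_cont_on_of_real_Re_Im:
  assumes "abs_cont_on c d f"
  shows "abs_cont_on c d (\<lambda>x. of_real (Re (f x)))" "abs_cont_on c d (\<lambda>x. of_real (Im (f x)))"
proof -
  have "norm (complex_of_real (Re w) - complex_of_real (Re z)) \<le> 1 * norm (w - z) + 1 * norm (w - z)"
    "norm (complex_of_real (Im w) - complex_of_real (Im z)) \<le> 1 * norm (w - z) + 1 * norm (w - z)" for w z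
    using abs_Re_le_cmod[of "w - z"] abs_Im_le_cmod[of "w - z"] by (simp_all flip: of_real_diff)
  then show "abs_cont_on c d (\<lambda>x. of_real (Re (f x)))" "abs_cont_on c d (\<lambda>x. of_real (Im (f x)))"
    using abs_cont_on_dominated[OF assms assms zero_less_one] by simp_all
qed

text \<open>On intervals shorter than the \<open>\<delta>\<close> belonging to \<open>\<epsilon> = 1\<close> all variation sums are at most \<open>1\<close>, so
  bounded variation is only needed there.\<close>

lemma abs_cont_on_imp_indefinite_integral:
  assumes f: "abs_cont_on c d f" and "c \<le> d"
  shows "indefinite_integral_on c d f"
proof -
  obtain \<delta> where "\<delta> > 0" and \<delta>: "\<forall>(T::nat set) l u. nonoverlapping T l u \<longrightarrow> (\<forall>i\<in>T. c \<le> l i \<and> u i \<le> d) \<longrightarrow>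
    (\<Sum>i\<in>T. u i - l i) < \<delta> \<longrightarrow> (\<Sum>i\<in>T. norm (f (u i) - f (l i))) < 1"
    using abs_cont_on_indexed[OF f zero_less_one] by blast
  have triv: "indefinite_integral_on x x f" for x
    unfolding indefinite_integral_on_def by (intro exI[of _ "\<lambda>_. 0"]) auto
  have short: "indefinite_integral_on x y f" if xy: "c \<le> x" "x \<le> y" "y \<le> d" "y - x < \<delta>" for x y
  proof (cases "x = y")
    case False
    then have "x < y" using xy by simp
    note f' = abs_cont_on_of_real_Re_Im[OF abs_cont_on_subinterval[OF f xy(1,3)]]
    have bnd: "v \<le> 1" if v: "v \<in> variation_sums (\<lambda>t. P (f t)) x y" and P: "\<And>z w. P z - P w \<le> cmod (z - w)" for v P
    proof -
      obtain T :: "nat set" and l u where v: "v = (\<Sum>i\<in>T. P (f (u i)) - P (f (l i)))" and no: "nonoverlapping T l u"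
        and sub: "\<And>i. i \<in> T \<Longrightarrow> x \<le> l i \<and> u i \<le> y" using v by (auto simp: variation_sums_def)
      have "v \<le> (\<Sum>i\<in>T. norm (f (u i) - f (l i)))" unfolding v by (intro sum_mono P)
      also have "\<dots> < 1"
      proof (rule \<delta>[rule_format, OF no])
        show "(\<Sum>i\<in>T. u i - l i) < \<delta>"
          using nonoverlapping_length_le[OF no sub xy(2)] xy(4) by simp
        show "c \<le> l i \<and> u i \<le> d" if "i \<in> T" for i using sub[OF that] xy by simp
      qed
      finally show ?thesis by simp
    qed
    have ReIm: "Re z - Re w \<le> cmod (z - w)" "Im z - Im w \<le> cmod (z - w)" for z w
      using complex_Re_le_cmod[of "z - w"] abs_Im_le_cmod[of "z - w"] by simp_all
    have "\<exists>h. h absolutely_integrable_on {x..y} \<and> (\<forall>t\<in>{x..y}. integral {x..t} h = Re (f t) - Re (f x))"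
      by (rule abs_cont_on_bounded_variation_imp_indefinite_integral[OF f'(1) \<open>x < y\<close>])
        (rule bnd, assumption, rule ReIm)
    then obtain h1 where h1: "h1 absolutely_integrable_on {x..y}"
      "\<And>t. t \<in> {x..y} \<Longrightarrow> integral {x..t} h1 = Re (f t) - Re (f x)" by blast
    have "\<exists>h. h absolutely_integrable_on {x..y} \<and> (\<forall>t\<in>{x..y}. integral {x..t} h = Im (f t) - Im (f x))"
      by (rule abs_cont_on_bounded_variation_imp_indefinite_integral[OF f'(2) \<open>x < y\<close>])
        (rule bnd, assumption, rule ReIm)
    then obtain h2 where h2: "h2 absolutely_integrable_on {x..y}"
      "\<And>t. t \<in> {x..y} \<Longrightarrow> integral {x..t} h2 = Im (f t) - Im (f x)" by blast
    have lin: "bounded_linear (\<lambda>r. complex_of_real r)" "bounded_linear (\<lambda>r. \<i> * complex_of_real r)"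
      by (auto intro: bounded_linear_of_real bounded_linear_mult_const bounded_linear_const_mult)
    note a = absolutely_integrable_linear[OF h1(1) lin(1), unfolded o_def]
      absolutely_integrable_linear[OF h2(1) lin(2), unfolded o_def]
    show ?thesis
      unfolding indefinite_integral_on_def
    proof (intro exI conjI ballI)
      show "(\<lambda>t. complex_of_real (h1 t) + \<i> * complex_of_real (h2 t)) absolutely_integrable_on {x..y}"
        by (intro set_integral_add a)
      fix t assume t: "t \<in> {x..y}"
      have "h1 integrable_on {x..t}" "h2 integrable_on {x..t}"
        using t set_lebesgue_integral_eq_integral(1)[OF h1(1)] set_lebesgue_integral_eq_integral(1)[OF h2(1)]
        by (auto intro: integrable_on_subinterval)
      then have "(h1 has_integral (Re (f t) - Re (f x))) {x..t}" "(h2 has_integral (Im (f t) - Im (f x))) {x..t}"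
        using h1(2)[OF t] h2(2)[OF t] by (simp_all add: has_integral_iff)
      then have "((\<lambda>t. complex_of_real (h1 t) + \<i> * complex_of_real (h2 t)) has_integral
          (complex_of_real (Re (f t) - Re (f x)) + \<i> * complex_of_real (Im (f t) - Im (f x)))) {x..t}"
        by (intro has_integral_add has_integral_linear[OF _ lin(1), unfolded o_def]
            has_integral_linear[OF _ lin(2), unfolded o_def])
      then show "integral {x..t} (\<lambda>t. complex_of_real (h1 t) + \<i> * complex_of_real (h2 t)) = f t - f x"
        by (auto simp: integral_unique complex_eq_iff)
    qed
  qed (use triv in simp)
  \<comment> \<open>The steps have length \<open>\<delta> / 2\<close> because \<open>short\<close>
    demands length strictly below \<open>\<delta>\<close>; the minimum makes the last step stop at
    \<open>d\<close>.\<close>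
  have "indefinite_integral_on c (min d (c + n * (\<delta>/2))) f" for n :: nat
  proof (induction n)
    case 0 then show ?case using triv \<open>c \<le> d\<close> by simp
  next
    case (Suc n)
    show ?case
    proof (rule indefinite_integral_on_glue[OF Suc.IH short])
      show "min d (c + real n * (\<delta> / 2)) \<le> min d (c + real (Suc n) * (\<delta> / 2))"
        "min d (c + real n * (\<delta> / 2)) \<le> min d (c + real (Suc n) * (\<delta> / 2))"
        using \<open>\<delta> > 0\<close> by (intro min.mono order_refl; simp add: field_simps)+
      have "c + real (Suc n) * (\<delta> / 2) = (c + real n * (\<delta> / 2)) + \<delta> / 2"
        by (simp add: algebra_simps add_divide_distrib)
      then show "min d (c + real (Suc n) * (\<delta> / 2)) - min d (c + real n * (\<delta> / 2)) < \<delta>"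
        using \<open>\<delta> > 0\<close> by linarith
    qed (use \<open>\<delta> > 0\<close> \<open>c \<le> d\<close> in auto)
  qed
  moreover obtain n :: nat where "(d - c) / (\<delta>/2) < n" using reals_Archimedean2 by blast
  then have "min d (c + n * (\<delta>/2)) = d" using \<open>\<delta> > 0\<close> by (simp add: field_simps)
  ultimately show ?thesis by metis
qed

section \<open>Locally absolutely continuous functions\<close>

text \<open>A relation rather than an operator, so that the derivative can be given by a formula,
  usually the right-hand side of a differential equation, and altered on a null set.\<close>

definition ac_deriv :: "real set \<Rightarrow> (real \<Rightarrow> complex) \<Rightarrow> (real \<Rightarrow> complex) \<Rightarrow> bool" where
  "ac_deriv I f f' \<longleftrightarrow> f \<in> AC_loc I \<and> (AE x in lebesgue_on I. (f has_vector_derivative f' x) (at x))"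

lemma AE_lebesgue_on_iff_negligible:
  assumes "S \<in> sets lebesgue"
  shows "(AE x in lebesgue_on S. P x) \<longleftrightarrow> negligible {x \<in> S. \<not> P x}"
proof -
  have "(AE x in lebesgue_on S. P x) \<longleftrightarrow> (AE x in lebesgue. x \<in> S \<longrightarrow> P x)"
    by (rule AE_restrict_space_iff) (use assms in simp)
  also have "\<dots> \<longleftrightarrow> {x \<in> space lebesgue. \<not> (x \<in> S \<longrightarrow> P x)} \<in> null_sets lebesgue"
    by (rule completion.AE_iff_null_sets)
  also have "{x \<in> space lebesgue. \<not> (x \<in> S \<longrightarrow> P x)} = {x \<in> S. \<not> P x}" by auto
  finally show ?thesis by (simp add: negligible_iff_null_sets)
qed

lemma open_real_Icc_nhd:
  fixes I :: "real set"
  assumes "open I" "x \<in> I"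
  obtains u v where "u < x" "x < v" "{u..v} \<subseteq> I"
proof -
  obtain e where "e > 0" "cball x e \<subseteq> I" using assms open_contains_cball by blast
  then show thesis using that[of "x - e" "x + e"] by (simp add: cball_eq_atLeastAtMost)
qed

text \<open>Negligibility is a local property. Hence statements holding almost everywhere can be
  proved on compact subintervals, where \<open>abs_cont_on\<close> is available.\<close>

lemma AE_lebesgue_on_openI:
  fixes I :: "real set"
  assumes "open I" and "\<And>u v. u < v \<Longrightarrow> {u..v} \<subseteq> I \<Longrightarrow> negligible {x \<in> {u<..<v}. \<not> P x}"
  shows "AE x in lebesgue_on I. P x"
proof -
  have "negligible {x \<in> I. \<not> P x}"
  proof (rule locally_negligible_alt[THEN iffD2], rule ballI)
    fix x assume x: "x \<in> {x \<in> I. \<not> P x}"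
    then have "x \<in> I" by simp
    then obtain u v where uv: "u < x" "x < v" "{u..v} \<subseteq> I" by (rule open_real_Icc_nhd[OF \<open>open I\<close>])
    show "\<exists>U. openin (top_of_set {x \<in> I. \<not> P x}) U \<and> x \<in> U \<and> negligible U"
    proof (intro exI conjI)
      show "openin (top_of_set {x \<in> I. \<not> P x}) ({x \<in> I. \<not> P x} \<inter> {u<..<v})"
        by (rule openin_open_Int) simp
      show "negligible ({x \<in> I. \<not> P x} \<inter> {u<..<v})"
        by (rule negligible_subset[OF assms(2)[of u v]]) (use uv in auto)
    qed (use x uv in simp)
  qed
  then show ?thesis using AE_lebesgue_on_iff_negligible[of I P] \<open>open I\<close> by simp
qed

lemma abs_cont_on_AE_derivative:
  assumes f: "abs_cont_on c d f" and "c < d"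
  shows "\<exists>h. h absolutely_integrable_on {c..d} \<and> (\<forall>t\<in>{c..d}. (h has_integral (f t - f c)) {c..t}) \<and>
    negligible {x \<in> {c<..<d}. \<not> (f has_vector_derivative h x) (at x)}"
proof -
  obtain h where h: "h absolutely_integrable_on {c..d}" "\<And>t. t \<in> {c..d} \<Longrightarrow> integral {c..t} h = f t - f c"
    using abs_cont_on_imp_indefinite_integral[OF f] \<open>c < d\<close> unfolding indefinite_integral_on_def by auto
  have int: "h integrable_on {c..d}" using h(1) set_lebesgue_integral_eq_integral(1) by blast
  show ?thesis
  proof (intro exI conjI ballI, rule h(1))
    show "(h has_integral (f t - f c)) {c..t}" if "t \<in> {c..d}" for t
      unfolding has_integral_iff using h(2)[OF that] that by (auto intro: integrable_on_subinterval[OF int])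
    show "negligible {x \<in> {c<..<d}. \<not> (f has_vector_derivative h x) (at x)}"
    proof (rule negligible_subset[OF negligible_indefinite_integral_not_differentiable[OF int]], clarify)
      fix x assume x: "x \<in> {c<..<d}" "\<not> (f has_vector_derivative h x) (at x)"
        and d: "((\<lambda>y. integral {c..y} h) has_vector_derivative h x) (at x)"
      have "((\<lambda>y. integral {c..y} h + f c) has_vector_derivative h x) (at x)"
        using has_vector_derivative_add[OF d has_vector_derivative_const] by simp
      then have "(f has_vector_derivative h x) (at x)"
        by (rule has_vector_derivative_transform_within_open[of _ _ _ "{c<..<d}"])
          (use x h(2) in auto)
      with x show False by simp
    qed
  qed
qed

lemma AC_loc_imp_ac_deriv:
  assumes "open I" "f \<in> AC_loc I"
  shows "ac_deriv I f (\<lambda>x. vector_derivative f (at x))"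
  unfolding ac_deriv_def
proof (intro conjI assms(2) AE_lebesgue_on_openI assms(1))
  fix u v :: real assume uv: "u < v" "{u..v} \<subseteq> I"
  then have "abs_cont_on u v f" using assms(2) unfolding AC_loc_def by auto
  then obtain h where "negligible {x \<in> {u<..<v}. \<not> (f has_vector_derivative h x) (at x)}"
    using abs_cont_on_AE_derivative[OF _ uv(1)] by blast
  then show "negligible {x \<in> {u<..<v}. \<not> (f has_vector_derivative vector_derivative f (at x)) (at x)}"
    by (rule negligible_subset) (auto simp: vector_derivative_at)
qed

text \<open>On \<open>{c..d}\<close> the function is the integral of some \<open>h\<close> that is
  also its derivative almost everywhere. Derivatives at a point are unique, so \<open>f'\<close>
  differs from \<open>h\<close> only on a null set.\<close>

lemma ac_deriv_FTC:
  assumes f: "ac_deriv I f f'" and "open I" and cd: "c \<le> d" "{c..d} \<subseteq> I"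
  shows "f' absolutely_integrable_on {c..d}" "(f' has_integral (f d - f c)) {c..d}"
proof -
  have "f' absolutely_integrable_on {c..d} \<and> (f' has_integral (f d - f c)) {c..d}"
  proof (cases "c = d")
    case False
    then have "c < d" using cd by simp
    have "abs_cont_on c d f" using f cd unfolding ac_deriv_def AC_loc_def by auto
    then obtain h where h: "h absolutely_integrable_on {c..d}" "\<And>t. t \<in> {c..d} \<Longrightarrow> (h has_integral (f t - f c)) {c..t}"
      "negligible {x \<in> {c<..<d}. \<not> (f has_vector_derivative h x) (at x)}"
      using abs_cont_on_AE_derivative[OF _ \<open>c < d\<close>, of f] by blast
    have I: "I \<in> sets lebesgue" using \<open>open I\<close> by simp
    define N where "N = {x \<in> {c<..<d}. \<not> (f has_vector_derivative h x) (at x)} \<union>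
        {x \<in> I. \<not> (f has_vector_derivative f' x) (at x)} \<union> {c, d}"
    have N: "negligible N"
      unfolding N_def using h(3) f AE_lebesgue_on_iff_negligible[OF I] unfolding ac_deriv_def by auto
    have eq: "f' x = h x" if "x \<in> {c..d} - N" for x
    proof -
      have "(f has_vector_derivative h x) (at x)" "(f has_vector_derivative f' x) (at x)"
        using that cd unfolding N_def by force+
      then show ?thesis by (metis vector_derivative_at)
    qed
    have "f' absolutely_integrable_on {c..d}" by (rule absolutely_integrable_spike[OF h(1) N eq])
    moreover have "(f' has_integral (f d - f c)) {c..d}"
      by (rule has_integral_spike[OF N eq h(2)]) (use cd in auto)
    ultimately show ?thesis by blast
  next
    case True
    have "f' absolutely_integrable_on cbox c d" using True by (intro absolutely_integrable_on_null) simp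
    then show ?thesis using True has_integral_refl(2)[of f' d] by simp
  qed
  then show "f' absolutely_integrable_on {c..d}" "(f' has_integral (f d - f c)) {c..d}" by auto
qed

lemma AC_loc_imp_continuous_on:
  assumes "open I" "f \<in> AC_loc I"
  shows "continuous_on I f"
proof (rule continuous_at_imp_continuous_on, rule ballI)
  fix x assume "x \<in> I"
  then obtain u v where uv: "u < x" "x < v" "{u..v} \<subseteq> I" by (rule open_real_Icc_nhd[OF \<open>open I\<close>])
  then have "abs_cont_on u v f" using assms(2) unfolding AC_loc_def by auto
  then show "isCont f x"
    using uv abs_cont_on_imp_continuous_on continuous_on_interior[of "{u..v}" f x] by auto
qed

section \<open>Rules of differentiation for locally absolutely continuous functions\<close>

lemma AC_loc_dominated:
  assumes "f1 \<in> AC_loc I" "f2 \<in> AC_loc I" "K > 0"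
    and "\<And>x y. x \<in> I \<Longrightarrow> y \<in> I \<Longrightarrow> norm (g y - g x) \<le> K * norm (f1 y - f1 x) + K * norm (f2 y - f2 x)"
  shows "g \<in> AC_loc I"
  unfolding AC_loc_def
proof (clarify)
  fix c d :: real assume cd: "c \<le> d" "{c..d} \<subseteq> I"
  have "abs_cont_on c d f1" "abs_cont_on c d f2" using assms(1,2) cd by (simp_all add: AC_loc_def)
  then show "abs_cont_on c d g"
    by (rule abs_cont_on_dominated[OF _ _ assms(3)]) (rule assms(4); use cd(2) in blast)
qed

lemma AC_loc_const: "(\<lambda>_. k) \<in> AC_loc I"
  by (simp add: AC_loc_def abs_cont_on_def exI[of _ "1::real"])

lemma ac_deriv_const: "ac_deriv I (\<lambda>_. k) (\<lambda>_. 0)"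
  unfolding ac_deriv_def by (simp add: AC_loc_const has_vector_derivative_const)

lemma ac_deriv_add:
  assumes f: "ac_deriv I f f'" and g: "ac_deriv I g g'"
  shows "ac_deriv I (\<lambda>x. f x + g x) (\<lambda>x. f' x + g' x)"
  unfolding ac_deriv_def
proof
  show "(\<lambda>x. f x + g x) \<in> AC_loc I"
  proof (rule AC_loc_dominated[of f I g 1])
    show "norm ((f y + g y) - (f x + g x)) \<le> 1 * norm (f y - f x) + 1 * norm (g y - g x)" for x y
      using norm_triangle_ineq[of "f y - f x" "g y - g x"] by (simp add: algebra_simps)
  qed (use f g in \<open>auto simp: ac_deriv_def\<close>)
  have "AE x in lebesgue_on I. (f has_vector_derivative f' x) (at x)" "AE x in lebesgue_on I. (g has_vector_derivative g' x) (at x)"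
    using f g by (auto simp: ac_deriv_def)
  then show "AE x in lebesgue_on I. ((\<lambda>x. f x + g x) has_vector_derivative f' x + g' x) (at x)"
    by eventually_elim (rule has_vector_derivative_add)
qed

lemma ac_deriv_cmult:
  assumes f: "ac_deriv I f f'"
  shows "ac_deriv I (\<lambda>x. k * f x) (\<lambda>x. k * f' x)"
  unfolding ac_deriv_def
proof
  have "norm k * t \<le> (norm k + 1) * t + (norm k + 1) * t" if "t \<ge> 0" for t
    using that by (simp add: algebra_simps mult_nonneg_nonneg)
  note le = this
  have fI: "f \<in> AC_loc I" using f by (simp add: ac_deriv_def)
  show "(\<lambda>x. k * f x) \<in> AC_loc I"
  proof (rule AC_loc_dominated[OF fI fI])
    show "norm k + 1 > 0" by (simp add: add_nonneg_pos)
    have "norm (k * f y - k * f x) = norm k * norm (f y - f x)" for x y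
      by (simp add: norm_mult flip: right_diff_distrib)
    then show "norm (k * f y - k * f x) \<le> (norm k + 1) * norm (f y - f x) + (norm k + 1) * norm (f y - f x)" for x y
      using le[of "norm (f y - f x)"] by simp
  qed
  have "AE x in lebesgue_on I. (f has_vector_derivative f' x) (at x)"
    using f by (auto simp: ac_deriv_def)
  then show "AE x in lebesgue_on I. ((\<lambda>x. k * f x) has_vector_derivative k * f' x) (at x)"
    by eventually_elim (rule has_vector_derivative_mult_right)
qed

lemma ac_deriv_diff:
  assumes "ac_deriv I f f'" "ac_deriv I g g'"
  shows "ac_deriv I (\<lambda>x. f x - g x) (\<lambda>x. f' x - g' x)"
  using ac_deriv_add[OF assms(1) ac_deriv_cmult[OF assms(2), of "-1"]] by simp

lemma ac_deriv_cnj: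
  assumes f: "ac_deriv I f f'"
  shows "ac_deriv I (\<lambda>x. cnj (f x)) (\<lambda>x. cnj (f' x))"
  unfolding ac_deriv_def
proof
  show "(\<lambda>x. cnj (f x)) \<in> AC_loc I"
  proof (rule AC_loc_dominated[of f I f 1])
    have "norm (cnj z - cnj w) = norm (z - w)" for z w
      using complex_mod_cnj[of "z - w"] by simp
    then show "norm (cnj (f y) - cnj (f x)) \<le> 1 * norm (f y - f x) + 1 * norm (f y - f x)" for x y by simp
  qed (use f in \<open>simp_all add: ac_deriv_def\<close>)
  have "AE x in lebesgue_on I. (f has_vector_derivative f' x) (at x)"
    using f by (auto simp: ac_deriv_def)
  then show "AE x in lebesgue_on I. ((\<lambda>x. cnj (f x)) has_vector_derivative cnj (f' x)) (at x)"
    by eventually_elim (rule has_vector_derivative_cnj)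
qed

lemma ac_deriv_mult:
  assumes f: "ac_deriv I f f'" and g: "ac_deriv I g g'" and "open I"
  shows "ac_deriv I (\<lambda>x. f x * g x) (\<lambda>x. f x * g' x + f' x * g x)"
  unfolding ac_deriv_def
proof
  show "(\<lambda>x. f x * g x) \<in> AC_loc I"
    unfolding AC_loc_def
  proof clarify
    fix c d :: real assume cd: "c \<le> d" "{c..d} \<subseteq> I"
    then have ac: "abs_cont_on c d f" "abs_cont_on c d g" using f g unfolding ac_deriv_def AC_loc_def by auto
    obtain B1 where B1: "\<And>x. x \<in> {c..d} \<Longrightarrow> norm (f x) \<le> B1"
      using compact_imp_bounded[OF compact_continuous_image[OF abs_cont_on_imp_continuous_on[OF ac(1)] compact_Icc]]
      unfolding bounded_iff by blast
    obtain B2 where B2: "\<And>x. x \<in> {c..d} \<Longrightarrow> norm (g x) \<le> B2"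
      using compact_imp_bounded[OF compact_continuous_image[OF abs_cont_on_imp_continuous_on[OF ac(2)] compact_Icc]]
      unfolding bounded_iff by blast
    define B where "B = max 1 (max B1 B2)"
    show "abs_cont_on c d (\<lambda>x. f x * g x)"
    proof (rule abs_cont_on_dominated[OF ac, of B])
      fix x y assume xy: "x \<in> {c..d}" "y \<in> {c..d}"
      have "f y * g y - f x * g x = (f y - f x) * g y + f x * (g y - g x)" by (simp add: algebra_simps)
      then have "norm (f y * g y - f x * g x) \<le> norm (f y - f x) * norm (g y) + norm (f x) * norm (g y - g x)"
        by (metis norm_triangle_ineq norm_mult)
      also have "\<dots> \<le> norm (f y - f x) * B + B * norm (g y - g x)"
        using B1[OF xy(1)] B2[OF xy(2)] by (intro add_mono mult_left_mono mult_right_mono) (auto simp: B_def)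
      finally show "norm (f y * g y - f x * g x) \<le> B * norm (f y - f x) + B * norm (g y - g x)"
        by (simp add: mult.commute)
    qed (simp add: B_def)
  qed
  have "AE x in lebesgue_on I. (f has_vector_derivative f' x) (at x)" "AE x in lebesgue_on I. (g has_vector_derivative g' x) (at x)"
    using f g by (auto simp: ac_deriv_def)
  then show "AE x in lebesgue_on I. ((\<lambda>x. f x * g x) has_vector_derivative f x * g' x + f' x * g x) (at x)"
    by eventually_elim (rule has_vector_derivative_mult)
qed

lemma ac_deriv_cong_AE:
  assumes "ac_deriv I f f'" "AE x in lebesgue_on I. f' x = g' x"
  shows "ac_deriv I f g'"
proof -
  have "AE x in lebesgue_on I. (f has_vector_derivative f' x) (at x)" using assms(1) by (simp add: ac_deriv_def)
  with assms(2) have "AE x in lebesgue_on I. (f has_vector_derivative g' x) (at x)"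
    by eventually_elim simp
  with assms(1) show ?thesis by (simp add: ac_deriv_def)
qed

lemma ac_deriv_cong:
  assumes f: "ac_deriv I f f'" and eq: "\<And>x. x \<in> I \<Longrightarrow> f x = g x" and "open I"
  shows "ac_deriv I g f'"
  unfolding ac_deriv_def
proof
  show "g \<in> AC_loc I"
    by (rule AC_loc_dominated[of f I f 1]) (use f in \<open>simp_all add: ac_deriv_def eq[symmetric]\<close>)
  have sp: "AE x in lebesgue_on I. x \<in> I" by (rule AE_I2) simp
  have "AE x in lebesgue_on I. (f has_vector_derivative f' x) (at x)" using f by (simp add: ac_deriv_def)
  with sp show "AE x in lebesgue_on I. (g has_vector_derivative f' x) (at x)"
  proof eventually_elim
    case (elim x)
    show ?case
      by (rule has_vector_derivative_transform_within_open[OF elim(2) \<open>open I\<close> elim(1)]) (rule eq)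
  qed
qed

lemma ex_antiderivative:
  fixes h :: "real \<Rightarrow> complex"
  assumes "open I" "is_interval I" "c \<in> I"
    and h: "\<And>u v. {u..v} \<subseteq> I \<Longrightarrow> h absolutely_integrable_on {u..v}"
  shows "\<exists>F. ac_deriv I F h \<and> F c = 0"
proof -
  \<comment> \<open>An interval with reversed ends is empty, so at least one term is zero; together
    they are the oriented integral from \<open>c\<close> to \<open>x\<close>.\<close>
  define F where "F x = integral {c..x} h - integral {x..c} h" for x
  have F: "F x = integral {u..x} h - integral {u..c} h" if "u \<le> x" "u \<le> c" "{u..max x c} \<subseteq> I" for u x
  proof -
    have int: "h integrable_on {u..max x c}" using h[OF that(3)] set_lebesgue_integral_eq_integral(1) by blast
    show ?thesis
    proof (cases "x \<le> c")
      case True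
      then have "integral {u..x} h + integral {x..c} h = integral {u..c} h"
        using int that by (intro Henstock_Kurzweil_Integration.integral_combine) (simp_all add: max_def)
      moreover have "integral {c..x} h = 0" using True by (cases "x = c") simp_all
      ultimately show ?thesis by (simp add: F_def algebra_simps)
    next
      case False
      then have "integral {u..c} h + integral {c..x} h = integral {u..x} h"
        using int that by (intro Henstock_Kurzweil_Integration.integral_combine) (simp_all add: max_def)
      then show ?thesis using False by (simp add: F_def algebra_simps)
    qed
  qed
  have key: "abs_cont_on u v F \<and> negligible {x \<in> {u<..<v}. \<not> (F has_vector_derivative h x) (at x)}"
    if uv: "u \<le> v" "{u..v} \<subseteq> I" for u v
  proof -
    \<comment> \<open>On an interval enlarged to contain \<open>c\<close>, the oriented primitive
      differs by a constant from the one based at the left end, to which the results on indefinite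
      integrals apply.\<close>
    define u' v' where "u' = min u c" and "v' = max v c"
    have u'v': "u' \<le> u" "v \<le> v'" "u' \<le> c" "c \<le> v'" by (auto simp: u'_def v'_def)
    have "u' \<in> I" "v' \<in> I" using uv assms(3) by (auto simp: u'_def v'_def min_def max_def)
    then have sub: "{u'..v'} \<subseteq> I"
      using mem_is_interval_1_I[OF assms(2) \<open>u' \<in> I\<close> \<open>v' \<in> I\<close>] by (intro subsetI) simp
    have Feq: "F x = integral {u'..x} h - integral {u'..c} h" if "x \<in> {u'..v'}" for x
    proof (rule F)
      show "{u'..max x c} \<subseteq> I" by (rule order_trans[OF _ sub]) (use that u'v' in simp)
    qed (use that u'v' in auto)
    let ?G = "\<lambda>x. integral {u'..x} h"
    have G: "abs_cont_on u' v' ?G" by (rule abs_cont_on_indefinite_integral[OF h[OF sub]])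
    have "abs_cont_on u' v' F"
      by (rule abs_cont_on_dominated[OF G G zero_less_one]) (simp add: Feq)
    then have 1: "abs_cont_on u v F" by (rule abs_cont_on_subinterval) (use u'v' in auto)
    have "negligible {x \<in> {u'<..<v'}. \<not> (?G has_vector_derivative h x) (at x)}"
      by (rule negligible_indefinite_integral_not_differentiable)
        (use h[OF sub] set_lebesgue_integral_eq_integral(1) in blast)
    moreover have "(F has_vector_derivative h x) (at x)"
      if x: "x \<in> {u<..<v}" and d: "(?G has_vector_derivative h x) (at x)" for x
    proof -
      have "((\<lambda>x. ?G x - integral {u'..c} h) has_vector_derivative h x) (at x)"
        using has_vector_derivative_diff[OF d has_vector_derivative_const] by simp
      then show ?thesis
        by (rule has_vector_derivative_transform_within_open[of _ _ _ "{u<..<v}"]) (use x u'v' Feq in auto)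
    qed
    then have "{x \<in> {u<..<v}. \<not> (F has_vector_derivative h x) (at x)} \<subseteq>
       {x \<in> {u'<..<v'}. \<not> (?G has_vector_derivative h x) (at x)}" using u'v' by auto
    ultimately show ?thesis using 1 negligible_subset by blast
  qed
  have "ac_deriv I F h"
    unfolding ac_deriv_def
  proof
    show "F \<in> AC_loc I" unfolding AC_loc_def using key by auto
    show "AE x in lebesgue_on I. (F has_vector_derivative h x) (at x)"
      by (rule AE_lebesgue_on_openI[OF \<open>open I\<close>]) (use key in force)
  qed
  moreover have "F c = 0" by (simp add: F_def)
  ultimately show ?thesis by blast
qed

section \<open>The weighted \<open>L\<^sup>2\<close> space\<close>

text \<open>The set where the two functions differ is open and null, hence empty.\<close>

lemma continuous_on_AE_eq_imp_eq:
  fixes f g :: "real \<Rightarrow> complex"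
  assumes "open I" "continuous_on I f" "continuous_on I g" "AE x in lebesgue_on I. f x = g x" "x \<in> I"
  shows "f x = g x"
proof (rule ccontr)
  assume ne: "f x \<noteq> g x"
  have I: "I \<in> sets lebesgue" using \<open>open I\<close> by simp
  have "open (I \<inter> (\<lambda>t. f t - g t) -` (- {0}))"
    by (rule continuous_open_preimage[OF continuous_on_diff[OF assms(2,3)] \<open>open I\<close>]) auto
  moreover have "negligible (I \<inter> (\<lambda>t. f t - g t) -` (- {0}))"
    using assms(4) unfolding AE_lebesgue_on_iff_negligible[OF I] by (rule negligible_subset) auto
  ultimately have "I \<inter> (\<lambda>t. f t - g t) -` (- {0}) = {}"
    using open_not_negligible by blast
  with ne assms(5) show False by auto
qed

locale sl_problem =
  fixes C :: sl_expr
  assumes SL: "sturm_liouville C"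
begin

abbreviation "I \<equiv> sl_int C"
abbreviation "p \<equiv> sl_p C"
abbreviation "q \<equiv> sl_q C"
abbreviation "r \<equiv> sl_r C"
abbreviation "s \<equiv> sl_s C"
abbreviation "M \<equiv> sl_measure C"

lemma open_I: "open I"
  by (simp add: sl_int_def)

lemma mem_I: "x \<in> I \<longleftrightarrow> sl_a C < ereal x \<and> ereal x < sl_b C"
  by (simp add: sl_int_def einterval_def)

lemma interval_I: "is_interval I"
proof -
  have "x \<in> I" if "u \<in> I" "v \<in> I" "u \<le> x" "x \<le> v" for u v x
  proof -
    have "ereal u \<le> ereal x" "ereal x \<le> ereal v" using that by simp_all
    then show ?thesis
      using that less_le_trans[of "sl_a C" "ereal u" "ereal x"] le_less_trans[of "ereal x" "ereal v" "sl_b C"]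
      by (simp add: mem_I)
  qed
  then show ?thesis unfolding is_interval_1 by blast
qed

lemma Icc_subset_I: "c \<in> I \<Longrightarrow> d \<in> I \<Longrightarrow> {c..d} \<subseteq> I"
  using mem_is_interval_1_I[OF interval_I, of c d] by (intro subsetI) simp

lemma I_sets [simp]: "I \<in> sets lebesgue"
  using open_I by simp

lemma I_nonempty: obtains c where "c \<in> I"
proof -
  have "sl_a C < sl_b C" using SL by (simp add: sturm_liouville_def)
  then obtain z where "sl_a C < ereal z" "ereal z < sl_b C"
    using ereal_dense2 by blast
  then show thesis using that by (simp add: mem_I)
qed

lemma AE_r: "AE x in lebesgue_on I. r x > 0"
  and AE_p: "AE x in lebesgue_on I. p x \<noteq> 0"
  and r_measurable: "r \<in> borel_measurable (lebesgue_on I)"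
  using SL by (simp_all add: sturm_liouville_def)

lemma coeff_integrable:
  assumes "{c..d} \<subseteq> I"
  shows "(\<lambda>x. inverse (p x)) absolutely_integrable_on {c..d}" "q absolutely_integrable_on {c..d}"
    "r absolutely_integrable_on {c..d}" "s absolutely_integrable_on {c..d}"
  using SL assms by (simp_all add: sturm_liouville_def L1_loc_def)

text \<open>Since \<open>r\<close> is positive only almost everywhere, pointwise estimates are made with \<open>\<bar>r\<bar>\<close>.\<close>

definition sqint :: "real set \<Rightarrow> (real \<Rightarrow> complex) \<Rightarrow> bool" where
  "sqint S f \<longleftrightarrow> f \<in> borel_measurable (lebesgue_on S) \<and>
     (\<lambda>x. r x * (norm (f x))\<^sup>2) absolutely_integrable_on S"

lemma measurable_on_subset:
  assumes "f \<in> borel_measurable (lebesgue_on T)" "S \<subseteq> T"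
  shows "f \<in> borel_measurable (lebesgue_on S)"
  using assms measurable_restrict_mono by blast

lemma sqint_subset:
  assumes "sqint T f" "S \<subseteq> T" "S \<in> sets lebesgue"
  shows "sqint S f"
  using assms measurable_on_subset set_integrable_subset unfolding sqint_def by blast

text \<open>The product of two norms is at most the sum of their squares, which gives an integrable
  majorant.\<close>

lemma sqint_mult_integrable:
  assumes f: "sqint S f" and g: "sqint S g" and S: "S \<subseteq> I" "S \<in> sets lebesgue"
  shows "(\<lambda>x. of_real (r x) * (f x * g x)) absolutely_integrable_on S"
proof (rule measurable_bounded_by_integrable_imp_absolutely_integrable[OF _ S(2)])
  show "(\<lambda>x. complex_of_real (r x) * (f x * g x)) \<in> borel_measurable (lebesgue_on S)"
    using f g measurable_on_subset[OF r_measurable S(1)] unfolding sqint_def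
    by (intro borel_measurable_times borel_measurable_of_real) auto
  show "(\<lambda>x. norm (r x * (norm (f x))\<^sup>2) + norm (r x * (norm (g x))\<^sup>2)) integrable_on S"
    using f g unfolding sqint_def by (intro integrable_add set_lebesgue_integral_eq_integral(1) set_integrable_norm) auto
  fix x
  have "norm (f x) * norm (g x) \<le> (norm (f x))\<^sup>2 + (norm (g x))\<^sup>2"
    using sum_squares_bound[of "norm (f x)" "norm (g x)"] mult_nonneg_nonneg[OF norm_ge_zero[of "f x"] norm_ge_zero[of "g x"]]
    by linarith
  then have "\<bar>r x\<bar> * (norm (f x) * norm (g x)) \<le> \<bar>r x\<bar> * ((norm (f x))\<^sup>2 + (norm (g x))\<^sup>2)"
    by (intro mult_left_mono) auto
  then show "norm (complex_of_real (r x) * (f x * g x)) \<le> norm (r x * (norm (f x))\<^sup>2) + norm (r x * (norm (g x))\<^sup>2)"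
    by (simp add: norm_mult abs_mult distrib_left)
qed

lemma sqint_continuous:
  assumes f: "continuous_on {c..d} f" and "{c..d} \<subseteq> I"
  shows "sqint {c..d} f"
  unfolding sqint_def
proof
  show m: "f \<in> borel_measurable (lebesgue_on {c..d})"
    by (rule continuous_imp_measurable_on_sets_lebesgue[OF f]) simp
  have "(\<lambda>x. (norm (f x))\<^sup>2 * r x) absolutely_integrable_on {c..d}"
  proof (rule absolutely_integrable_bounded_measurable_product_real)
    have c: "continuous_on {c..d} (\<lambda>x. (norm (f x))\<^sup>2)" by (intro continuous_intros f)
    show "(\<lambda>x. (norm (f x))\<^sup>2) \<in> borel_measurable (lebesgue_on {c..d})"
      by (rule continuous_imp_measurable_on_sets_lebesgue[OF c]) simp
    show "bounded ((\<lambda>x. (norm (f x))\<^sup>2) ` {c..d})"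
      by (rule compact_imp_bounded[OF compact_continuous_image[OF c]]) simp
  qed (use coeff_integrable(3)[OF assms(2)] in auto)
  then show "(\<lambda>x. r x * (norm (f x))\<^sup>2) absolutely_integrable_on {c..d}" by (simp add: mult.commute)
qed

lemma sqint_add:
  assumes f: "sqint S f" and g: "sqint S g" and S: "S \<subseteq> I" "S \<in> sets lebesgue"
  shows "sqint S (\<lambda>x. f x + g x)"
  unfolding sqint_def
proof
  show m: "(\<lambda>x. f x + g x) \<in> borel_measurable (lebesgue_on S)" using f g by (auto simp: sqint_def)
  show "(\<lambda>x. r x * (norm (f x + g x))\<^sup>2) absolutely_integrable_on S"
  proof (rule measurable_bounded_by_integrable_imp_absolutely_integrable[OF _ S(2)])
    show "(\<lambda>x. r x * (norm (f x + g x))\<^sup>2) \<in> borel_measurable (lebesgue_on S)"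
      using m measurable_on_subset[OF r_measurable S(1)] by measurable
    show "(\<lambda>x. 2 * norm (r x * (norm (f x))\<^sup>2) + 2 * norm (r x * (norm (g x))\<^sup>2)) integrable_on S"
      using f g unfolding sqint_def
      by (intro integrable_add set_lebesgue_integral_eq_integral(1) set_integrable_norm set_integrable_mult_right) auto
    fix x
    have "(norm (f x + g x))\<^sup>2 \<le> (norm (f x) + norm (g x))\<^sup>2" by (intro power_mono norm_triangle_ineq) simp
    also have "\<dots> \<le> 2 * (norm (f x))\<^sup>2 + 2 * (norm (g x))\<^sup>2"
      using sum_squares_bound[of "norm (f x)" "norm (g x)"] by (simp add: power2_sum)
    finally have "\<bar>r x\<bar> * (norm (f x + g x))\<^sup>2 \<le> \<bar>r x\<bar> * (2 * (norm (f x))\<^sup>2 + 2 * (norm (g x))\<^sup>2)"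
      by (intro mult_left_mono) auto
    then show "norm (r x * (norm (f x + g x))\<^sup>2) \<le> 2 * norm (r x * (norm (f x))\<^sup>2) + 2 * norm (r x * (norm (g x))\<^sup>2)"
      by (simp add: abs_mult algebra_simps)
  qed
qed

lemma sqint_cmult:
  assumes f: "sqint S f"
  shows "sqint S (\<lambda>x. k * f x)"
proof -
  have "(\<lambda>x. (norm k)\<^sup>2 * (r x * (norm (f x))\<^sup>2)) absolutely_integrable_on S"
    using f unfolding sqint_def by (intro set_integrable_mult_right) auto
  then show ?thesis using f by (auto simp: sqint_def norm_mult power_mult_distrib mult.left_commute)
qed

lemma sqint_diff:
  assumes f: "sqint S f" and g: "sqint S g" and S: "S \<subseteq> I" "S \<in> sets lebesgue"
  shows "sqint S (\<lambda>x. f x - g x)"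
  using sqint_add[OF f sqint_cmult[OF g, of "-1"] S] by simp

lemma sqint_cnj: "sqint S f \<Longrightarrow> sqint S (\<lambda>x. cnj (f x))"
  using measurable_compose[OF _ borel_measurable_continuous_onI[OF continuous_on_cnj[OF continuous_on_id]]]
  unfolding sqint_def by auto

lemma sqint_cong_AE:
  assumes f: "sqint I f" and eq: "AE x in lebesgue_on I. f x = g x"
  shows "sqint I g"
proof -
  have neg: "negligible {x \<in> I. f x \<noteq> g x}" using eq by (simp only: AE_lebesgue_on_iff_negligible[OF I_sets])
  have "g \<in> borel_measurable (lebesgue_on I)"
  proof -
    have "(\<lambda>x. if x \<in> I then f x else 0) \<in> borel_measurable lebesgue"
      using f by (simp add: sqint_def borel_measurable_if)
    moreover have "AE x in lebesgue. (if x \<in> I then f x else 0) = (if x \<in> I then g x else 0)"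
      using eq by (subst (asm) AE_restrict_space_iff) (auto elim!: eventually_mono)
    ultimately have "(\<lambda>x. if x \<in> I then g x else 0) \<in> borel_measurable lebesgue"
      by (rule borel_measurable_AE)
    then show ?thesis by (simp add: borel_measurable_if)
  qed
  moreover have "(\<lambda>x. r x * (norm (g x))\<^sup>2) absolutely_integrable_on I"
    by (rule absolutely_integrable_spike[where f = "\<lambda>x. r x * (norm (f x))\<^sup>2", OF _ neg])
      (use f in \<open>auto simp: sqint_def\<close>)
  ultimately show ?thesis by (simp add: sqint_def)
qed

section \<open>Comparison of the weighted measure with Lebesgue measure\<close>

context
  fixes u v :: ereal
  assumes sub: "einterval u v \<subseteq> I"
begin

lemma weight_AE_r: "AE x in lebesgue_on (einterval u v). r x > 0"
proof -
  have "negligible {x \<in> einterval u v. \<not> r x > 0}"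
    by (rule negligible_subset[OF AE_r[unfolded AE_lebesgue_on_iff_negligible[OF I_sets]]]) (use sub in auto)
  then show ?thesis by (subst AE_lebesgue_on_iff_negligible) auto
qed

lemma weight_measurable: "r \<in> borel_measurable (lebesgue_on (einterval u v))"
  by (rule measurable_on_subset[OF r_measurable sub])

lemma borel_measurable_weight:
  "f \<in> borel_measurable (weight C u v) \<longleftrightarrow> f \<in> borel_measurable (lebesgue_on (einterval u v))"
  for f :: "real \<Rightarrow> 'b::topological_space"
proof -
  have "borel_measurable (weight C u v) = (borel_measurable (lebesgue_on (einterval u v)) :: (real \<Rightarrow> 'b) set)"
    by (rule measurable_cong_sets) (simp_all add: weight_def)
  then show ?thesis by simp
qed

lemma integrable_weight:
  fixes f :: "real \<Rightarrow> 'b::euclidean_space"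
  assumes "f \<in> borel_measurable (lebesgue_on (einterval u v))"
  shows "integrable (weight C u v) f \<longleftrightarrow> (\<lambda>x. r x *\<^sub>R f x) absolutely_integrable_on (einterval u v)"
proof -
  have "integrable (weight C u v) f \<longleftrightarrow> integrable (lebesgue_on (einterval u v)) (\<lambda>x. r x *\<^sub>R f x)"
    unfolding weight_def
    by (rule integrable_density[OF assms weight_measurable]) (use weight_AE_r in eventually_elim, simp)
  also have "\<dots> \<longleftrightarrow> (\<lambda>x. r x *\<^sub>R f x) absolutely_integrable_on (einterval u v)"
    unfolding set_integrable_def by (rule integrable_restrict_space) simp
  finally show ?thesis .
qed

lemma integral_weight:
  fixes f :: "real \<Rightarrow> complex"
  assumes "f \<in> borel_measurable (lebesgue_on (einterval u v))"
    and "(\<lambda>x. of_real (r x) * f x) absolutely_integrable_on (einterval u v)"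
  shows "integral\<^sup>L (weight C u v) f = integral (einterval u v) (\<lambda>x. of_real (r x) * f x)"
proof -
  have "integral\<^sup>L (weight C u v) f = integral\<^sup>L (lebesgue_on (einterval u v)) (\<lambda>x. r x *\<^sub>R f x)"
    unfolding weight_def
    by (rule integral_density[OF assms(1) weight_measurable]) (use weight_AE_r in eventually_elim, simp)
  also have "\<dots> = (LINT x:einterval u v|lebesgue. r x *\<^sub>R f x)"
    unfolding set_lebesgue_integral_def by (rule integral_restrict_space) simp
  also have "\<dots> = integral (einterval u v) (\<lambda>x. of_real (r x) * f x)"
    using set_lebesgue_integral_eq_integral(2)[OF assms(2)] by (simp add: scaleR_conv_of_real)
  finally show ?thesis .
qed

lemma L2_weight: "f \<in> L2 (weight C u v) \<longleftrightarrow> sqint (einterval u v) f"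
proof (cases "f \<in> borel_measurable (lebesgue_on (einterval u v))")
  case True
  then have "(\<lambda>x. (norm (f x))\<^sup>2) \<in> borel_measurable (lebesgue_on (einterval u v))" by measurable
  from integrable_weight[OF this] True show ?thesis
    by (simp add: L2_def sqint_def borel_measurable_weight)
qed (simp add: L2_def sqint_def borel_measurable_weight)

end

lemma L2_iff_sqint: "f \<in> L2 M \<longleftrightarrow> sqint I f"
  using L2_weight[of "sl_a C" "sl_b C"] by (simp add: sl_int_def)

text \<open>The weight is positive almost everywhere, so both measures have the same null sets in
  \<open>I\<close>.\<close>

lemma AE_M: "(AE x in M. P x) \<longleftrightarrow> (AE x in lebesgue_on I. P x)"
proof -
  have "(AE x in M. P x) \<longleftrightarrow> (AE x in lebesgue_on I. ennreal (r x) > 0 \<longrightarrow> P x)"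
    unfolding weight_def sl_int_def[symmetric]
    by (rule AE_density) (use r_measurable in measurable)
  also have "\<dots> \<longleftrightarrow> (AE x in lebesgue_on I. P x)"
  proof
    assume "AE x in lebesgue_on I. ennreal (r x) > 0 \<longrightarrow> P x"
    with AE_r show "AE x in lebesgue_on I. P x" by eventually_elim simp
  next
    assume "AE x in lebesgue_on I. P x"
    then show "AE x in lebesgue_on I. ennreal (r x) > 0 \<longrightarrow> P x" by eventually_elim simp
  qed
  finally show ?thesis .
qed

lemma L2_inner_eq:
  assumes "sqint I f" "sqint I g"
  shows "L2_inner M f g = integral I (\<lambda>x. of_real (r x) * (cnj (f x) * g x))"
proof -
  have "(\<lambda>x. of_real (r x) * (cnj (f x) * g x)) absolutely_integrable_on I"
    by (rule sqint_mult_integrable[OF sqint_cnj[OF assms(1)] assms(2)]) simp_all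
  moreover have "(\<lambda>x. cnj (f x) * g x) \<in> borel_measurable (lebesgue_on I)"
    using assms sqint_cnj[OF assms(1)] by (auto simp: sqint_def)
  ultimately show ?thesis
    unfolding L2_inner_def using integral_weight[of "sl_a C" "sl_b C" "\<lambda>x. cnj (f x) * g x"]
    by (simp add: sl_int_def)
qed

end

section \<open>The first-order system\<close>

context sl_problem
begin

text \<open>\<open>\<tau>f = k\<close> as a first-order system for \<open>f\<close> and its quasi-derivative \<open>f1\<close>.\<close>

definition sl_system :: "(real \<Rightarrow> complex) \<Rightarrow> (real \<Rightarrow> complex) \<Rightarrow> (real \<Rightarrow> complex) \<Rightarrow> bool" where
  "sl_system f f1 k \<longleftrightarrow>
     ac_deriv I f (\<lambda>x. of_real (inverse (p x)) * f1 x - of_real (s x) * f x) \<and>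
     ac_deriv I f1 (\<lambda>x. of_real (s x) * f1 x + of_real (q x) * f x - of_real (r x) * k x)"

lemma sl_system_AC_loc:
  assumes "sl_system f f1 k"
  shows "f \<in> AC_loc I" "f1 \<in> AC_loc I"
  using assms by (simp_all add: sl_system_def ac_deriv_def)

lemma sl_system_continuous_on:
  assumes "sl_system f f1 k"
  shows "continuous_on I f" "continuous_on I f1"
  using sl_system_AC_loc[OF assms] AC_loc_imp_continuous_on[OF open_I] by blast+

text \<open>Continuous functions that agree almost everywhere on an open set agree there, so the
  choice made by \<open>SOME\<close> in \<open>quasi_deriv\<close> has no effect on
  \<open>I\<close>.\<close>

lemma is_quasi_deriv_unique:
  assumes "is_quasi_deriv C f g" "is_quasi_deriv C f h" "x \<in> I"
  shows "g x = h x"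
proof (rule continuous_on_AE_eq_imp_eq[OF open_I _ _ _ \<open>x \<in> I\<close>])
  show "continuous_on I g" "continuous_on I h"
    using assms AC_loc_imp_continuous_on[OF open_I] by (simp_all add: is_quasi_deriv_def)
  have "AE x in lebesgue_on I. g x = of_real (p x) * (vector_derivative f (at x) + of_real (s x) * f x)"
    "AE x in lebesgue_on I. h x = of_real (p x) * (vector_derivative f (at x) + of_real (s x) * f x)"
    using assms(1,2) by (simp_all add: is_quasi_deriv_def)
  then show "AE x in lebesgue_on I. g x = h x" by eventually_elim simp
qed

lemma sl_system_is_quasi_deriv:
  assumes "sl_system f f1 k"
  shows "is_quasi_deriv C f f1"
  unfolding is_quasi_deriv_def
proof
  show "f1 \<in> AC_loc I" using sl_system_AC_loc[OF assms] by simp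
  have "AE x in lebesgue_on I. (f has_vector_derivative of_real (inverse (p x)) * f1 x - of_real (s x) * f x) (at x)"
    using assms by (simp add: sl_system_def ac_deriv_def)
  with AE_p show "AE x in lebesgue_on I. f1 x = of_real (p x) * (vector_derivative f (at x) + of_real (s x) * f x)"
    by eventually_elim (simp add: vector_derivative_at)
qed

lemma sl_system_quasi_deriv:
  assumes "sl_system f f1 k" "x \<in> I"
  shows "quasi_deriv C f x = f1 x"
proof -
  have "is_quasi_deriv C f (quasi_deriv C f)"
    unfolding quasi_deriv_def using sl_system_is_quasi_deriv[OF assms(1)] by (metis someI_ex)
  then show ?thesis using is_quasi_deriv_unique sl_system_is_quasi_deriv[OF assms(1)] assms(2) by blast
qed

lemma sl_system_dom_tau:
  assumes "sl_system f f1 k"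
  shows "f \<in> dom_tau C"
  using sl_system_is_quasi_deriv[OF assms] sl_system_AC_loc[OF assms] by (auto simp: dom_tau_def)

lemma sl_system_tau:
  assumes f: "sl_system f f1 k"
  shows "AE x in lebesgue_on I. tau C f x = k x"
proof -
  have "ac_deriv I (quasi_deriv C f) (\<lambda>x. of_real (s x) * f1 x + of_real (q x) * f x - of_real (r x) * k x)"
    by (rule ac_deriv_cong[of I f1]) (use f sl_system_quasi_deriv[OF f] open_I in \<open>simp_all add: sl_system_def\<close>)
  then have 1: "AE x in lebesgue_on I. (quasi_deriv C f has_vector_derivative
     of_real (s x) * f1 x + of_real (q x) * f x - of_real (r x) * k x) (at x)" by (simp add: ac_deriv_def)
  have 2: "AE x in lebesgue_on I. x \<in> I" by (rule AE_I2) simp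
  from 1 2 AE_r show ?thesis
    by eventually_elim (simp add: tau_def vector_derivative_at sl_system_quasi_deriv[OF f])
qed

text \<open>Away from the null sets where \<open>p\<close> vanishes or \<open>r\<close> is not
  positive, the defining equations can be solved for the two derivatives. Together with
  \<open>sl_system_dom_tau\<close> and \<open>sl_system_tau\<close> this translates the differential
  expression completely into the first-order system.\<close>

lemma dom_tau_sl_system:
  assumes f: "f \<in> dom_tau C"
  shows "sl_system f (quasi_deriv C f) (tau C f)"
proof -
  obtain g where "is_quasi_deriv C f g" using f by (auto simp: dom_tau_def)
  then have "is_quasi_deriv C f (quasi_deriv C f)" unfolding quasi_deriv_def by (metis someI_ex)
  then have q: "quasi_deriv C f \<in> AC_loc I" "AE x in lebesgue_on I. quasi_deriv C f x
      = of_real (p x) * (vector_derivative f (at x) + of_real (s x) * f x)"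
    by (simp_all add: is_quasi_deriv_def)
  have f: "f \<in> AC_loc I" using f by (simp add: dom_tau_def)
  show ?thesis
    unfolding sl_system_def
  proof
    show "ac_deriv I f (\<lambda>x. of_real (inverse (p x)) * quasi_deriv C f x - of_real (s x) * f x)"
    proof (rule ac_deriv_cong_AE[OF AC_loc_imp_ac_deriv[OF open_I f]])
      show "AE x in lebesgue_on I. vector_derivative f (at x) = of_real (inverse (p x)) * quasi_deriv C f x - of_real (s x) * f x"
        using q(2) AE_p by eventually_elim (simp add: field_simps)
    qed
    show "ac_deriv I (quasi_deriv C f) (\<lambda>x. of_real (s x) * quasi_deriv C f x + of_real (q x) * f x - of_real (r x) * tau C f x)"
    proof (rule ac_deriv_cong_AE[OF AC_loc_imp_ac_deriv[OF open_I q(1)]])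
      show "AE x in lebesgue_on I. vector_derivative (quasi_deriv C f) (at x)
          = of_real (s x) * quasi_deriv C f x + of_real (q x) * f x - of_real (r x) * tau C f x"
        using AE_r by eventually_elim (simp add: tau_def)
    qed
  qed
qed

lemma sl_system_cong_AE:
  assumes "sl_system f f1 k" "AE x in lebesgue_on I. k x = l x"
  shows "sl_system f f1 l"
  unfolding sl_system_def
proof
  show "ac_deriv I f (\<lambda>x. of_real (inverse (p x)) * f1 x - of_real (s x) * f x)"
    using assms(1) by (simp add: sl_system_def)
  show "ac_deriv I f1 (\<lambda>x. of_real (s x) * f1 x + of_real (q x) * f x - of_real (r x) * l x)"
  proof (rule ac_deriv_cong_AE)
    show "ac_deriv I f1 (\<lambda>x. of_real (s x) * f1 x + of_real (q x) * f x - of_real (r x) * k x)"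
      using assms(1) by (simp add: sl_system_def)
  qed (use assms(2) in eventually_elim, simp)
qed

lemma sl_system_add:
  assumes "sl_system f f1 k" "sl_system g g1 l"
  shows "sl_system (\<lambda>x. f x + g x) (\<lambda>x. f1 x + g1 x) (\<lambda>x. k x + l x)"
  unfolding sl_system_def
proof
  from assms have "ac_deriv I (\<lambda>x. f x + g x) (\<lambda>x. (of_real (inverse (p x)) * f1 x - of_real (s x) * f x) +
     (of_real (inverse (p x)) * g1 x - of_real (s x) * g x))" unfolding sl_system_def by (intro ac_deriv_add) auto
  then show "ac_deriv I (\<lambda>x. f x + g x) (\<lambda>x. of_real (inverse (p x)) * (f1 x + g1 x) - of_real (s x) * (f x + g x))"
    by (simp add: algebra_simps)
  from assms have "ac_deriv I (\<lambda>x. f1 x + g1 x) (\<lambda>x. (of_real (s x) * f1 x + of_real (q x) * f x - of_real (r x) * k x) +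
     (of_real (s x) * g1 x + of_real (q x) * g x - of_real (r x) * l x))" unfolding sl_system_def by (intro ac_deriv_add) auto
  then show "ac_deriv I (\<lambda>x. f1 x + g1 x) (\<lambda>x. of_real (s x) * (f1 x + g1 x) + of_real (q x) * (f x + g x)
     - of_real (r x) * (k x + l x))"
    by (simp add: algebra_simps)
qed

lemma sl_system_cmult:
  assumes "sl_system f f1 k"
  shows "sl_system (\<lambda>x. c * f x) (\<lambda>x. c * f1 x) (\<lambda>x. c * k x)"
  unfolding sl_system_def
proof
  from assms have "ac_deriv I (\<lambda>x. c * f x) (\<lambda>x. c * (of_real (inverse (p x)) * f1 x - of_real (s x) * f x))"
    unfolding sl_system_def by (intro ac_deriv_cmult) auto
  then show "ac_deriv I (\<lambda>x. c * f x) (\<lambda>x. of_real (inverse (p x)) * (c * f1 x) - of_real (s x) * (c * f x))"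
    by (simp add: algebra_simps)
  from assms have "ac_deriv I (\<lambda>x. c * f1 x) (\<lambda>x. c * (of_real (s x) * f1 x + of_real (q x) * f x - of_real (r x) * k x))"
    unfolding sl_system_def by (intro ac_deriv_cmult) auto
  then show "ac_deriv I (\<lambda>x. c * f1 x) (\<lambda>x. of_real (s x) * (c * f1 x) + of_real (q x) * (c * f x) - of_real (r x) * (c * k x))"
    by (simp add: algebra_simps)
qed

lemma sl_system_cnj:
  assumes "sl_system f f1 k"
  shows "sl_system (\<lambda>x. cnj (f x)) (\<lambda>x. cnj (f1 x)) (\<lambda>x. cnj (k x))"
  unfolding sl_system_def
proof
  from assms have "ac_deriv I (\<lambda>x. cnj (f x)) (\<lambda>x. cnj (of_real (inverse (p x)) * f1 x - of_real (s x) * f x))"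
    unfolding sl_system_def by (intro ac_deriv_cnj) auto
  then show "ac_deriv I (\<lambda>x. cnj (f x)) (\<lambda>x. of_real (inverse (p x)) * cnj (f1 x) - of_real (s x) * cnj (f x))" by simp
  from assms have "ac_deriv I (\<lambda>x. cnj (f1 x)) (\<lambda>x. cnj (of_real (s x) * f1 x + of_real (q x) * f x - of_real (r x) * k x))"
    unfolding sl_system_def by (intro ac_deriv_cnj) auto
  then show "ac_deriv I (\<lambda>x. cnj (f1 x)) (\<lambda>x. of_real (s x) * cnj (f1 x) + of_real (q x) * cnj (f x) - of_real (r x) * cnj (k x))"
    by simp
qed

text \<open>In the product rule the terms with \<open>inverse (p x)\<close>, \<open>s\<close> and
  \<open>q\<close> cancel in pairs. Only the terms with the weight survive, and these are integrable
  on all of \<open>I\<close> for elements of the maximal domain.\<close>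

lemma lagrange_identity:
  assumes "sl_system f f1 k" "sl_system g g1 l"
  shows "ac_deriv I (\<lambda>x. f x * g1 x - f1 x * g x) (\<lambda>x. of_real (r x) * (k x * g x - f x * l x))"
proof -
  have "ac_deriv I (\<lambda>x. f x * g1 x - f1 x * g x)
    (\<lambda>x. (f x * (of_real (s x) * g1 x + of_real (q x) * g x - of_real (r x) * l x) +
          (of_real (inverse (p x)) * f1 x - of_real (s x) * f x) * g1 x) -
         (f1 x * (of_real (inverse (p x)) * g1 x - of_real (s x) * g x) +
          (of_real (s x) * f1 x + of_real (q x) * f x - of_real (r x) * k x) * g x))"
    using assms unfolding sl_system_def by (intro ac_deriv_diff ac_deriv_mult open_I) auto
  then show ?thesis by (rule ac_deriv_cong_AE) (simp add: algebra_simps)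
qed

lemma wronskian_eq:
  assumes "sl_system f f1 k" "sl_system g g1 l" "x \<in> I"
  shows "wronskian C f g x = f x * g1 x - f1 x * g x"
  using assms by (simp add: wronskian_def sl_system_quasi_deriv)

lemma wronskian_diff:
  assumes f: "sl_system f f1 k" and g: "sl_system g g1 l" and cd: "c \<le> d" "c \<in> I" "d \<in> I"
  shows "(\<lambda>x. of_real (r x) * (k x * g x - f x * l x)) absolutely_integrable_on {c..d}"
    "((\<lambda>x. of_real (r x) * (k x * g x - f x * l x)) has_integral (wronskian C f g d - wronskian C f g c)) {c..d}"
  using ac_deriv_FTC[OF lagrange_identity[OF f g] open_I cd(1) Icc_subset_I[OF cd(2,3)]] cd
  by (simp_all add: wronskian_eq[OF f g])

section \<open>The domain of the maximal operator\<close>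

lemma dom_T_max_iff:
  "g \<in> dom_T_max C \<longleftrightarrow> sl_system g (quasi_deriv C g) (tau C g) \<and> sqint I g \<and> sqint I (tau C g)"
  using dom_tau_sl_system[of g] sl_system_dom_tau[of g] by (auto simp: dom_T_max_def L2_iff_sqint)

lemma dom_T_maxI:
  assumes "sl_system f f1 k" "sqint I f" "sqint I k"
  shows "f \<in> dom_T_max C" "AE x in lebesgue_on I. tau C f x = k x"
proof -
  show t: "AE x in lebesgue_on I. tau C f x = k x" by (rule sl_system_tau[OF assms(1)])
  then have "AE x in lebesgue_on I. k x = tau C f x" by eventually_elim simp
  then show "f \<in> dom_T_max C"
    using assms sl_system_dom_tau sqint_cong_AE by (simp add: dom_T_max_def L2_iff_sqint)
qed

lemma dom_T_max_D:
  assumes "f \<in> dom_T_max C"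
  shows "sl_system f (quasi_deriv C f) (tau C f)" "sqint I f" "sqint I (tau C f)"
  using assms by (simp_all add: dom_T_max_iff)

lemma dom_T_max_add:
  assumes f: "f \<in> dom_T_max C" and g: "g \<in> dom_T_max C"
  shows "(\<lambda>x. f x + g x) \<in> dom_T_max C" "AE x in lebesgue_on I. tau C (\<lambda>x. f x + g x) x = tau C f x + tau C g x"
  using dom_T_maxI[OF sl_system_add[OF dom_T_max_D(1)[OF f] dom_T_max_D(1)[OF g]]]
    sqint_add dom_T_max_D[OF f] dom_T_max_D[OF g] by simp_all

lemma dom_T_max_cmult:
  assumes f: "f \<in> dom_T_max C"
  shows "(\<lambda>x. c * f x) \<in> dom_T_max C" "AE x in lebesgue_on I. tau C (\<lambda>x. c * f x) x = c * tau C f x"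
  using dom_T_maxI[OF sl_system_cmult[OF dom_T_max_D(1)[OF f]]] sqint_cmult dom_T_max_D[OF f] by simp_all

lemma dom_T_max_cnj:
  assumes f: "f \<in> dom_T_max C"
  shows "cnj_fun f \<in> dom_T_max C" "AE x in lebesgue_on I. tau C (cnj_fun f) x = cnj (tau C f x)"
  using dom_T_maxI[OF sl_system_cnj[OF dom_T_max_D(1)[OF f]]] sqint_cnj dom_T_max_D[OF f]
  by (simp_all add: cnj_fun_def)

end

section \<open>Boundary values of the Wronskian\<close>

context sl_problem
begin

section \<open>The filters at the endpoints\<close>

lemma eventually_to_a: "eventually P (to_a C) \<longleftrightarrow> (\<exists>c\<in>I. \<forall>x\<in>I. x < c \<longrightarrow> P x)"
proof -
  have ab: "sl_a C < sl_b C" using SL by (simp add: sturm_liouville_def)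
  have "eventually P (to_a C) \<longleftrightarrow> (\<exists>b>sl_a C. \<forall>y>sl_a C. y < b \<longrightarrow> P (real_of_ereal y))"
    unfolding to_a_def eventually_filtermap by (rule eventually_at_right[OF ab])
  also have "\<dots> \<longleftrightarrow> (\<exists>c\<in>I. \<forall>x\<in>I. x < c \<longrightarrow> P x)"
  proof
    assume "\<exists>b>sl_a C. \<forall>y>sl_a C. y < b \<longrightarrow> P (real_of_ereal y)"
    then obtain b where b: "b > sl_a C" "\<forall>y>sl_a C. y < b \<longrightarrow> P (real_of_ereal y)" by auto
    have "sl_a C < min b (sl_b C)" using b(1) ab by simp
    then obtain c where c: "sl_a C < ereal c" "ereal c < min b (sl_b C)" using ereal_dense2 by blast
    have "P x" if "x \<in> I" "x < c" for x
    proof -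
      have "ereal x < b" using c(2) that(2) by (meson ereal_less_eq(3) le_less_trans less_imp_le min_less_iff_conj)
      then show ?thesis using b(2)[rule_format, of "ereal x"] that(1) by (simp add: mem_I)
    qed
    then show "\<exists>c\<in>I. \<forall>x\<in>I. x < c \<longrightarrow> P x" using c by (intro bexI[of _ c]) (simp_all add: mem_I)
  next
    assume "\<exists>c\<in>I. \<forall>x\<in>I. x < c \<longrightarrow> P x"
    then obtain c where c: "c \<in> I" "\<forall>x\<in>I. x < c \<longrightarrow> P x" by auto
    have "P (real_of_ereal y)" if y: "sl_a C < y" "y < ereal c" for y
    proof (cases y)
      case (real x)
      have "ereal x < sl_b C" using y(2) c(1) real by (simp add: mem_I) (meson less_trans ereal_less(1) less_ereal.simps(1))
      then have "x \<in> I" using y(1) real by (simp add: mem_I)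
      then show ?thesis using c(2) y(2) real by simp
    qed (use y in auto)
    then show "\<exists>b>sl_a C. \<forall>y>sl_a C. y < b \<longrightarrow> P (real_of_ereal y)"
      using c(1) by (intro exI[of _ "ereal c"]) (simp add: mem_I)
  qed
  finally show ?thesis .
qed

lemma eventually_to_b: "eventually P (to_b C) \<longleftrightarrow> (\<exists>c\<in>I. \<forall>x\<in>I. c < x \<longrightarrow> P x)"
proof -
  have ab: "sl_a C < sl_b C" using SL by (simp add: sturm_liouville_def)
  have "eventually P (to_b C) \<longleftrightarrow> (\<exists>b<sl_b C. \<forall>y>b. y < sl_b C \<longrightarrow> P (real_of_ereal y))"
    unfolding to_b_def eventually_filtermap by (rule eventually_at_left[OF ab])
  also have "\<dots> \<longleftrightarrow> (\<exists>c\<in>I. \<forall>x\<in>I. c < x \<longrightarrow> P x)"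
  proof
    assume "\<exists>b<sl_b C. \<forall>y>b. y < sl_b C \<longrightarrow> P (real_of_ereal y)"
    then obtain b where b: "b < sl_b C" "\<forall>y>b. y < sl_b C \<longrightarrow> P (real_of_ereal y)" by auto
    have "max b (sl_a C) < sl_b C" using b(1) ab by simp
    then obtain c where c: "max b (sl_a C) < ereal c" "ereal c < sl_b C" using ereal_dense2 by blast
    have "P x" if "x \<in> I" "c < x" for x
    proof -
      have "b < ereal x" using c(1) that(2) by (meson ereal_less_eq(3) less_le_trans less_imp_le max_less_iff_conj)
      then show ?thesis using b(2)[rule_format, of "ereal x"] that(1) by (simp add: mem_I)
    qed
    then show "\<exists>c\<in>I. \<forall>x\<in>I. c < x \<longrightarrow> P x" using c by (intro bexI[of _ c]) (simp_all add: mem_I)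
  next
    assume "\<exists>c\<in>I. \<forall>x\<in>I. c < x \<longrightarrow> P x"
    then obtain c where c: "c \<in> I" "\<forall>x\<in>I. c < x \<longrightarrow> P x" by auto
    have "P (real_of_ereal y)" if y: "ereal c < y" "y < sl_b C" for y
    proof (cases y)
      case (real x)
      have "sl_a C < ereal x" using y(1) c(1) real by (simp add: mem_I) (meson less_trans less_ereal.simps(1))
      then have "x \<in> I" using y(2) real by (simp add: mem_I)
      then show ?thesis using c(2) y(1) real by simp
    qed (use y in auto)
    then show "\<exists>b<sl_b C. \<forall>y>b. y < sl_b C \<longrightarrow> P (real_of_ereal y)"
      using c(1) by (intro exI[of _ "ereal c"]) (simp add: mem_I)
  qed
  finally show ?thesis .
qed

lemma I_extend:
  assumes "c \<in> I"
  obtains u v where "u \<in> I" "u < c" "v \<in> I" "c < v"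
proof -
  obtain u v where "u < c" "c < v" "{u..v} \<subseteq> I" by (rule open_real_Icc_nhd[OF open_I assms])
  note uv = this
  then have "u \<in> {u..v}" "v \<in> {u..v}" by simp_all
  with uv(3) have "u \<in> I" "v \<in> I" by blast+
  with uv show thesis by (intro that[of u v])
qed

lemma to_a_neq_bot: "to_a C \<noteq> bot"
  unfolding trivial_limit_def[symmetric]
proof -
  have "\<not> eventually (\<lambda>_. False) (to_a C)"
    unfolding eventually_to_a using I_extend by (metis)
  then show "to_a C \<noteq> bot" by (simp add: eventually_False[symmetric])
qed

lemma to_b_neq_bot: "to_b C \<noteq> bot"
proof -
  have "\<not> eventually (\<lambda>_. False) (to_b C)"
    unfolding eventually_to_b using I_extend by (metis)
  then show "to_b C \<noteq> bot" by (simp add: eventually_False[symmetric])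
qed

text \<open>Dominated convergence along an exhaustion by compact intervals. The bound is uniform
  over all measurable sets missing the interval, so one interval serves for both tails and for every
  endpoint neighbourhood that avoids it.\<close>

lemma small_tails:
  fixes h :: "real \<Rightarrow> 'b::euclidean_space"
  assumes h: "h absolutely_integrable_on I" and "\<epsilon> > 0"
  shows "\<exists>c\<in>I. \<exists>d\<in>I. c \<le> d \<and>
    (\<forall>S. S \<in> sets lebesgue \<longrightarrow> S \<subseteq> I \<longrightarrow> S \<inter> {c..d} = {} \<longrightarrow> integral S (\<lambda>x. norm (h x)) < \<epsilon>)"
proof -
  have ab: "sl_a C < sl_b C" using SL by (simp add: sturm_liouville_def)
  obtain u l :: "nat \<Rightarrow> real" where "einterval (sl_a C) (sl_b C) = (\<Union>i. {l i..u i})"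
      and ul': "incseq u" "decseq l" "\<And>i. l i < u i"
    by (rule einterval_Icc_approximation[OF ab]) (rule that)
  then have ul: "I = (\<Union>i. {l i..u i})" "incseq u" "decseq l" "\<And>i. l i < u i"
    by (simp_all add: sl_int_def)
  define g where "g x = norm (h x)" for x
  have g: "g absolutely_integrable_on I" unfolding g_def by (rule set_integrable_norm[OF h])
  have gint: "g integrable_on S" if "S \<subseteq> I" "S \<in> sets lebesgue" for S
    using set_integrable_subset[OF g] that set_lebesgue_integral_eq_integral(1) by blast
  have sub: "{l i..u i} \<subseteq> I" for i using ul(1) by blast
  have "(\<lambda>k. integral I (\<lambda>x. if x \<in> {l k..u k} then g x else 0)) \<longlonglongrightarrow> integral I g"
  proof (rule dominated_convergence(2)[where h = g])
    have "{l k..u k} \<inter> I = {l k..u k}" for k using sub by blast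
    then show "(\<lambda>x. if x \<in> {l k..u k} then g x else 0) integrable_on I" for k
      unfolding integrable_restrict_Int using gint[OF sub] by simp
    show "g integrable_on I" by (rule gint) simp_all
    show "norm (if x \<in> {l k..u k} then g x else 0) \<le> g x" for k x by (simp add: g_def)
    fix x assume "x \<in> I"
    then obtain N where N: "x \<in> {l N..u N}" using ul(1) by blast
    have "x \<in> {l k..u k}" if "N \<le> k" for k
      using N decseqD[OF ul(3) that] incseqD[OF ul(2) that] by auto
    then have "eventually (\<lambda>k. (if x \<in> {l k..u k} then g x else 0) = g x) sequentially"
      unfolding eventually_sequentially by (intro exI[of _ N]) simp
    then show "(\<lambda>k. if x \<in> {l k..u k} then g x else 0) \<longlonglongrightarrow> g x" by (rule tendsto_eventually)
  qed
  moreover have "integral I (\<lambda>x. if x \<in> {l k..u k} then g x else 0) = integral {l k..u k} g" for k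
    by (simp only: integral_restrict_Int Int_absorb2[OF sub])
  ultimately have "(\<lambda>k. integral {l k..u k} g) \<longlonglongrightarrow> integral I g" by simp
  then have "eventually (\<lambda>k. integral {l k..u k} g > integral I g - \<epsilon>) sequentially"
    using \<open>\<epsilon> > 0\<close> by (intro order_tendstoD(1)) auto
  then obtain k where k: "integral {l k..u k} g > integral I g - \<epsilon>"
    unfolding eventually_sequentially by blast
  show ?thesis
  proof (rule bexI[of _ "l k"], rule bexI[of _ "u k"], intro conjI allI impI)
    show "l k \<in> I" "u k \<in> I" using sub[of k] ul(4)[of k] by auto
    show "l k \<le> u k" using ul(4)[of k] by simp
    fix S :: "real set" assume S: "S \<in> sets lebesgue" "S \<subseteq> I" "S \<inter> {l k..u k} = {}"
    have "integral S g + integral {l k..u k} g = integral (S \<union> {l k..u k}) g"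
      by (rule Henstock_Kurzweil_Integration.integral_Un[symmetric]) (use S gint gint[OF sub] in auto)
    also have "\<dots> \<le> integral I g"
    proof -
      have un: "S \<union> {l k..u k} \<subseteq> I" "S \<union> {l k..u k} \<in> sets lebesgue"
        using S(2) sub[of k] by (simp, intro sets.Un S(1), simp)
      show ?thesis
        by (rule integral_subset_le[OF un(1) gint[OF un] gint[OF order_refl I_sets]]) (simp add: g_def)
    qed
    finally show "integral S (\<lambda>x. norm (h x)) < \<epsilon>" using k unfolding g_def[symmetric] by simp
  qed
qed

lemma primitive_limits:
  fixes h W :: "real \<Rightarrow> complex"
  assumes h: "h absolutely_integrable_on I"
    and W: "\<And>c d. c \<in> I \<Longrightarrow> d \<in> I \<Longrightarrow> c \<le> d \<Longrightarrow> (h has_integral (W d - W c)) {c..d}"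
  obtains La Lb where "(W \<longlongrightarrow> La) (to_a C)" "(W \<longlongrightarrow> Lb) (to_b C)" "Lb - La = integral I h"
proof -
  have hint: "h integrable_on S" "(\<lambda>x. norm (h x)) integrable_on S" if "S \<subseteq> I" "S \<in> sets lebesgue" for S
    using set_integrable_subset[OF h] set_integrable_norm[OF set_integrable_subset[OF h]]
      that set_lebesgue_integral_eq_integral(1) by blast+
  have S[simp]: "I \<inter> {..x} \<in> sets lebesgue" "I \<inter> {x<..} \<in> sets lebesgue" for x
    by (intro sets.Int I_sets; simp)+
  define \<Phi> where "\<Phi> x = integral (I \<inter> {..x}) h" for x
  have step: "\<Phi> d = \<Phi> c + (W d - W c)" if cd: "c \<in> I" "d \<in> I" "c \<le> d" for c d
  proof -
    have "integral ((I \<inter> {..c}) \<union> {c..d}) h = integral (I \<inter> {..c}) h + integral {c..d} h"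
    proof (rule Henstock_Kurzweil_Integration.integral_Un)
      show "negligible (I \<inter> {..c} \<inter> {c..d})" by (rule negligible_subset[of "{c}"]) auto
    qed (use hint Icc_subset_I[OF cd(1,2)] in auto)
    moreover have "(I \<inter> {..c}) \<union> {c..d} = I \<inter> {..d}" using Icc_subset_I[OF cd(1,2)] cd(3) by auto
    ultimately show ?thesis using W[OF cd] by (simp add: \<Phi>_def integral_unique)
  qed
  obtain c0 where c0: "c0 \<in> I" by (rule I_nonempty)
  \<comment> \<open>The difference of \<open>W\<close> and \<open>\<Phi>\<close> is constant on
    \<open>I\<close>, and \<open>\<Phi>\<close> tends to zero at the left endpoint, so this constant
    is the limit there.\<close>
  define La where "La = W c0 - \<Phi> c0"
  have WLa: "W x - La = \<Phi> x" if "x \<in> I" for x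
    using step[OF that c0] step[OF c0 that] by (cases "x \<le> c0") (simp_all add: La_def)
  have WLb: "W x - (La + integral I h) = - integral (I \<inter> {x<..}) h" if "x \<in> I" for x
  proof -
    have "integral ((I \<inter> {..x}) \<union> (I \<inter> {x<..})) h = integral (I \<inter> {..x}) h + integral (I \<inter> {x<..}) h"
    proof (rule Henstock_Kurzweil_Integration.integral_Un)
      have "(I \<inter> {..x}) \<inter> (I \<inter> {x<..}) = {}" by auto
      then show "negligible ((I \<inter> {..x}) \<inter> (I \<inter> {x<..}))" by simp
    qed (use hint in auto)
    moreover have "(I \<inter> {..x}) \<union> (I \<inter> {x<..}) = I" by auto
    ultimately show ?thesis using WLa[OF that] by (simp add: \<Phi>_def algebra_simps)
  qed
  have nle: "norm (integral S h) \<le> integral S (\<lambda>x. norm (h x))" if "S \<subseteq> I" "S \<in> sets lebesgue" for S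
    using that by (intro integral_norm_bound_integral hint) auto
  have "(W \<longlongrightarrow> La) (to_a C)"
    unfolding tendsto_iff
  proof (intro allI impI)
    fix e :: real assume "e > 0"
    obtain c d where cd: "c \<in> I" "d \<in> I" "c \<le> d"
      "\<And>S. S \<in> sets lebesgue \<Longrightarrow> S \<subseteq> I \<Longrightarrow> S \<inter> {c..d} = {} \<Longrightarrow> integral S (\<lambda>x. norm (h x)) < e"
      using small_tails[OF h \<open>e > 0\<close>] by blast
    have "dist (W x) La < e" if "x \<in> I" "x < c" for x
    proof -
      have "norm (\<Phi> x) \<le> integral (I \<inter> {..x}) (\<lambda>x. norm (h x))" unfolding \<Phi>_def by (rule nle) auto
      also have "\<dots> < e" by (rule cd(4)) (use that in auto)
      finally show ?thesis using WLa[OF that(1)] by (simp add: dist_norm)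
    qed
    then show "eventually (\<lambda>x. dist (W x) La < e) (to_a C)" unfolding eventually_to_a using cd(1) by blast
  qed
  moreover have "(W \<longlongrightarrow> La + integral I h) (to_b C)"
    unfolding tendsto_iff
  proof (intro allI impI)
    fix e :: real assume "e > 0"
    obtain c d where cd: "c \<in> I" "d \<in> I" "c \<le> d"
      "\<And>S. S \<in> sets lebesgue \<Longrightarrow> S \<subseteq> I \<Longrightarrow> S \<inter> {c..d} = {} \<Longrightarrow> integral S (\<lambda>x. norm (h x)) < e"
      using small_tails[OF h \<open>e > 0\<close>] by blast
    have "dist (W x) (La + integral I h) < e" if "x \<in> I" "d < x" for x
    proof -
      have "norm (integral (I \<inter> {x<..}) h) \<le> integral (I \<inter> {x<..}) (\<lambda>x. norm (h x))" by (rule nle) auto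
      also have "\<dots> < e" by (rule cd(4)) (use that in auto)
      finally show ?thesis using WLb[OF that(1)] by (simp add: dist_norm)
    qed
    then show "eventually (\<lambda>x. dist (W x) (La + integral I h) < e) (to_b C)" unfolding eventually_to_b using cd(2) by blast
  qed
  ultimately show thesis by (rule that) simp
qed

text \<open>\<open>Lim\<close> is an unspecified value where no limit exists; here it is identified
  with a true limit. The last claim is Green's formula with both boundary terms.\<close>

lemma wronskian_tendsto:
  assumes f: "f \<in> dom_T_max C" and g: "g \<in> dom_T_max C"
  shows "(wronskian C f g \<longlongrightarrow> wronskian_lim C (to_a C) f g) (to_a C)"
    "(wronskian C f g \<longlongrightarrow> wronskian_lim C (to_b C) f g) (to_b C)"
    "wronskian_lim C (to_b C) f g - wronskian_lim C (to_a C) f g =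
       integral I (\<lambda>x. of_real (r x) * (tau C f x * g x - f x * tau C g x))"
proof -
  note f' = dom_T_max_D[OF f] and g' = dom_T_max_D[OF g]
  let ?h = "\<lambda>x. of_real (r x) * (tau C f x * g x - f x * tau C g x)"
  have "(\<lambda>x. of_real (r x) * (tau C f x * g x) - of_real (r x) * (f x * tau C g x)) absolutely_integrable_on I"
    by (intro set_integral_diff sqint_mult_integrable f' g') simp_all
  then have h: "?h absolutely_integrable_on I" by (simp add: algebra_simps)
  have "(?h has_integral (wronskian C f g d - wronskian C f g c)) {c..d}" if "c \<in> I" "d \<in> I" "c \<le> d" for c d
    by (rule wronskian_diff(2)[OF f'(1) g'(1) that(3,1,2)])
  then obtain La Lb where L: "(wronskian C f g \<longlongrightarrow> La) (to_a C)" "(wronskian C f g \<longlongrightarrow> Lb) (to_b C)"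
      "Lb - La = integral I ?h"
    by (rule primitive_limits[OF h])
  have "wronskian_lim C (to_a C) f g = La" "wronskian_lim C (to_b C) f g = Lb"
    unfolding wronskian_lim_def using L tendsto_Lim[OF to_a_neq_bot] tendsto_Lim[OF to_b_neq_bot] by auto
  with L show "(wronskian C f g \<longlongrightarrow> wronskian_lim C (to_a C) f g) (to_a C)"
    "(wronskian C f g \<longlongrightarrow> wronskian_lim C (to_b C) f g) (to_b C)"
    "wronskian_lim C (to_b C) f g - wronskian_lim C (to_a C) f g = integral I ?h" by auto
qed

end

section \<open>The limit-point case\<close>

context sl_problem
begin

lemma sqint_norm: "sqint S f \<Longrightarrow> sqint S (\<lambda>x. of_real (norm (f x)))"
  unfolding sqint_def by (auto intro!: borel_measurable_of_real borel_measurable_norm)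

lemma sqint_Un:
  assumes "sqint S f" "sqint T f" "S \<in> sets lebesgue" "T \<in> sets lebesgue"
  shows "sqint (S \<union> T) f"
proof -
  have "f \<in> borel_measurable (lebesgue_on (S \<union> T))"
  proof -
    have "(\<lambda>x. if x \<in> S then f x else 0) \<in> borel_measurable lebesgue" "(\<lambda>x. if x \<in> T then f x else 0) \<in> borel_measurable lebesgue"
      using assms by (simp_all add: sqint_def borel_measurable_if)
    then have "(\<lambda>x. if x \<in> S then (if x \<in> S then f x else 0) else (if x \<in> T then f x else 0)) \<in> borel_measurable lebesgue"
      by (rule measurable_If_set) (use assms in simp)
    moreover have "(\<lambda>x. if x \<in> S then (if x \<in> S then f x else 0) else (if x \<in> T then f x else 0))
        = (\<lambda>x. if x \<in> S \<union> T then f x else 0)" by auto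
    ultimately show ?thesis using assms borel_measurable_if[of "S \<union> T" f] by auto
  qed
  moreover have "(\<lambda>x. r x * (norm (f x))\<^sup>2) absolutely_integrable_on (S \<union> T)"
    using assms by (intro absolutely_integrable_Un) (auto simp: sqint_def)
  ultimately show ?thesis by (simp add: sqint_def)
qed

text \<open>The segment between \<open>d\<close> and \<open>x\<close> carries no orientation, so one
  estimate serves on both sides of the base point and thereby at both endpoints.\<close>

lemma wronskian_add_seg:
  assumes u: "sl_system u u1 k" and f: "sl_system f f1 l" and "d \<in> I" "x \<in> I"
  shows "norm (wronskian C u f x) \<le> norm (wronskian C u f d)
     + integral (closed_segment d x) (\<lambda>t. norm (of_real (r t) * (k t * f t - u t * l t)))"
proof -
  let ?h = "\<lambda>t. of_real (r t) * (k t * f t - u t * l t)"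
  have *: "norm (wronskian C u f y - wronskian C u f z) \<le> integral {z..y} (\<lambda>t. norm (?h t))"
    if "z \<le> y" "z \<in> I" "y \<in> I" for z y
  proof -
    note h = wronskian_diff[OF u f that]
    have "norm (integral {z..y} ?h) \<le> integral {z..y} (\<lambda>t. norm (?h t))"
      by (rule integral_norm_bound_integral[OF set_lebesgue_integral_eq_integral(1)[OF h(1)]
            set_lebesgue_integral_eq_integral(1)[OF set_integrable_norm[OF h(1)]]]) simp
    then show ?thesis using h(2) by (simp add: integral_unique)
  qed
  have "norm (wronskian C u f x - wronskian C u f d) \<le> integral (closed_segment d x) (\<lambda>t. norm (?h t))"
    using *[of d x] *[of x d] assms(3,4) by (cases "d \<le> x") (simp_all add: closed_segment_eq_real_ivl norm_minus_commute)
  then show ?thesis using norm_triangle_ineq2[of "wronskian C u f x" "wronskian C u f d"] by linarith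
qed

text \<open>Expanding \<open>u W(f,g)\<close> gives \<open>\<delta> |u| \<le> A (K + J)\<close>,
  where \<open>J x\<close> is the integral of \<open>|r| |u| B\<close> between \<open>d\<close> and
  \<open>x\<close>. Multiplying by \<open>|r| B\<close> and integrating again yields
  \<open>\<delta> J \<le> (K + J) \<delta> / 2\<close> by \<open>small\<close>, hence
  \<open>J \<le> K\<close>. This absorption leaves \<open>u\<close> bounded by a multiple of the
  square-integrable function \<open>A\<close>.\<close>

lemma sqint_solution_of_wronskian_bound:
  assumes U: "U \<subseteq> I" "U \<in> sets lebesgue" "is_interval U" "d \<in> U"
    and f: "sl_system f f1 kf" "sqint U f" "sqint U kf"
    and g: "sl_system g g1 kg" "sqint U g" "sqint U kg"
    and u: "sl_system u u1 (\<lambda>x. z * u x)"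
    and "\<delta> > 0" and W: "\<And>x. x \<in> U \<Longrightarrow> \<delta> \<le> norm (wronskian C f g x)"
    and small: "integral U (\<lambda>x. norm (of_real (r x) * (complex_of_real (norm (f x) + norm (g x)) *
         complex_of_real (norm (z * f x - kf x) + norm (z * g x - kg x))))) \<le> \<delta> / 2"
  shows "sqint U u"
proof -
  define A where "A x = norm (f x) + norm (g x)" for x
  define B where "B x = norm (z * f x - kf x) + norm (z * g x - kg x)" for x
  have A0: "A x \<ge> 0" and B0: "B x \<ge> 0" for x by (simp_all add: A_def B_def)
  have sqA: "sqint U (\<lambda>x. of_real (A x))"
    unfolding A_def of_real_add by (intro sqint_add sqint_norm f g U)
  have sqB: "sqint U (\<lambda>x. of_real (B x))"
    unfolding B_def of_real_add by (intro sqint_add sqint_norm sqint_diff sqint_cmult f g U)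
  define h where "h x = \<bar>r x\<bar> * (A x * B x)" for x
  have h_eq: "h x = norm (of_real (r x) * (complex_of_real (A x) * complex_of_real (B x)))" for x
    using A0[of x] B0[of x] by (simp add: h_def norm_mult)
  have hint: "h absolutely_integrable_on U"
    unfolding h_eq by (intro set_integrable_norm sqint_mult_integrable sqA sqB U)
  have hU: "integral U h \<le> \<delta> / 2" using small unfolding h_eq A_def B_def by simp
  have uc: "continuous_on I u" by (rule sl_system_continuous_on[OF u])
  have seg: "closed_segment d x \<subseteq> U" if "x \<in> U" for x
    using closed_segment_subset[OF U(4) that] is_interval_convex[OF U(3)] by blast
  define J where "J x = integral (closed_segment d x) (\<lambda>t. \<bar>r t\<bar> * (norm (u t) * B t))" for x
  have Jint: "(\<lambda>t. \<bar>r t\<bar> * (norm (u t) * B t)) integrable_on closed_segment d x" if x: "x \<in> U" for x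
  proof -
    obtain c e where ce: "closed_segment d x = {c..e}" by (metis closed_segment_eq_real_ivl)
    have sub: "{c..e} \<subseteq> I" using seg[OF x] U(1) ce by blast
    have "sqint {c..e} u" by (rule sqint_continuous[OF continuous_on_subset[OF uc sub] sub])
    moreover have "sqint {c..e} (\<lambda>x. of_real (B x))"
      by (rule sqint_subset[OF sqB]) (use seg[OF x] ce in auto)
    ultimately have "(\<lambda>t. norm (of_real (r t) * (u t * complex_of_real (B t)))) absolutely_integrable_on {c..e}"
      by (intro set_integrable_norm sqint_mult_integrable sub) auto
    then show ?thesis
      unfolding ce using set_lebesgue_integral_eq_integral(1) B0 by (simp add: norm_mult)
  qed
  define K where "K = norm (wronskian C u f d) + norm (wronskian C u g d)"
  have wb: "norm (wronskian C u f x) \<le> norm (wronskian C u f d) + J x"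
    if x: "x \<in> U" and f: "sl_system f f1 kf" and le: "\<And>t. norm (z * f t - kf t) \<le> B t" for x f f1 kf
  proof -
    have "norm (wronskian C u f x) \<le> norm (wronskian C u f d)
     + integral (closed_segment d x) (\<lambda>t. norm (of_real (r t) * ((z * u t) * f t - u t * kf t)))"
      by (rule wronskian_add_seg[OF u f]) (use U x in auto)
    also have "integral (closed_segment d x) (\<lambda>t. norm (of_real (r t) * ((z * u t) * f t - u t * kf t))) \<le> J x"
      unfolding J_def
    proof (rule integral_le[OF _ Jint[OF x]])
      obtain c e where ce: "closed_segment d x = {c..e}" "c \<le> e"
        using closed_segment_eq_real_ivl[of d x] by (metis linear)
      have "c \<in> I" "e \<in> I" using seg[OF x] U(1) ce by auto
      from set_integrable_norm[OF wronskian_diff(1)[OF u f ce(2) this]]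
      show "(\<lambda>t. norm (of_real (r t) * ((z * u t) * f t - u t * kf t))) integrable_on closed_segment d x"
        unfolding ce(1) by (rule set_lebesgue_integral_eq_integral(1))
      fix t
      have "(z * u t) * f t - u t * kf t = u t * (z * f t - kf t)" by (simp add: algebra_simps)
      then have "norm (of_real (r t) * ((z * u t) * f t - u t * kf t)) = \<bar>r t\<bar> * (norm (u t) * norm (z * f t - kf t))"
        by (simp add: norm_mult)
      also have "\<dots> \<le> \<bar>r t\<bar> * (norm (u t) * B t)" using le by (intro mult_left_mono) auto
      finally show "norm (of_real (r t) * ((z * u t) * f t - u t * kf t)) \<le> \<bar>r t\<bar> * (norm (u t) * B t)" .
    qed
    finally show ?thesis by simp
  qed
  have ub: "\<delta> * norm (u x) \<le> A x * (K + J x)" if x: "x \<in> U" for x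
  proof -
    have xI: "x \<in> I" using x U(1) by blast
    have "u x * wronskian C f g x = f x * wronskian C u g x - g x * wronskian C u f x"
      unfolding wronskian_eq[OF f(1) g(1) xI] wronskian_eq[OF u g(1) xI] wronskian_eq[OF u f(1) xI]
      by (simp add: algebra_simps)
    then have "norm (u x) * norm (wronskian C f g x) = norm (f x * wronskian C u g x - g x * wronskian C u f x)"
      by (metis norm_mult)
    also have "\<dots> \<le> norm (f x) * norm (wronskian C u g x) + norm (g x) * norm (wronskian C u f x)"
      using norm_triangle_ineq4[of "f x * wronskian C u g x" "g x * wronskian C u f x"] by (simp add: norm_mult)
    also have "\<dots> \<le> norm (f x) * (K + J x) + norm (g x) * (K + J x)"
    proof (intro add_mono mult_left_mono)
      have "norm (wronskian C u g x) \<le> norm (wronskian C u g d) + J x"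
        by (rule wb[OF x g(1)]) (simp add: B_def)
      then show "norm (wronskian C u g x) \<le> K + J x"
        using norm_ge_zero[of "wronskian C u f d"] unfolding K_def by linarith
      have "norm (wronskian C u f x) \<le> norm (wronskian C u f d) + J x"
        by (rule wb[OF x f(1)]) (simp add: B_def)
      then show "norm (wronskian C u f x) \<le> K + J x"
        using norm_ge_zero[of "wronskian C u g d"] unfolding K_def by linarith
    qed auto
    also have "\<dots> = A x * (K + J x)" by (simp add: A_def algebra_simps)
    finally have "norm (u x) * norm (wronskian C f g x) \<le> A x * (K + J x)" .
    moreover have "norm (u x) * \<delta> \<le> norm (u x) * norm (wronskian C f g x)"
      by (intro mult_left_mono W x) simp
    ultimately show ?thesis by (simp add: mult.commute)
  qed
  have JK: "J x \<le> K" if x: "x \<in> U" for x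
  proof -
    have hx: "h integrable_on closed_segment d x"
    proof -
      obtain c e where ce: "closed_segment d x = {c..e}" by (metis closed_segment_eq_real_ivl)
      have "h absolutely_integrable_on {c..e}" by (rule set_integrable_subset[OF hint]) (use seg[OF x] ce in auto)
      then show ?thesis unfolding ce by (rule set_lebesgue_integral_eq_integral(1))
    qed
    have J0: "J y \<ge> 0" if "y \<in> U" for y unfolding J_def
      by (rule Henstock_Kurzweil_Integration.integral_nonneg[OF Jint[OF that]]) (simp add: B0)
    have "\<delta> * J x = integral (closed_segment d x) (\<lambda>t. \<delta> * (\<bar>r t\<bar> * (norm (u t) * B t)))"
      unfolding J_def by simp
    also have "\<dots> \<le> integral (closed_segment d x) (\<lambda>t. (K + J x) * h t)"
    proof (rule integral_le)
      show "(\<lambda>t. \<delta> * (\<bar>r t\<bar> * (norm (u t) * B t))) integrable_on closed_segment d x"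
        using integrable_on_cmult_left[OF Jint[OF x], of \<delta>] by simp
      show "(\<lambda>t. (K + J x) * h t) integrable_on closed_segment d x"
        using integrable_on_cmult_left[OF hx, of "K + J x"] by simp
      fix t assume t: "t \<in> closed_segment d x"
      then have tU: "t \<in> U" using seg[OF x] by blast
      \<comment> \<open>\<open>J\<close> grows along the segment because its integrand is
        nonnegative, so under the integral \<open>J t\<close> may be replaced by the constant
        \<open>J x\<close>.\<close>
      have sub: "closed_segment d t \<subseteq> closed_segment d x"
        using t by (simp add: subset_closed_segment)
      have "J t \<le> J x"
        unfolding J_def by (rule integral_subset_le[OF sub Jint[OF tU] Jint[OF x]]) (simp add: B0)
      then have "A t * (K + J t) \<le> A t * (K + J x)" by (intro mult_left_mono A0) simp
      with ub[OF tU] have "\<delta> * norm (u t) \<le> A t * (K + J x)" by simp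
      then have "(\<bar>r t\<bar> * B t) * (\<delta> * norm (u t)) \<le> (\<bar>r t\<bar> * B t) * (A t * (K + J x))"
        by (intro mult_left_mono) (simp_all add: B0)
      then show "\<delta> * (\<bar>r t\<bar> * (norm (u t) * B t)) \<le> (K + J x) * h t"
        by (simp add: h_def mult_ac)
    qed
    also have "\<dots> = (K + J x) * integral (closed_segment d x) h" by simp
    also have "\<dots> \<le> (K + J x) * (\<delta> / 2)"
    proof (rule mult_left_mono)
      have "integral (closed_segment d x) h \<le> integral U h"
        by (rule integral_subset_le[OF seg[OF x] hx set_lebesgue_integral_eq_integral(1)[OF hint]])
          (simp add: h_def A0 B0)
      with hU show "integral (closed_segment d x) h \<le> \<delta> / 2" by simp
      show "K + J x \<ge> 0" using J0[OF x] by (simp add: K_def)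
    qed
    finally have "\<delta> * J x \<le> \<delta> * ((K + J x) / 2)" by (simp add: mult.commute)
    then have "J x \<le> (K + J x) / 2" using \<open>\<delta> > 0\<close> by simp
    then show ?thesis by simp
  qed
  \<comment> \<open>This is the constant obtained by inserting \<open>J \<le> K\<close> into
    \<open>ub\<close>.\<close>
  define L where "L = 2 * K / \<delta>"
  have uL: "norm (u x) \<le> norm (of_real L * complex_of_real (A x))" if x: "x \<in> U" for x
  proof -
    have "\<delta> * norm (u x) \<le> A x * (2 * K)"
      using ub[OF x] mult_left_mono[OF add_left_mono[OF JK[OF x], of K] A0[of x]] by simp
    then have "norm (u x) \<le> L * A x" using \<open>\<delta> > 0\<close> by (simp add: L_def field_simps)
    moreover have "norm (of_real L * complex_of_real (A x)) = \<bar>L\<bar> * A x" using A0[of x] by (simp add: norm_mult)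
    moreover have "L * A x \<le> \<bar>L\<bar> * A x" by (intro mult_right_mono A0) simp
    ultimately show ?thesis by simp
  qed
  have sqLA: "sqint U (\<lambda>x. of_real L * complex_of_real (A x))" by (rule sqint_cmult[OF sqA])
  show ?thesis
    unfolding sqint_def
  proof
    show um: "u \<in> borel_measurable (lebesgue_on U)"
      by (rule continuous_imp_measurable_on_sets_lebesgue[OF continuous_on_subset[OF uc U(1)] U(2)])
    show "(\<lambda>x. r x * (norm (u x))\<^sup>2) absolutely_integrable_on U"
    proof (rule measurable_bounded_by_integrable_imp_absolutely_integrable[OF _ U(2)])
      show "(\<lambda>x. r x * (norm (u x))\<^sup>2) \<in> borel_measurable (lebesgue_on U)"
        using um measurable_on_subset[OF r_measurable U(1)] by measurable
      show "(\<lambda>x. norm (r x * (norm (of_real L * complex_of_real (A x)))\<^sup>2)) integrable_on U"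
        using sqLA unfolding sqint_def by (intro set_lebesgue_integral_eq_integral(1) set_integrable_norm) auto
      fix x assume "x \<in> U"
      then have "\<bar>r x\<bar> * (norm (u x))\<^sup>2 \<le> \<bar>r x\<bar> * (norm (of_real L * complex_of_real (A x)))\<^sup>2"
        by (intro mult_left_mono power_mono uL) auto
      then show "norm (r x * (norm (u x))\<^sup>2) \<le> norm (r x * (norm (of_real L * complex_of_real (A x)))\<^sup>2)"
        by (simp add: abs_mult)
    qed
  qed
qed

lemma solutions_sl_system:
  assumes "u \<in> solutions C z"
  shows "sl_system u (quasi_deriv C u) (\<lambda>x. z * u x)"
proof -
  have "sl_system u (quasi_deriv C u) (tau C u)" and "AE x in lebesgue_on I. tau C u x - z * u x = 0"
    using assms dom_tau_sl_system by (simp_all add: solutions_def)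
  then show ?thesis by (auto intro: sl_system_cong_AE)
qed

text \<open>The filter \<open>F\<close> with its base \<open>U\<close> of one-sided neighbourhoods
  stands for either endpoint. By \<open>tail\<close> these neighbourhoods leave every compact
  interval, so far enough out the integral needed for the absorption argument is small.\<close>

lemma solutions_sqint_of_nonzero_wronskian:
  assumes f: "f \<in> dom_T_max C" and g: "g \<in> dom_T_max C"
    and L: "(wronskian C f g \<longlongrightarrow> L) F" "L \<noteq> 0"
    and F: "\<And>P. eventually P F \<longleftrightarrow> (\<exists>c\<in>I. \<forall>x\<in>U c. P x)"
    and U: "\<And>c. c \<in> I \<Longrightarrow> U c \<subseteq> I" "\<And>c. U c \<in> sets lebesgue" "\<And>c. is_interval (U c)" "\<And>c. c \<in> I \<Longrightarrow> U c \<noteq> {}"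
    and tail: "\<And>c d. c \<in> I \<Longrightarrow> d \<in> I \<Longrightarrow> c \<le> d \<Longrightarrow> eventually (\<lambda>x. x \<notin> {c..d}) F"
  shows "\<exists>c\<in>I. \<forall>u\<in>solutions C z. sqint (U c) u"
proof -
  note f' = dom_T_max_D[OF f] and g' = dom_T_max_D[OF g]
  \<comment> \<open>Half the modulus of the limit, which bounds the Wronskian from below
    eventually.\<close>
  define \<delta> where "\<delta> = norm L / 2"
  have "\<delta> > 0" using L(2) by (simp add: \<delta>_def)
  have ev1: "eventually (\<lambda>x. \<delta> \<le> norm (wronskian C f g x)) F"
  proof -
    have "eventually (\<lambda>x. norm (wronskian C f g x) > \<delta>) F"
      by (rule order_tendstoD(1)[OF tendsto_norm[OF L(1)]]) (use L(2) in \<open>simp add: \<delta>_def\<close>)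
    then show ?thesis by eventually_elim simp
  qed
  define h where "h x = of_real (r x) * (complex_of_real (norm (f x) + norm (g x)) *
         complex_of_real (norm (z * f x - tau C f x) + norm (z * g x - tau C g x)))" for x
  have "h absolutely_integrable_on I"
    unfolding h_def of_real_add
    by (intro sqint_mult_integrable sqint_add sqint_norm sqint_diff sqint_cmult f' g') simp_all
  from small_tails[OF this, of "\<delta> / 2"] \<open>\<delta> > 0\<close> obtain c0 d0 where cd: "c0 \<in> I" "d0 \<in> I" "c0 \<le> d0"
    and small: "\<And>S. S \<in> sets lebesgue \<Longrightarrow> S \<subseteq> I \<Longrightarrow> S \<inter> {c0..d0} = {} \<Longrightarrow> integral S (\<lambda>x. norm (h x)) < \<delta> / 2"
    by auto
  have "eventually (\<lambda>x. \<delta> \<le> norm (wronskian C f g x) \<and> x \<notin> {c0..d0}) F"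
    using ev1 tail[OF cd] by (rule eventually_conj)
  then obtain c where c: "c \<in> I" "\<forall>x\<in>U c. \<delta> \<le> norm (wronskian C f g x) \<and> x \<notin> {c0..d0}"
    unfolding F by blast
  obtain d where d: "d \<in> U c" using U(4)[OF c(1)] by blast
  have "sqint (U c) u" if u: "u \<in> solutions C z" for u
  proof (rule sqint_solution_of_wronskian_bound[OF U(1)[OF c(1)] U(2) U(3) d f'(1) _ _ g'(1) _ _ solutions_sl_system[OF u] \<open>\<delta> > 0\<close>])
    show "sqint (U c) f" "sqint (U c) (tau C f)" "sqint (U c) g" "sqint (U c) (tau C g)"
      by (rule sqint_subset[OF _ U(1)[OF c(1)] U(2)], rule f' g')+
    show "\<delta> \<le> norm (wronskian C f g x)" if "x \<in> U c" for x using c(2) that by blast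
    have "integral (U c) (\<lambda>x. norm (h x)) < \<delta> / 2"
      by (rule small[OF U(2) U(1)[OF c(1)]]) (use c(2) in blast)
    then show "integral (U c) (\<lambda>x. norm (of_real (r x) * (complex_of_real (norm (f x) + norm (g x)) *
         complex_of_real (norm (z * f x - tau C f x) + norm (z * g x - tau C g x))))) \<le> \<delta> / 2"
      unfolding h_def by simp
  qed
  with c(1) show ?thesis by blast
qed

lemma is_interval_I_Int: "is_interval (I \<inter> {c<..})" "is_interval (I \<inter> {..<c})" for c :: real
  by (intro is_interval_Int interval_I; simp add: is_interval_1)+

section \<open>Vanishing of boundary values at a limit-point endpoint\<close>

lemma limit_point_b_wronskian_lim:
  assumes lp: "limit_point_b C" and f: "f \<in> dom_T_max C" and g: "g \<in> dom_T_max C"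
  shows "wronskian_lim C (to_b C) f g = 0"
proof (rule ccontr)
  assume ne: "wronskian_lim C (to_b C) f g \<noteq> 0"
  \<comment> \<open>A single spectral parameter suffices, since the limit-point case provides a
    solution outside the space for every \<open>z\<close>.\<close>
  have "\<exists>c\<in>I. \<forall>u\<in>solutions C 0. sqint (I \<inter> {c<..}) u"
  proof (rule solutions_sqint_of_nonzero_wronskian[OF f g wronskian_tendsto(2)[OF f g] ne])
    show "eventually P (to_b C) = (\<exists>c\<in>I. \<forall>x\<in>I \<inter> {c<..}. P x)" for P
      unfolding eventually_to_b by (intro bex_cong refl) auto
    show "I \<inter> {c<..} \<in> sets lebesgue" for c by (intro sets.Int I_sets) simp
    show "I \<inter> {c<..} \<noteq> {}" if c: "c \<in> I" for c
    proof -
      obtain u v where "v \<in> I" "c < v" by (rule I_extend[OF c])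
      then show ?thesis by blast
    qed
    show "eventually (\<lambda>x. x \<notin> {c..d}) (to_b C)" if "d \<in> I" for c d
      unfolding eventually_to_b by (intro bexI[of _ d] that) auto
  qed (use is_interval_I_Int in auto)
  then obtain c where c: "c \<in> I" "\<And>u. u \<in> solutions C 0 \<Longrightarrow> sqint (I \<inter> {c<..}) u" by blast
  have "L2_near_b C u" if u: "u \<in> solutions C 0" for u
    unfolding L2_near_b_def
  proof
    fix c' assume c': "c' \<in> I"
    have E: "einterval (ereal c') (sl_b C) = I \<inter> {c'<..}"
      using c' less_trans[of "sl_a C" "ereal c'"] by (auto simp: einterval_def mem_I)
    have mI: "max c c' \<in> I" using c(1) c' by (simp add: max_def)
    have uc: "continuous_on I u" by (rule sl_system_continuous_on[OF solutions_sl_system[OF u]])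
    \<comment> \<open>Square-integrability is known only to the right of \<open>c\<close>; if
      \<open>c'\<close> lies further left, the compact gap is covered by the continuity of
      \<open>u\<close>.\<close>
    have "sqint {c'..max c c'} u"
      by (rule sqint_continuous[OF continuous_on_subset[OF uc]]) (rule Icc_subset_I[OF c' mI])+
    then have "sqint ({c'..max c c'} \<union> I \<inter> {c<..}) u"
      by (rule sqint_Un[OF _ c(2)[OF u]]) (simp, intro sets.Int I_sets, simp)
    then have "sqint (I \<inter> {c'<..}) u"
      by (rule sqint_subset) (auto intro!: sets.Int I_sets)
    then show "u \<in> L2 (weight C (ereal c') (sl_b C))"
      using L2_weight[of "ereal c'" "sl_b C" u] by (simp add: E)
  qed
  with lp show False unfolding limit_point_b_def by blast
qed

lemma limit_point_a_wronskian_lim: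
  assumes lp: "limit_point_a C" and f: "f \<in> dom_T_max C" and g: "g \<in> dom_T_max C"
  shows "wronskian_lim C (to_a C) f g = 0"
proof (rule ccontr)
  assume ne: "wronskian_lim C (to_a C) f g \<noteq> 0"
  have "\<exists>c\<in>I. \<forall>u\<in>solutions C 0. sqint (I \<inter> {..<c}) u"
  proof (rule solutions_sqint_of_nonzero_wronskian[OF f g wronskian_tendsto(1)[OF f g] ne])
    show "eventually P (to_a C) = (\<exists>c\<in>I. \<forall>x\<in>I \<inter> {..<c}. P x)" for P
      unfolding eventually_to_a by (intro bex_cong refl) auto
    show "I \<inter> {..<c} \<in> sets lebesgue" for c by (intro sets.Int I_sets) simp
    show "I \<inter> {..<c} \<noteq> {}" if c: "c \<in> I" for c
    proof -
      obtain u v where "u \<in> I" "u < c" by (rule I_extend[OF c])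
      then show ?thesis by blast
    qed
    show "eventually (\<lambda>x. x \<notin> {c..d}) (to_a C)" if "c \<in> I" for c d
      unfolding eventually_to_a by (intro bexI[of _ c] that) auto
  qed (use is_interval_I_Int in auto)
  then obtain c where c: "c \<in> I" "\<And>u. u \<in> solutions C 0 \<Longrightarrow> sqint (I \<inter> {..<c}) u" by blast
  have "L2_near_a C u" if u: "u \<in> solutions C 0" for u
    unfolding L2_near_a_def
  proof
    fix c' assume c': "c' \<in> I"
    have E: "einterval (sl_a C) (ereal c') = I \<inter> {..<c'}"
      using c' less_trans[of _ "ereal c'" "sl_b C"] by (auto simp: einterval_def mem_I)
    have mI: "min c c' \<in> I" using c(1) c' by (simp add: min_def)
    have uc: "continuous_on I u" by (rule sl_system_continuous_on[OF solutions_sl_system[OF u]])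
    have "sqint {min c c'..c'} u"
      by (rule sqint_continuous[OF continuous_on_subset[OF uc]]) (rule Icc_subset_I[OF mI c'])+
    then have "sqint ({min c c'..c'} \<union> I \<inter> {..<c}) u"
      by (rule sqint_Un[OF _ c(2)[OF u]]) (simp, intro sets.Int I_sets, simp)
    then have "sqint (I \<inter> {..<c'}) u"
      by (rule sqint_subset) (auto intro!: sets.Int I_sets)
    then show "u \<in> L2 (weight C (sl_a C) (ereal c'))"
      using L2_weight[of "sl_a C" "ereal c'" u] by (simp add: E)
  qed
  with lp show False unfolding limit_point_a_def by blast
qed

end

section \<open>Existence of solutions\<close>

text \<open>What survives the passage to the limit in Picard's method is an integral equation.
  Comparison with an antiderivative turns it back into a statement about derivatives.\<close>

lemma ac_deriv_of_primitive:
  assumes "open I" "is_interval I" "c \<in> I"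
    and h: "\<And>u v. {u..v} \<subseteq> I \<Longrightarrow> h absolutely_integrable_on {u..v}"
    and F: "\<And>u v. u \<in> I \<Longrightarrow> v \<in> I \<Longrightarrow> u \<le> v \<Longrightarrow> integral {u..v} h = F v - F u"
  shows "ac_deriv I F h"
proof -
  obtain G where G: "ac_deriv I G h" "G c = 0" using ex_antiderivative[OF assms(1-4)] by blast
  have sub: "{u..v} \<subseteq> I" if "u \<in> I" "v \<in> I" for u v
    using mem_is_interval_1_I[OF assms(2) that] by (intro subsetI) simp
  have eq: "G v - G u = F v - F u" if "u \<in> I" "v \<in> I" "u \<le> v" for u v
    using ac_deriv_FTC(2)[OF G(1) assms(1) that(3) sub[OF that(1,2)]] F[OF that] by (simp add: integral_unique)
  have eqF: "G x + F c = F x" if "x \<in> I" for x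
  proof (cases "x \<le> c")
    case True
    from eq[OF that assms(3) True] G(2) show ?thesis by algebra
  next
    case False
    then have "c \<le> x" by simp
    from eq[OF assms(3) that this] G(2) show ?thesis by algebra
  qed
  have "ac_deriv I (\<lambda>x. G x + F c) h"
    using ac_deriv_add[OF G(1) ac_deriv_const] by simp
  then show ?thesis by (rule ac_deriv_cong[OF _ eqF assms(1)])
qed

lemma ac_deriv_power:
  assumes N: "ac_deriv I (\<lambda>x. of_real (N x)) (\<lambda>x. of_real (m x))" and "open I"
  shows "ac_deriv I (\<lambda>x. of_real (N x ^ Suc n)) (\<lambda>x. of_real (real (Suc n) * (m x * N x ^ n)))"
proof (induction n)
  case 0 then show ?case using N by simp
next
  case (Suc n)
  have "ac_deriv I (\<lambda>x. of_real (N x ^ Suc n) * of_real (N x))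
    (\<lambda>x. of_real (N x ^ Suc n) * of_real (m x) + of_real (real (Suc n) * (m x * N x ^ n)) * of_real (N x))"
    by (rule ac_deriv_mult[OF Suc N \<open>open I\<close>])
  then show ?case
    by (simp add: algebra_simps flip: of_real_mult of_real_add)
qed

text \<open>\<open>N\<close> is a primitive of the nonnegative function \<open>m\<close>, so
  integrating \<open>m |N|^n\<close> raises the power and divides by \<open>Suc n\<close>. Thus
  \<open>N\<close> replaces the distance from \<open>c\<close>, which would do for bounded
  coefficients, and iteration produces the factorials.\<close>

lemma iterated_integral_bound:
  assumes I: "open I" "is_interval I" "c \<in> I" "x \<in> I"
    and N: "ac_deriv I (\<lambda>x. of_real (N x)) (\<lambda>x. of_real (m x))" "N c = 0"
    and m: "\<And>x. m x \<ge> 0"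
    and F: "ac_deriv I F h" "F c = 0"
    and h: "\<And>x. x \<in> I \<Longrightarrow> norm (h x) \<le> m x * (K * \<bar>N x\<bar> ^ n)"
  shows "norm (F x) \<le> K * \<bar>N x\<bar> ^ Suc n / Suc n"
proof -
  have sub: "{u..v} \<subseteq> I" if "u \<in> I" "v \<in> I" for u v
    using mem_is_interval_1_I[OF I(2) that] by (intro subsetI) simp
  have intN: "((\<lambda>t. of_real (real (Suc n) * (m t * N t ^ n)) :: complex) has_integral
      of_real (N v ^ Suc n) - of_real (N u ^ Suc n)) {u..v}" if "u \<in> I" "v \<in> I" "u \<le> v" for u v
    by (rule ac_deriv_FTC(2)[OF ac_deriv_power[OF N(1) I(1)] I(1) that(3) sub[OF that(1,2)]])
  have intN: "((\<lambda>t. m t * N t ^ n) has_integral (N v ^ Suc n - N u ^ Suc n) / Suc n) {u..v}"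
    if "u \<in> I" "v \<in> I" "u \<le> v" for u v
  proof -
    have "((\<lambda>t. real (Suc n) * (m t * N t ^ n)) has_integral (N v ^ Suc n - N u ^ Suc n)) {u..v}"
      using has_integral_linear[OF intN[OF that] bounded_linear_Re] unfolding o_def Re_complex_of_real
      by (simp del: of_nat_Suc power_Suc)
    from has_integral_mult_right[OF this, of "1 / Suc n"] show ?thesis by simp
  qed
  have mono: "N u \<le> N v" if "u \<in> I" "v \<in> I" "u \<le> v" for u v
  proof -
    have "((\<lambda>t. of_real (m t) :: complex) has_integral of_real (N v) - of_real (N u)) {u..v}"
      by (rule ac_deriv_FTC(2)[OF N(1) I(1) that(3) sub[OF that(1,2)]])
    from has_integral_linear[OF this bounded_linear_Re] have "(m has_integral N v - N u) {u..v}"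
      by (simp add: o_def)
    from has_integral_nonneg[OF this] m show ?thesis by simp
  qed
  \<comment> \<open>\<open>\<sigma>\<close> stands for the sign of \<open>N\<close>, which is
    \<open>1\<close> to the right of \<open>c\<close> and \<open>-1\<close> to the left. With it
    \<open>|N|^n\<close> becomes a multiple of \<open>N^n\<close>, and the primitive from
    \<open>intN\<close> applies.\<close>
  have main: "norm (F v - F u) \<le> K * (\<sigma> ^ n * ((N v ^ Suc n - N u ^ Suc n) / Suc n))"
    if uv: "u \<in> I" "v \<in> I" "u \<le> v" and \<sigma>: "\<And>t. t \<in> {u..v} \<Longrightarrow> \<bar>N t\<bar> = \<sigma> * N t" for u v \<sigma>
  proof -
    have Fi: "(h has_integral F v - F u) {u..v}"
      by (rule ac_deriv_FTC(2)[OF F(1) I(1) uv(3) sub[OF uv(1,2)]])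
    have Gi: "((\<lambda>t. K * (\<sigma> ^ n * (m t * N t ^ n))) has_integral K * (\<sigma> ^ n * ((N v ^ Suc n - N u ^ Suc n) / Suc n))) {u..v}"
      by (intro has_integral_mult_right intN uv)
    have "norm (integral {u..v} h) \<le> integral {u..v} (\<lambda>t. K * (\<sigma> ^ n * (m t * N t ^ n)))"
    proof (rule integral_norm_bound_integral)
      show "h integrable_on {u..v}" "(\<lambda>t. K * (\<sigma> ^ n * (m t * N t ^ n))) integrable_on {u..v}"
        using Fi Gi by blast+
      fix t assume t: "t \<in> {u..v}"
      then have "t \<in> I" using sub[OF uv(1,2)] by blast
      from h[OF this] show "norm (h t) \<le> K * (\<sigma> ^ n * (m t * N t ^ n))"
        unfolding \<sigma>[OF t] power_mult_distrib by (simp add: mult_ac)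
    qed
    then show ?thesis using Fi Gi by (simp only: integral_unique)
  qed
  show ?thesis
  proof (cases "c \<le> x")
    case True
    have "\<bar>N t\<bar> = 1 * N t" if "t \<in> {c..x}" for t
      using mono[OF I(3), of t] N(2) that sub[OF I(3,4)] by auto
    from main[OF I(3,4) True this] mono[OF I(3,4) True] show ?thesis
      using N(2) F(2) by simp
  next
    case False
    then have xc: "x \<le> c" by simp
    have "\<bar>N t\<bar> = (-1) * N t" if "t \<in> {x..c}" for t
      using mono[of t c] N(2) I(3) that sub[OF I(4,3)] by auto
    from main[OF I(4,3) xc this] have "norm (F x) \<le> K * ((-1) ^ n * (- (N x ^ Suc n) / Suc n))"
      using N(2) F(2) by (simp del: of_nat_Suc)
    also have "\<dots> = K * (- N x) ^ Suc n / Suc n"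
      by (simp add: power_minus[of "N x" n] del: of_nat_Suc)
    also have "- N x = \<bar>N x\<bar>" using mono[OF I(4,3) xc] N(2) by simp
    finally show ?thesis .
  qed
qed

lemma absolutely_integrable_real_mult_continuous:
  fixes g :: "real \<Rightarrow> complex"
  assumes k: "k absolutely_integrable_on {c..d}" and g: "continuous_on {c..d} g"
  shows "(\<lambda>x. of_real (k x) * g x) absolutely_integrable_on {c..d}"
proof -
  have k': "(\<lambda>x. complex_of_real (k x)) absolutely_integrable_on {c..d}"
    using absolutely_integrable_linear[OF k bounded_linear_of_real] by (simp add: o_def)
  have "(\<lambda>x. g x * complex_of_real (k x)) absolutely_integrable_on {c..d}"
  proof (rule absolutely_integrable_bounded_measurable_product[OF bilinear_times _ _ _ k'])
    show "g \<in> borel_measurable (lebesgue_on {c..d})"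
      by (rule continuous_imp_measurable_on_sets_lebesgue[OF g]) simp
    show "bounded (g ` {c..d})"
      by (rule compact_imp_bounded[OF compact_continuous_image[OF g]]) simp
  qed simp
  then show ?thesis by (simp add: mult.commute)
qed

context sl_problem
begin

lemma ac_deriv_continuous_on: "ac_deriv I f f' \<Longrightarrow> continuous_on I f"
  using AC_loc_imp_continuous_on[OF open_I] by (simp add: ac_deriv_def)

lemma system_rhs_integrable:
  fixes y z :: "real \<Rightarrow> complex"
  assumes "continuous_on I y" "continuous_on I z" "{u..v} \<subseteq> I"
  shows "(\<lambda>x. of_real (inverse (p x)) * z x - of_real (s x) * y x) absolutely_integrable_on {u..v}"
    "(\<lambda>x. of_real (s x) * z x + of_real (q x) * y x) absolutely_integrable_on {u..v}"
proof -
  have y: "continuous_on {u..v} y" and z: "continuous_on {u..v} z"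
    using assms continuous_on_subset by blast+
  note c = coeff_integrable[OF assms(3)]
  show "(\<lambda>x. of_real (inverse (p x)) * z x - of_real (s x) * y x) absolutely_integrable_on {u..v}"
    "(\<lambda>x. of_real (s x) * z x + of_real (q x) * y x) absolutely_integrable_on {u..v}"
    by (intro set_integral_diff set_integral_add absolutely_integrable_real_mult_continuous c y z)+
qed

section \<open>Picard iteration for locally integrable coefficients\<close>

definition antideriv :: "real \<Rightarrow> (real \<Rightarrow> complex) \<Rightarrow> real \<Rightarrow> complex" where
  "antideriv c h = (SOME F. ac_deriv I F h \<and> F c = 0)"

lemma ac_deriv_antideriv:
  assumes "c \<in> I" "\<And>u v. {u..v} \<subseteq> I \<Longrightarrow> h absolutely_integrable_on {u..v}"
  shows "ac_deriv I (antideriv c h) h" "antideriv c h c = 0"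
proof -
  have "\<exists>F. ac_deriv I F h \<and> F c = 0" by (rule ex_antiderivative[OF open_I interval_I assms])
  then have "ac_deriv I (antideriv c h) h \<and> antideriv c h c = 0" unfolding antideriv_def by (rule someI_ex)
  then show "ac_deriv I (antideriv c h) h" "antideriv c h c = 0" by auto
qed

text \<open>These are the terms of the series and not its partial sums: all terms after the initial
  data vanish at \<open>c\<close>, and the solution is their sum.\<close>

primrec picard :: "real \<Rightarrow> complex \<Rightarrow> complex \<Rightarrow> nat \<Rightarrow> (real \<Rightarrow> complex) \<times> (real \<Rightarrow> complex)" where
  "picard c y0 z0 0 = ((\<lambda>_. y0), (\<lambda>_. z0))"
| "picard c y0 z0 (Suc n) =
     (antideriv c (\<lambda>x. of_real (inverse (p x)) * snd (picard c y0 z0 n) x - of_real (s x) * fst (picard c y0 z0 n) x),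
      antideriv c (\<lambda>x. of_real (s x) * snd (picard c y0 z0 n) x + of_real (q x) * fst (picard c y0 z0 n) x))"

lemma picard_continuous:
  assumes "c \<in> I"
  shows "continuous_on I (fst (picard c y0 z0 n)) \<and> continuous_on I (snd (picard c y0 z0 n))"
proof (induction n)
  case (Suc n)
  then show ?case
    using ac_deriv_antideriv(1)[OF assms system_rhs_integrable(1)] ac_deriv_antideriv(1)[OF assms system_rhs_integrable(2)]
    by (auto intro!: ac_deriv_continuous_on)
qed simp

text \<open>The series is dominated by \<open>K * exp |N|\<close>, where \<open>N\<close> is a
  primitive of a common bound \<open>m\<close> for the coefficients. This majorant is bounded on
  compact intervals, so dominated convergence takes the integral equation of the partial sums to the
  limit.\<close>

lemma ex_solution:
  assumes c: "c \<in> I"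
  shows "\<exists>u u1. sl_system u u1 (\<lambda>_. 0) \<and> u c = y0 \<and> u1 c = z0"
proof -
  define y where "y n = fst (picard c y0 z0 n)" for n
  define z where "z n = snd (picard c y0 z0 n)" for n
  have cont: "continuous_on I (y n)" "continuous_on I (z n)" for n
    using picard_continuous[OF c] by (simp_all add: y_def z_def)
  \<comment> \<open>The right-hand sides are written as functions of the values \<open>a\<close> and
    \<open>b\<close>; they are linear in these and bounded by \<open>m x\<close> times any common
    bound of them.\<close>
  define Y' where "Y' a b x = of_real (inverse (p x)) * b - of_real (s x) * (a :: complex)" for a b x
  define Z' where "Z' a b x = of_real (s x) * b + of_real (q x) * (a :: complex)" for a b x
  have rhs: "(\<lambda>x. Y' (a x) (b x) x) absolutely_integrable_on {u..v}" "(\<lambda>x. Z' (a x) (b x) x) absolutely_integrable_on {u..v}"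
    if "continuous_on I a" "continuous_on I b" "{u..v} \<subseteq> I" for a b u v
    unfolding Y'_def Z'_def using system_rhs_integrable[OF that] .
  have ySuc: "y (Suc n) = antideriv c (\<lambda>x. Y' (y n x) (z n x) x)" and zSuc: "z (Suc n) = antideriv c (\<lambda>x. Z' (y n x) (z n x) x)" for n
    by (simp_all add: y_def z_def Y'_def Z'_def)
  have step: "ac_deriv I (y (Suc n)) (\<lambda>x. Y' (y n x) (z n x) x)" "y (Suc n) c = 0"
    "ac_deriv I (z (Suc n)) (\<lambda>x. Z' (y n x) (z n x) x)" "z (Suc n) c = 0" for n
    unfolding ySuc zSuc using ac_deriv_antideriv[OF c rhs(1)[OF cont]] ac_deriv_antideriv[OF c rhs(2)[OF cont]] by auto
  define m where "m x = \<bar>inverse (p x)\<bar> + \<bar>s x\<bar> + \<bar>q x\<bar>" for x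
  have m0: "m x \<ge> 0" for x by (simp add: m_def)
  have mint: "m absolutely_integrable_on {u..v}" if "{u..v} \<subseteq> I" for u v
    unfolding m_def real_norm_def[symmetric] using coeff_integrable[OF that]
    by (intro set_integral_add set_integrable_norm) auto
  have Y'm: "norm (Y' a b x) \<le> m x * B" and Z'm: "norm (Z' a b x) \<le> m x * B"
    if "norm a \<le> B" "norm b \<le> B" for a b B x
  proof -
    have B: "B \<ge> 0" using that(1) norm_ge_zero order_trans by blast
    have "norm (Y' a b x) \<le> \<bar>inverse (p x)\<bar> * norm b + \<bar>s x\<bar> * norm a"
      unfolding Y'_def by (rule order_trans[OF norm_triangle_ineq4]) (simp add: norm_mult norm_inverse)
    also have "\<dots> \<le> \<bar>inverse (p x)\<bar> * B + \<bar>s x\<bar> * B + \<bar>q x\<bar> * B"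
      using that B by (intro order_trans[OF _ add_increasing2[OF _ order_refl]] add_mono mult_left_mono) auto
    finally show "norm (Y' a b x) \<le> m x * B" by (simp add: m_def algebra_simps)
    have "norm (Z' a b x) \<le> \<bar>s x\<bar> * norm b + \<bar>q x\<bar> * norm a"
      unfolding Z'_def by (rule order_trans[OF norm_triangle_ineq]) (simp add: norm_mult norm_inverse)
    also have "\<dots> \<le> \<bar>inverse (p x)\<bar> * B + (\<bar>s x\<bar> * B + \<bar>q x\<bar> * B)"
      using that B by (intro order_trans[OF _ add_increasing[OF _ order_refl]] add_mono mult_left_mono) auto
    finally show "norm (Z' a b x) \<le> m x * B" by (simp add: m_def algebra_simps)
  qed
  have mc: "(\<lambda>x. complex_of_real (m x)) absolutely_integrable_on {u..v}" if "{u..v} \<subseteq> I" for u v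
    using absolutely_integrable_linear[OF mint[OF that] bounded_linear_of_real] by (simp add: o_def)
  obtain Nc where Nc: "ac_deriv I Nc (\<lambda>x. of_real (m x))" "Nc c = 0"
    using ex_antiderivative[OF open_I interval_I c mc] by blast
  \<comment> \<open>Antiderivatives are available for complex integrands. Since the integrand is
    real, the imaginary part is constant, and it vanishes at \<open>c\<close>.\<close>
  define N where "N x = Re (Nc x)" for x
  have NcN: "complex_of_real (N x) = Nc x" if "x \<in> I" for x
  proof -
    have im: "Im (Nc v) = Im (Nc u)" if "u \<in> I" "v \<in> I" "u \<le> v" for u v
    proof -
      have "((\<lambda>t. complex_of_real (m t)) has_integral Nc v - Nc u) {u..v}"
        by (rule ac_deriv_FTC(2)[OF Nc(1) open_I that(3) Icc_subset_I[OF that(1,2)]])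
      from has_integral_linear[OF this bounded_linear_Im] have "((\<lambda>t. 0) has_integral Im (Nc v) - Im (Nc u)) {u..v}"
        by (simp add: o_def)
      then show ?thesis using has_integral_unique[OF has_integral_0] by fastforce
    qed
    have "Im (Nc x) = 0" using im[OF that c] im[OF c that] Nc(2) by (cases "x \<le> c") simp_all
    then show ?thesis by (simp add: N_def complex_eq_iff)
  qed
  have N: "ac_deriv I (\<lambda>x. of_real (N x)) (\<lambda>x. of_real (m x))" "N c = 0"
    using ac_deriv_cong[OF Nc(1) NcN[symmetric] open_I] Nc(2) by (simp_all add: N_def)
  have Ncont: "continuous_on I N"
    unfolding N_def by (intro continuous_intros ac_deriv_continuous_on[OF Nc(1)])
  define K where "K = max (norm y0) (norm z0)"
  have bound: "norm (y n x) \<le> K * \<bar>N x\<bar> ^ n / fact n \<and> norm (z n x) \<le> K * \<bar>N x\<bar> ^ n / fact n" if "x \<in> I" for n x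
    using that
  proof (induction n arbitrary: x)
    case 0
    then show ?case by (simp add: y_def z_def K_def)
  next
    case (Suc n)
    have h: "norm (Y' (y n t) (z n t) t) \<le> m t * ((K / fact n) * \<bar>N t\<bar> ^ n)"
      "norm (Z' (y n t) (z n t) t) \<le> m t * ((K / fact n) * \<bar>N t\<bar> ^ n)" if "t \<in> I" for t
    proof -
      have b: "norm (y n t) \<le> (K / fact n) * \<bar>N t\<bar> ^ n" "norm (z n t) \<le> (K / fact n) * \<bar>N t\<bar> ^ n"
        using Suc.IH[OF that] by simp_all
      show "norm (Y' (y n t) (z n t) t) \<le> m t * ((K / fact n) * \<bar>N t\<bar> ^ n)"
        "norm (Z' (y n t) (z n t) t) \<le> m t * ((K / fact n) * \<bar>N t\<bar> ^ n)"
        using Y'm[OF b] Z'm[OF b] .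
    qed
    have "norm (y (Suc n) x) \<le> (K / fact n) * \<bar>N x\<bar> ^ Suc n / Suc n"
      by (rule iterated_integral_bound[OF open_I interval_I c Suc.prems N m0 step(1,2) h(1)])
    moreover have "norm (z (Suc n) x) \<le> (K / fact n) * \<bar>N x\<bar> ^ Suc n / Suc n"
      by (rule iterated_integral_bound[OF open_I interval_I c Suc.prems N m0 step(3,4) h(2)])
    ultimately show ?case by (simp add: field_simps)
  qed
  have expsum: "summable (\<lambda>n. K * \<bar>N x\<bar> ^ n / fact n)" "(\<Sum>n. K * \<bar>N x\<bar> ^ n / fact n) = K * exp \<bar>N x\<bar>" for x
  proof -
    have "(\<lambda>n. K * (\<bar>N x\<bar> ^ n /\<^sub>R fact n)) sums (K * exp \<bar>N x\<bar>)" by (intro sums_mult exp_converges)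
    then have "(\<lambda>n. K * \<bar>N x\<bar> ^ n / fact n) sums (K * exp \<bar>N x\<bar>)" by (simp add: field_simps)
    then show "summable (\<lambda>n. K * \<bar>N x\<bar> ^ n / fact n)" "(\<Sum>n. K * \<bar>N x\<bar> ^ n / fact n) = K * exp \<bar>N x\<bar>"
      by (simp_all add: sums_iff)
  qed
  have K0: "K \<ge> 0" by (simp add: K_def max_def)
  define u where "u x = (\<Sum>n. y n x)" for x
  define v where "v x = (\<Sum>n. z n x)" for x
  have sums: "(\<lambda>n. y n x) sums u x" "(\<lambda>n. z n x) sums v x" if "x \<in> I" for x
  proof -
    have "summable (\<lambda>n. y n x)" "summable (\<lambda>n. z n x)"
      by (rule summable_comparison_test'[OF expsum(1)[of x], of 0], use bound[OF that] in blast)+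
    then show "(\<lambda>n. y n x) sums u x" "(\<lambda>n. z n x) sums v x" by (simp_all add: u_def v_def summable_sums)
  qed
  \<comment> \<open>The sum stops before \<open>n\<close>, so \<open>Sy 0\<close> is zero and the
    derivative of \<open>Sy (Suc n)\<close> is the right-hand side at \<open>Sy n\<close> and
    \<open>Sz n\<close>.\<close>
  define Sy where "Sy n x = (\<Sum>k<n. y k x)" for n x
  define Sz where "Sz n x = (\<Sum>k<n. z k x)" for n x
  have lims: "(\<lambda>n. Sy n x) \<longlonglongrightarrow> u x" "(\<lambda>n. Sz n x) \<longlonglongrightarrow> v x" if "x \<in> I" for x
    using sums[OF that] by (simp_all add: sums_def Sy_def Sz_def)
  have Scont: "continuous_on I (Sy n)" "continuous_on I (Sz n)" for n
    unfolding Sy_def Sz_def by (intro continuous_on_sum cont)+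
  have Sb: "norm (Sy n x) \<le> K * exp \<bar>N x\<bar>" "norm (Sz n x) \<le> K * exp \<bar>N x\<bar>" if "x \<in> I" for n x
  proof -
    have "(\<Sum>k<n. K * \<bar>N x\<bar> ^ k / fact k) \<le> K * exp \<bar>N x\<bar>"
      unfolding expsum(2)[symmetric] by (rule sum_le_suminf[OF expsum(1)]) (use K0 in auto)
    moreover have "norm (Sy n x) \<le> (\<Sum>k<n. K * \<bar>N x\<bar> ^ k / fact k)" "norm (Sz n x) \<le> (\<Sum>k<n. K * \<bar>N x\<bar> ^ k / fact k)"
      unfolding Sy_def Sz_def using bound[OF that] by (intro sum_norm_le; blast)+
    ultimately show "norm (Sy n x) \<le> K * exp \<bar>N x\<bar>" "norm (Sz n x) \<le> K * exp \<bar>N x\<bar>" by linarith+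
  qed
  have Sd: "ac_deriv I (Sy (Suc n)) (\<lambda>x. Y' (Sy n x) (Sz n x) x) \<and> ac_deriv I (Sz (Suc n)) (\<lambda>x. Z' (Sy n x) (Sz n x) x)" for n
  proof (induction n)
    case 0
    have "Sy (Suc 0) = (\<lambda>_. y0)" "Sz (Suc 0) = (\<lambda>_. z0)" by (auto simp: Sy_def Sz_def y_def z_def)
    moreover have "Sy 0 = (\<lambda>_. 0)" "Sz 0 = (\<lambda>_. 0)" by (auto simp: Sy_def Sz_def)
    ultimately show ?case by (simp add: Y'_def Z'_def ac_deriv_const)
  next
    case (Suc n)
    have "ac_deriv I (\<lambda>x. Sy (Suc n) x + y (Suc n) x) (\<lambda>x. Y' (Sy n x) (Sz n x) x + Y' (y n x) (z n x) x)"
      "ac_deriv I (\<lambda>x. Sz (Suc n) x + z (Suc n) x) (\<lambda>x. Z' (Sy n x) (Sz n x) x + Z' (y n x) (z n x) x)"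
      using Suc step by (auto intro: ac_deriv_add)
    moreover have "(\<lambda>x. Sy (Suc n) x + y (Suc n) x) = Sy (Suc (Suc n))" "(\<lambda>x. Sz (Suc n) x + z (Suc n) x) = Sz (Suc (Suc n))"
      by (auto simp: Sy_def Sz_def)
    moreover have "Y' (Sy n x) (Sz n x) x + Y' (y n x) (z n x) x = Y' (Sy (Suc n) x) (Sz (Suc n) x) x"
      "Z' (Sy n x) (Sz n x) x + Z' (y n x) (z n x) x = Z' (Sy (Suc n) x) (Sz (Suc n) x) x" for x
      by (simp_all add: Sy_def Sz_def Y'_def Z'_def algebra_simps)
    ultimately show ?case by simp
  qed
  \<comment> \<open>Generic in the sequence \<open>S\<close> and the right-hand side
    \<open>G\<close>, so as to cover both components of the system.\<close>
  have limit: "ac_deriv I w (\<lambda>x. G (u x) (v x) x)"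
    if Sw: "\<And>n. ac_deriv I (S (Suc n)) (\<lambda>x. G (Sy n x) (Sz n x) x)"
      and lim: "\<And>x. x \<in> I \<Longrightarrow> (\<lambda>n. S n x) \<longlonglongrightarrow> w x"
      and G: "\<And>a b B x. norm a \<le> B \<Longrightarrow> norm b \<le> B \<Longrightarrow> norm (G a b x) \<le> m x * B"
      and Gint: "\<And>n \<alpha> \<beta>. {\<alpha>..\<beta>} \<subseteq> I \<Longrightarrow> (\<lambda>x. G (Sy n x) (Sz n x) x) absolutely_integrable_on {\<alpha>..\<beta>}"
      and Gc: "\<And>x. x \<in> I \<Longrightarrow> (\<lambda>n. G (Sy n x) (Sz n x) x) \<longlonglongrightarrow> G (u x) (v x) x"
    for w G S
  proof -
    have dom: "\<exists>L. L \<ge> 0 \<and> (\<forall>x\<in>{\<alpha>..\<beta>}. K * exp \<bar>N x\<bar> \<le> L)" if "{\<alpha>..\<beta>} \<subseteq> I" for \<alpha> \<beta>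
    proof -
      have "compact ((\<lambda>x. K * exp \<bar>N x\<bar>) ` {\<alpha>..\<beta>})"
        by (intro compact_continuous_image continuous_intros continuous_on_subset[OF Ncont that]) simp
      then have "bounded ((\<lambda>x. K * exp \<bar>N x\<bar>) ` {\<alpha>..\<beta>})" by (rule compact_imp_bounded)
      then obtain L where L: "\<And>x. x \<in> {\<alpha>..\<beta>} \<Longrightarrow> norm (K * exp \<bar>N x\<bar>) \<le> L" unfolding bounded_iff by blast
      then show ?thesis by (intro exI[of _ "\<bar>L\<bar>"]) force
    qed
    have dc: "(\<lambda>x. G (u x) (v x) x) absolutely_integrable_on {\<alpha>..\<beta>} \<and>
       (\<lambda>n. integral {\<alpha>..\<beta>} (\<lambda>x. G (Sy n x) (Sz n x) x)) \<longlonglongrightarrow> integral {\<alpha>..\<beta>} (\<lambda>x. G (u x) (v x) x)"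
      if sub: "{\<alpha>..\<beta>} \<subseteq> I" for \<alpha> \<beta>
    proof -
      obtain L where L: "L \<ge> 0" "\<And>x. x \<in> {\<alpha>..\<beta>} \<Longrightarrow> K * exp \<bar>N x\<bar> \<le> L" using dom[OF sub] by blast
      have mL: "(\<lambda>x. m x * L) integrable_on {\<alpha>..\<beta>}"
        using set_lebesgue_integral_eq_integral(1)[OF mint[OF sub]] by (rule integrable_on_mult_left)
      have le: "norm (G (Sy n x) (Sz n x) x) \<le> m x * L" if x: "x \<in> {\<alpha>..\<beta>}" for n x
      proof -
        have "x \<in> I" using sub x by blast
        then show ?thesis using L(2)[OF x] Sb[of x n] by (intro G) linarith+
      qed
      have xI: "x \<in> I" if "x \<in> {\<alpha>..\<beta>}" for x using sub that by blast
      have Gi: "(\<lambda>x. G (Sy n x) (Sz n x) x) integrable_on {\<alpha>..\<beta>}" for n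
        using Gint[OF sub] set_lebesgue_integral_eq_integral(1) by blast
      note D = dominated_convergence[OF Gi mL le Gc[OF xI]]
      have "(\<lambda>x. G (u x) (v x) x) absolutely_integrable_on {\<alpha>..\<beta>}"
      proof (rule absolutely_integrable_integrable_bound[OF _ D(1) mL])
        fix x assume x: "x \<in> {\<alpha>..\<beta>}"
        show "norm (G (u x) (v x) x) \<le> m x * L"
          by (rule Lim_norm_ubound[OF _ Gc[OF xI[OF x]]]) (use le[OF x] in auto)
      qed
      with D(2) show ?thesis by blast
    qed
    show ?thesis
    proof (rule ac_deriv_of_primitive[OF open_I interval_I c])
      show "(\<lambda>x. G (u x) (v x) x) absolutely_integrable_on {\<alpha>..\<beta>}" if "{\<alpha>..\<beta>} \<subseteq> I" for \<alpha> \<beta>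
        using dc[OF that] by blast
      fix \<alpha> \<beta> assume ab: "\<alpha> \<in> I" "\<beta> \<in> I" "\<alpha> \<le> \<beta>"
      have "integral {\<alpha>..\<beta>} (\<lambda>x. G (Sy n x) (Sz n x) x) = S (Suc n) \<beta> - S (Suc n) \<alpha>" for n
        by (rule integral_unique[OF ac_deriv_FTC(2)[OF Sw open_I ab(3) Icc_subset_I[OF ab(1,2)]]])
      moreover have "(\<lambda>n. S (Suc n) \<beta> - S (Suc n) \<alpha>) \<longlonglongrightarrow> w \<beta> - w \<alpha>"
        by (intro tendsto_diff LIMSEQ_Suc lim ab)
      ultimately show "integral {\<alpha>..\<beta>} (\<lambda>x. G (u x) (v x) x) = w \<beta> - w \<alpha>"
        using dc[OF Icc_subset_I[OF ab(1,2)]] LIMSEQ_unique by auto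
    qed
  qed
  have du: "ac_deriv I u (\<lambda>x. Y' (u x) (v x) x)"
    by (rule limit[of Sy]) (use Sd lims Y'm rhs(1)[OF Scont] in \<open>auto simp: Y'_def intro!: tendsto_intros\<close>)
  have dv: "ac_deriv I v (\<lambda>x. Z' (u x) (v x) x)"
    by (rule limit[of Sz]) (use Sd lims Z'm rhs(2)[OF Scont] in \<open>auto simp: Z'_def intro!: tendsto_intros\<close>)
  have "sl_system u v (\<lambda>_. 0)" unfolding sl_system_def using du dv by (simp add: Y'_def Z'_def)
  moreover have "u c = y0" "v c = z0"
  proof -
    have "y (Suc n) c = 0" "z (Suc n) c = 0" for n using step by auto
    then have "(\<lambda>n. y n c) sums (\<Sum>n\<in>{0}. y n c)" "(\<lambda>n. z n c) sums (\<Sum>n\<in>{0}. z n c)"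
      by (intro sums_finite; metis finite.emptyI finite.insertI insertI1 not0_implies_Suc)+
    then show "u c = y0" "v c = z0" unfolding u_def v_def by (simp_all add: sums_iff y_def z_def)
  qed
  ultimately show ?thesis by blast
qed

end

section \<open>Variation of constants\<close>

lemma absolutely_integrable_zero_outside:
  assumes "g absolutely_integrable_on S" "S \<subseteq> T" "\<And>x. x \<in> T \<Longrightarrow> x \<notin> S \<Longrightarrow> g x = 0"
  shows "g absolutely_integrable_on T" "integral T g = integral S g"
proof -
  have "(\<lambda>x. indicator T x *\<^sub>R g x) = (\<lambda>x. indicator S x *\<^sub>R g x)"
  proof
    fix x
    show "indicator T x *\<^sub>R g x = indicator S x *\<^sub>R g x"
      using assms(2) assms(3)[of x] by (cases "x \<in> S"; cases "x \<in> T") auto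
  qed
  then show "g absolutely_integrable_on T" using assms(1) unfolding set_integrable_def by simp
  have "integral T g = integral T (\<lambda>x. if x \<in> S then g x else 0)"
    using assms(3) by (intro Henstock_Kurzweil_Integration.integral_cong) auto
  also have "\<dots> = integral S g" by (simp only: integral_restrict_Int Int_absorb2[OF assms(2)])
  finally show "integral T g = integral S g" .
qed

context sl_problem
begin

text \<open>By the Lagrange identity the Wronskian of two homogeneous solutions has derivative zero;
  the initial values at \<open>c\<close> make it \<open>1\<close>.\<close>

lemma ex_fundamental_system:
  "\<exists>u u1 v v1. sl_system u u1 (\<lambda>_. 0) \<and> sl_system v v1 (\<lambda>_. 0) \<and> (\<forall>x\<in>I. u x * v1 x - u1 x * v x = 1)"
proof -
  obtain c where c: "c \<in> I" by (rule I_nonempty)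
  obtain u u1 where u: "sl_system u u1 (\<lambda>_. 0)" "u c = 1" "u1 c = 0" using ex_solution[OF c, of 1 0] by blast
  obtain v v1 where v: "sl_system v v1 (\<lambda>_. 0)" "v c = 0" "v1 c = 1" using ex_solution[OF c, of 0 1] by blast
  let ?W = "\<lambda>x. u x * v1 x - u1 x * v x"
  have W: "ac_deriv I ?W (\<lambda>_. 0)" using lagrange_identity[OF u(1) v(1)] by simp
  have eq: "?W y = ?W x" if "x \<in> I" "y \<in> I" "x \<le> y" for x y
    using has_integral_unique[OF ac_deriv_FTC(2)[OF W open_I that(3) Icc_subset_I[OF that(1,2)]] has_integral_0]
    by simp
  have "?W x = 1" if "x \<in> I" for x
    using eq[OF that c] eq[OF c that] u v by (cases "x \<le> c") simp_all
  with u(1) v(1) show ?thesis by blast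
qed

text \<open>The derivatives of \<open>\<alpha>\<close> and \<open>\<beta>\<close> are chosen so that
  the additional terms cancel in the first equation. In the second they add up to
  \<open>- r k\<close> times the Wronskian, which is \<open>1\<close>.\<close>

lemma variation_of_constants:
  assumes u: "sl_system u u1 (\<lambda>_. 0)" and v: "sl_system v v1 (\<lambda>_. 0)"
    and W: "\<And>x. x \<in> I \<Longrightarrow> u x * v1 x - u1 x * v x = 1"
    and \<alpha>: "ac_deriv I \<alpha> (\<lambda>x. of_real (r x) * (v x * k x))"
    and \<beta>: "ac_deriv I \<beta> (\<lambda>x. of_real (r x) * (u x * k x))"
  shows "sl_system (\<lambda>x. u x * \<alpha> x - v x * \<beta> x) (\<lambda>x. u1 x * \<alpha> x - v1 x * \<beta> x) k"
  unfolding sl_system_def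
proof
  note d = u[unfolded sl_system_def] v[unfolded sl_system_def]
  have xI: "AE x in lebesgue_on I. x \<in> I" by (rule AE_I2) simp
  have "ac_deriv I (\<lambda>x. u x * \<alpha> x - v x * \<beta> x)
    (\<lambda>x. (u x * (of_real (r x) * (v x * k x)) + (of_real (inverse (p x)) * u1 x - of_real (s x) * u x) * \<alpha> x) -
         (v x * (of_real (r x) * (u x * k x)) + (of_real (inverse (p x)) * v1 x - of_real (s x) * v x) * \<beta> x))"
    by (intro ac_deriv_diff ac_deriv_mult open_I \<alpha> \<beta>) (use d in auto)
  then show "ac_deriv I (\<lambda>x. u x * \<alpha> x - v x * \<beta> x) (\<lambda>x. of_real (inverse (p x)) * (u1 x * \<alpha> x - v1 x * \<beta> x) -
      of_real (s x) * (u x * \<alpha> x - v x * \<beta> x))"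
    by (rule ac_deriv_cong_AE) (simp add: algebra_simps)
  have "ac_deriv I (\<lambda>x. u1 x * \<alpha> x - v1 x * \<beta> x)
    (\<lambda>x. (u1 x * (of_real (r x) * (v x * k x)) + (of_real (s x) * u1 x + of_real (q x) * u x - of_real (r x) * 0) * \<alpha> x) -
         (v1 x * (of_real (r x) * (u x * k x)) + (of_real (s x) * v1 x + of_real (q x) * v x - of_real (r x) * 0) * \<beta> x))"
    by (intro ac_deriv_diff ac_deriv_mult open_I \<alpha> \<beta>) (use d in auto)
  then show "ac_deriv I (\<lambda>x. u1 x * \<alpha> x - v1 x * \<beta> x) (\<lambda>x. of_real (s x) * (u1 x * \<alpha> x - v1 x * \<beta> x) +
      of_real (q x) * (u x * \<alpha> x - v x * \<beta> x) - of_real (r x) * k x)"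
  proof (rule ac_deriv_cong_AE)
    show "AE x in lebesgue_on I. (u1 x * (of_real (r x) * (v x * k x)) + (of_real (s x) * u1 x + of_real (q x) * u x - of_real (r x) * 0) * \<alpha> x) -
         (v1 x * (of_real (r x) * (u x * k x)) + (of_real (s x) * v1 x + of_real (q x) * v x - of_real (r x) * 0) * \<beta> x)
       = of_real (s x) * (u1 x * \<alpha> x - v1 x * \<beta> x) + of_real (q x) * (u x * \<alpha> x - v x * \<beta> x) - of_real (r x) * k x"
      using xI
    proof eventually_elim
      case (elim x)
      from W[OF elim] show ?case by algebra
    qed
  qed
qed

lemma sqint_Icc:
  assumes "sqint I f" "{c..d} \<subseteq> I"
  shows "sqint {c..d} f"
  by (rule sqint_subset[OF assms]) simp

lemma sl_system_sqint_Icc: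
  assumes "sl_system u u1 k" "{c..d} \<subseteq> I"
  shows "sqint {c..d} u"
  by (rule sqint_continuous[OF continuous_on_subset[OF sl_system_continuous_on(1)[OF assms(1)] assms(2)] assms(2)])

lemma ex_inhomogeneous_solution:
  assumes k: "sqint I k"
  shows "\<exists>f f1. sl_system f f1 k"
proof -
  obtain c where c: "c \<in> I" by (rule I_nonempty)
  obtain u u1 v v1 where uv: "sl_system u u1 (\<lambda>_. 0)" "sl_system v v1 (\<lambda>_. 0)"
      and "\<forall>x\<in>I. u x * v1 x - u1 x * v x = 1"
    using ex_fundamental_system by blast
  then have W: "u x * v1 x - u1 x * v x = 1" if "x \<in> I" for x using that by blast
  have int: "(\<lambda>x. of_real (r x) * (w x * k x)) absolutely_integrable_on {a..b}"
    if "sl_system w w1 (\<lambda>_. 0)" "{a..b} \<subseteq> I" for w w1 a b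
    by (intro sqint_mult_integrable sl_system_sqint_Icc[OF that] sqint_Icc[OF k that(2)] that(2)) simp
  obtain \<alpha> where \<alpha>: "ac_deriv I \<alpha> (\<lambda>x. of_real (r x) * (v x * k x))"
    using ex_antiderivative[OF open_I interval_I c int[OF uv(2)]] by blast
  obtain \<beta> where \<beta>: "ac_deriv I \<beta> (\<lambda>x. of_real (r x) * (u x * k x))"
    using ex_antiderivative[OF open_I interval_I c int[OF uv(1)]] by blast
  show ?thesis using variation_of_constants[OF uv W \<alpha> \<beta>] by blast
qed

lemma sqint_zero_outside:
  assumes "sqint S f" "S \<subseteq> I" "S \<in> sets lebesgue" "\<And>x. x \<in> I \<Longrightarrow> x \<notin> S \<Longrightarrow> f x = 0"
  shows "sqint I f"
  unfolding sqint_def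
proof
  have "(\<lambda>x. if x \<in> S then f x else 0) \<in> borel_measurable lebesgue"
    using assms(1,3) by (simp add: sqint_def borel_measurable_if)
  moreover have "(\<lambda>x. if x \<in> I then f x else 0) = (\<lambda>x. if x \<in> S then f x else 0)"
  proof
    fix x
    show "(if x \<in> I then f x else 0) = (if x \<in> S then f x else 0)"
      using assms(2) assms(4)[of x] by auto
  qed
  ultimately show "f \<in> borel_measurable (lebesgue_on I)" using borel_measurable_if[OF I_sets, of f] by simp
  show "(\<lambda>x. r x * (norm (f x))\<^sup>2) absolutely_integrable_on I"
    by (rule absolutely_integrable_zero_outside(1)[where S = S]) (use assms in \<open>auto simp: sqint_def\<close>)
qed

text \<open>Both coefficients in the variation of constants are normalised to vanish at
  \<open>c\<close>. The two vanishing integrals make them vanish at \<open>d\<close> as well, and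
  they are constant on either side of \<open>{c..d}\<close> because \<open>h\<close> is zero
  there.\<close>

lemma compactly_supported_solution:
  assumes uv: "sl_system u u1 (\<lambda>_. 0)" "sl_system v v1 (\<lambda>_. 0)" "\<And>x. x \<in> I \<Longrightarrow> u x * v1 x - u1 x * v x = 1"
    and cd: "c \<in> I" "d \<in> I" "c \<le> d"
    and h: "sqint I h" "\<And>x. x \<notin> {c..d} \<Longrightarrow> h x = 0"
    and orth: "integral {c..d} (\<lambda>x. of_real (r x) * (u x * h x)) = 0" "integral {c..d} (\<lambda>x. of_real (r x) * (v x * h x)) = 0"
  shows "\<exists>f f1. sl_system f f1 h \<and> f \<in> dom_T_max C \<and> (\<forall>x\<in>I. x \<le> c \<or> d \<le> x \<longrightarrow> f x = 0 \<and> f1 x = 0)"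
proof -
  have int: "(\<lambda>x. of_real (r x) * (w x * h x)) absolutely_integrable_on {a..b}"
    if "sl_system w w1 (\<lambda>_. 0)" "{a..b} \<subseteq> I" for w w1 a b
    by (intro sqint_mult_integrable sl_system_sqint_Icc[OF that] sqint_Icc[OF h(1) that(2)] that(2)) simp
  have key: "\<exists>\<alpha>. ac_deriv I \<alpha> (\<lambda>x. of_real (r x) * (w x * h x)) \<and> (\<forall>x\<in>I. x \<le> c \<or> d \<le> x \<longrightarrow> \<alpha> x = 0)"
    if w: "sl_system w w1 (\<lambda>_. 0)" and o: "integral {c..d} (\<lambda>x. of_real (r x) * (w x * h x)) = 0" for w w1
  proof -
    obtain \<alpha> where \<alpha>: "ac_deriv I \<alpha> (\<lambda>x. of_real (r x) * (w x * h x))" "\<alpha> c = 0"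
      using ex_antiderivative[OF open_I interval_I cd(1) int[OF w]] by blast
    have FTC: "((\<lambda>x. of_real (r x) * (w x * h x)) has_integral \<alpha> b - \<alpha> a) {a..b}" if "a \<in> I" "b \<in> I" "a \<le> b" for a b
      by (rule ac_deriv_FTC(2)[OF \<alpha>(1) open_I that(3) Icc_subset_I[OF that(1,2)]])
    have zero: "\<alpha> b = \<alpha> a" if "a \<in> I" "b \<in> I" "a \<le> b" "b \<le> c \<or> d \<le> a" for a b
    proof -
      have "((\<lambda>x. of_real (r x) * (w x * h x)) has_integral 0) {a..b}"
      proof (rule has_integral_spike[where f = "\<lambda>_. 0" and S = "{c, d}"])
        fix x assume "x \<in> {a..b} - {c, d}"
        then have "x \<notin> {c..d}" using that(4) by auto
        then show "of_real (r x) * (w x * h x) = 0" by (simp add: h(2))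
      qed auto
      from has_integral_unique[OF FTC[OF that(1-3)] this] show ?thesis by simp
    qed
    have "\<alpha> d = 0" using integral_unique[OF FTC[OF cd]] o \<alpha>(2) by simp
    then have "\<alpha> x = 0" if "x \<in> I" "x \<le> c \<or> d \<le> x" for x
      using zero[OF that(1) cd(1)] zero[OF cd(2) that(1)] that(2) \<alpha>(2) by auto
    with \<alpha>(1) show ?thesis by blast
  qed
  obtain \<alpha> where \<alpha>: "ac_deriv I \<alpha> (\<lambda>x. of_real (r x) * (v x * h x))" "\<forall>x\<in>I. x \<le> c \<or> d \<le> x \<longrightarrow> \<alpha> x = 0"
    using key[OF uv(2) orth(2)] by blast
  obtain \<beta> where \<beta>: "ac_deriv I \<beta> (\<lambda>x. of_real (r x) * (u x * h x))" "\<forall>x\<in>I. x \<le> c \<or> d \<le> x \<longrightarrow> \<beta> x = 0"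
    using key[OF uv(1) orth(1)] by blast
  define f where "f x = u x * \<alpha> x - v x * \<beta> x" for x
  define f1 where "f1 x = u1 x * \<alpha> x - v1 x * \<beta> x" for x
  have f: "sl_system f f1 h" unfolding f_def f1_def by (rule variation_of_constants[OF uv \<alpha>(1) \<beta>(1)])
  have z: "f x = 0 \<and> f1 x = 0" if "x \<in> I" "x \<le> c \<or> d \<le> x" for x
  proof -
    have "\<alpha> x = 0" "\<beta> x = 0" using that \<alpha>(2) \<beta>(2) by blast+
    then show ?thesis by (simp add: f_def f1_def)
  qed
  have "sqint {c..d} f" by (rule sl_system_sqint_Icc[OF f Icc_subset_I[OF cd(1,2)]])
  then have "sqint I f"
    by (rule sqint_zero_outside) (use z Icc_subset_I[OF cd(1,2)] in auto)
  then have "f \<in> dom_T_max C" by (rule dom_T_maxI(1)[OF f _ h(1)])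
  with f z show ?thesis by blast
qed

text \<open>Off the null set where \<open>r\<close> is not positive the integrand equals
  \<open>|r| |f|^2\<close>, and a nonnegative function with integral zero vanishes almost
  everywhere.\<close>

lemma sqint_norm_eq_0_imp_negligible:
  assumes f: "sqint S f" and S: "S \<subseteq> I" "S \<in> sets lebesgue"
    and 0: "integral S (\<lambda>x. of_real (r x) * (cnj (f x) * f x)) = 0"
  shows "negligible {x \<in> S. f x \<noteq> 0}"
proof -
  let ?N = "{x \<in> I. \<not> r x > 0}"
  have N: "negligible ?N" using AE_r by (simp only: AE_lebesgue_on_iff_negligible[OF I_sets])
  let ?\<phi> = "\<lambda>x. norm (r x * (norm (f x))\<^sup>2)"
  have \<phi>: "?\<phi> absolutely_integrable_on S" using f unfolding sqint_def by (intro set_integrable_norm) auto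
  have "((\<lambda>x. complex_of_real (?\<phi> x)) has_integral 0) S"
  proof (rule has_integral_spike[OF N])
    have int: "(\<lambda>x. of_real (r x) * (cnj (f x) * f x)) absolutely_integrable_on S"
      by (rule sqint_mult_integrable[OF sqint_cnj[OF f] f S])
    show "((\<lambda>x. of_real (r x) * (cnj (f x) * f x)) has_integral 0) S"
      using set_lebesgue_integral_eq_integral(1)[OF int] 0 by (simp add: has_integral_iff)
    fix x assume "x \<in> S - ?N"
    then have "r x > 0" using S by auto
    then show "complex_of_real (?\<phi> x) = of_real (r x) * (cnj (f x) * f x)"
      by (simp add: complex_norm_square mult.commute flip: of_real_power)
  qed
  from has_integral_linear[OF this bounded_linear_Re] have "integral S ?\<phi> = 0"
    by (simp add: o_def integral_unique)
  then have "(LINT x:S|lebesgue. ?\<phi> x) = 0"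
    using set_lebesgue_integral_eq_integral(2)[OF \<phi>] by simp
  then have "AE x in lebesgue. indicator S x *\<^sub>R ?\<phi> x = 0"
    using \<phi> unfolding set_lebesgue_integral_def set_integrable_def
    by (subst (asm) integral_nonneg_eq_0_iff_AE) auto
  then have "{x \<in> space lebesgue. \<not> indicator S x *\<^sub>R ?\<phi> x = 0} \<in> null_sets lebesgue"
    by (simp only: completion.AE_iff_null_sets)
  then have "negligible {x. indicator S x *\<^sub>R ?\<phi> x \<noteq> 0}" by (simp add: negligible_iff_null_sets)
  then have "negligible (?N \<union> {x. indicator S x *\<^sub>R ?\<phi> x \<noteq> 0})" using N by (rule negligible_Un[rotated])
  then show ?thesis
    by (rule negligible_subset) (use S in \<open>auto simp: indicator_def\<close>)
qed

end

section \<open>Weak solutions\<close>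

context sl_problem
begin

text \<open>The inner product localised to \<open>S\<close>, conjugate-linear in the first argument
  like \<open>L2_inner\<close>. On compact subintervals it applies to homogeneous solutions, which
  need not be square-integrable on \<open>I\<close>.\<close>

definition ip :: "real set \<Rightarrow> (real \<Rightarrow> complex) \<Rightarrow> (real \<Rightarrow> complex) \<Rightarrow> complex" where
  "ip S f g = integral S (\<lambda>x. of_real (r x) * (cnj (f x) * g x))"

context
  fixes S :: "real set"
  assumes S: "S \<subseteq> I" "S \<in> sets lebesgue"
begin

lemma ip_integrable:
  assumes "sqint S f" "sqint S g"
  shows "(\<lambda>x. of_real (r x) * (cnj (f x) * g x)) integrable_on S"
  by (rule set_lebesgue_integral_eq_integral(1)[OF sqint_mult_integrable[OF sqint_cnj[OF assms(1)] assms(2) S]])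

lemma ip_add_right:
  assumes "sqint S f" "sqint S g" "sqint S h"
  shows "ip S f (\<lambda>x. g x + h x) = ip S f g + ip S f h"
  unfolding ip_def
  using Henstock_Kurzweil_Integration.integral_add[OF ip_integrable[OF assms(1,2)] ip_integrable[OF assms(1,3)]]
  by (simp add: distrib_left)

lemma ip_cmult_right: "ip S f (\<lambda>x. a * g x) = a * ip S f g"
proof -
  have "(\<lambda>x. of_real (r x) * (cnj (f x) * (a * g x))) = (\<lambda>x. a * (of_real (r x) * (cnj (f x) * g x)))"
    by (simp add: mult_ac)
  then show ?thesis unfolding ip_def by simp
qed

lemma ip_diff_right:
  assumes "sqint S f" "sqint S g" "sqint S h"
  shows "ip S f (\<lambda>x. g x - h x) = ip S f g - ip S f h"
  using ip_add_right[OF assms(1,2) sqint_cmult[OF assms(3), of "-1"]] ip_cmult_right[of f "-1" h] by simp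

lemma ip_cnj:
  assumes "sqint S f" "sqint S g"
  shows "ip S g f = cnj (ip S f g)"
proof -
  have "((\<lambda>x. of_real (r x) * (cnj (f x) * g x)) has_integral ip S f g) S"
    unfolding ip_def by (rule integrable_integral[OF ip_integrable[OF assms]])
  from has_integral_linear[OF this bounded_linear_cnj]
  have "((\<lambda>x. of_real (r x) * (cnj (g x) * f x)) has_integral cnj (ip S f g)) S"
    by (simp add: o_def mult_ac)
  then show ?thesis unfolding ip_def by (rule integral_unique)
qed

lemma ip_diff_left:
  assumes "sqint S f" "sqint S g" "sqint S h"
  shows "ip S (\<lambda>x. g x - h x) f = ip S g f - ip S h f"
  using ip_diff_right[OF assms] ip_cnj[OF assms(1) sqint_diff[OF assms(2,3) S]] ip_cnj[OF assms(1,2)] ip_cnj[OF assms(1,3)]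
  by simp

lemma ip_cmult_left:
  assumes "sqint S f" "sqint S g"
  shows "ip S (\<lambda>x. a * g x) f = cnj a * ip S g f"
  using ip_cmult_right[of f a g] ip_cnj[OF assms(1) sqint_cmult[OF assms(2), of a]] ip_cnj[OF assms] by simp

lemma ip_cong_right:
  assumes "negligible {x \<in> S. g x \<noteq> h x}"
  shows "ip S f g = ip S f h"
  unfolding ip_def by (rule integral_spike[OF assms]) auto

lemma ip_self_0:
  assumes "sqint S f" "ip S f f = 0"
  shows "negligible {x \<in> S. f x \<noteq> 0}"
  using sqint_norm_eq_0_imp_negligible[OF assms(1) S] assms(2) by (simp add: ip_def)

text \<open>The usual coefficient is a quotient by \<open>ip S e e\<close>. If this is zero,
  \<open>e\<close> vanishes almost everywhere on \<open>S\<close> and any coefficient will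
  do.\<close>

lemma ip_project:
  assumes e: "sqint S e" and w: "sqint S w"
  shows "\<exists>a. ip S e (\<lambda>x. w x - a * e x) = 0"
proof -
  have *: "ip S e (\<lambda>x. w x - a * e x) = ip S e w - a * ip S e e" for a
    using ip_diff_right[OF e w sqint_cmult[OF e, of a]] ip_cmult_right[of e a e] by simp
  show ?thesis
  proof (cases "ip S e e = 0")
    case True
    have "ip S w e = ip S w (\<lambda>_. 0)"
      by (rule ip_cong_right) (use ip_self_0[OF e True] in simp)
    then have "ip S w e = 0" by (simp add: ip_def)
    then have "ip S e w = 0" using ip_cnj[OF w e] by simp
    then show ?thesis using * True by auto
  next
    case False
    then have "ip S e (\<lambda>x. w x - (ip S e w / ip S e e) * e x) = 0" unfolding * by simp
    then show ?thesis by blast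
  qed
qed

text \<open>Gram-Schmidt: \<open>e'\<close> is replaced by its component \<open>e2\<close>
  orthogonal to \<open>e\<close>, after which the two projections do not interfere.\<close>

lemma ip_project2:
  assumes e: "sqint S e" "sqint S e'" and w: "sqint S w"
  shows "\<exists>a b. ip S e (\<lambda>x. w x - (a * e x + b * e' x)) = 0 \<and> ip S e' (\<lambda>x. w x - (a * e x + b * e' x)) = 0"
proof -
  note sq = sqint_diff[OF _ _ S] sqint_add[OF _ _ S] sqint_cmult
  obtain \<gamma> where \<gamma>: "ip S e (\<lambda>x. e' x - \<gamma> * e x) = 0" using ip_project[OF e] by blast
  define e2 where "e2 x = e' x - \<gamma> * e x" for x
  have e2: "sqint S e2" "ip S e e2 = 0" unfolding e2_def using \<gamma> by (auto intro!: sq e)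
  obtain a where a: "ip S e (\<lambda>x. w x - a * e x) = 0" using ip_project[OF e(1) w] by blast
  define w1 where "w1 x = w x - a * e x" for x
  have w1: "sqint S w1" "ip S e w1 = 0" unfolding w1_def using a by (auto intro!: sq e w)
  obtain b where b: "ip S e2 (\<lambda>x. w1 x - b * e2 x) = 0" using ip_project[OF e2(1) w1(1)] by blast
  define w2 where "w2 x = w1 x - b * e2 x" for x
  have w2: "sqint S w2" "ip S e2 w2 = 0" unfolding w2_def using b by (auto intro!: sq e2 w1)
  have "ip S e w2 = 0"
    unfolding w2_def using ip_diff_right[OF e(1) w1(1) sqint_cmult[OF e2(1), of b]] ip_cmult_right[of e b e2] w1(2) e2(2) by simp
  moreover have "ip S e' w2 = 0"
  proof -
    have "ip S (\<lambda>x. e2 x - (- \<gamma>) * e x) w2 = ip S e2 w2 - ip S (\<lambda>x. (- \<gamma>) * e x) w2"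
      by (rule ip_diff_left[OF w2(1) e2(1) sqint_cmult[OF e(1)]])
    also have "\<dots> = 0" using w2(2) ip_cmult_left[OF w2(1) e(1), of "- \<gamma>"] \<open>ip S e w2 = 0\<close> by simp
    also have "(\<lambda>x. e2 x - (- \<gamma>) * e x) = e'" by (simp add: e2_def)
    finally show ?thesis .
  qed
  \<comment> \<open>Expressing \<open>e2\<close> through \<open>e\<close> and \<open>e'\<close>
    again shifts the coefficient of \<open>e\<close> by \<open>b * \<gamma>\<close>.\<close>
  moreover have eq: "w2 = (\<lambda>x. w x - ((a - b * \<gamma>) * e x + b * e' x))"
    by (rule ext) (simp add: w2_def w1_def e2_def algebra_simps)
  ultimately show ?thesis unfolding eq by blast
qed

end

lemma L2_inner_ip: "sqint I f \<Longrightarrow> sqint I g \<Longrightarrow> L2_inner M f g = ip I f g"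
  by (simp add: ip_def L2_inner_eq)

lemma ip_zero_outside:
  assumes "sqint S f" "sqint S g" "S \<subseteq> I" "S \<in> sets lebesgue" and "\<And>x. x \<in> I \<Longrightarrow> x \<notin> S \<Longrightarrow> g x = 0"
  shows "ip I f g = ip S f g"
  unfolding ip_def
  by (rule absolutely_integrable_zero_outside(2)[OF sqint_mult_integrable[OF sqint_cnj[OF assms(1)] assms(2-4)] assms(3)])
    (simp add: assms(5))

lemma AE_I_negligible: "(AE x in lebesgue_on I. P x) \<longleftrightarrow> negligible {x \<in> I. \<not> P x}"
  by (rule AE_lebesgue_on_iff_negligible[OF I_sets])

text \<open>Only compactly supported elements of the domain are used for testing, so this is
  membership in the adjoint of the preminimal operator and does not depend on boundary conditions.
  On \<open>I\<close> the function \<open>f1\<close> is the quasi-derivative of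
  \<open>f\<close>.\<close>

definition weak_solution :: "(real \<Rightarrow> complex) \<Rightarrow> (real \<Rightarrow> complex) \<Rightarrow> bool" where
  "weak_solution g k \<longleftrightarrow> (\<forall>f f1 c d. f \<in> dom_T_max C \<and> sl_system f f1 (tau C f) \<and> c \<in> I \<and> d \<in> I \<and> c \<le> d \<and>
     (\<forall>x\<in>I. x \<le> c \<or> d \<le> x \<longrightarrow> f x = 0 \<and> f1 x = 0) \<longrightarrow> ip I g (tau C f) = ip I k f)"

text \<open>Let \<open>w'\<close> be the residual of \<open>g - G\<close> after projection onto
  \<open>cnj u\<close> and \<open>cnj v\<close>, and \<open>h\<close> its cut-off. Then
  \<open>h\<close> is the right-hand side of a compactly supported solution \<open>f\<close>.
  Testing with \<open>f\<close> gives \<open>ip g h = ip k f\<close>, and the Lagrange identity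
  gives \<open>ip k f = ip G h\<close>. So \<open>g - G\<close> is orthogonal to \<open>w'\<close>;
  as its projected part is too, \<open>w'\<close> has norm zero.\<close>

lemma weak_solution_on_interval:
  assumes g: "sqint I g" and k: "sqint I k" and weak: "weak_solution g k"
    and G: "sl_system G G1 k"
    and uv: "sl_system u u1 (\<lambda>_. 0)" "sl_system v v1 (\<lambda>_. 0)" "\<And>x. x \<in> I \<Longrightarrow> u x * v1 x - u1 x * v x = 1"
    and cd: "c \<in> I" "d \<in> I" "c \<le> d"
  shows "\<exists>a b. negligible {x \<in> {c..d}. g x \<noteq> G x + (a * cnj (u x) + b * cnj (v x))}"
proof -
  let ?S = "{c..d}"
  have S: "?S \<subseteq> I" "?S \<in> sets lebesgue" using Icc_subset_I[OF cd(1,2)] by simp_all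
  note sq = sqint_diff[OF _ _ S] sqint_add[OF _ _ S] sqint_cmult
  define w where "w x = g x - G x" for x
  have gS: "sqint ?S g" and kS: "sqint ?S k" by (rule sqint_Icc[OF g S(1)], rule sqint_Icc[OF k S(1)])
  have GS: "sqint ?S G" by (rule sl_system_sqint_Icc[OF G S(1)])
  have w: "sqint ?S w" unfolding w_def by (intro sq gS GS)
  \<comment> \<open>The conjugates offset the conjugation in the first argument of
    \<open>ip\<close>; orthogonality to them means that the integrals of \<open>r u h\<close> and
    \<open>r v h\<close> vanish, as \<open>compactly_supported_solution\<close> demands.\<close>
  define e e' where "e x = cnj (u x)" and "e' x = cnj (v x)" for x
  have e: "sqint ?S e" "sqint ?S e'"
    unfolding e_def e'_def by (intro sqint_cnj sl_system_sqint_Icc[OF uv(1) S(1)] sl_system_sqint_Icc[OF uv(2) S(1)])+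
  obtain a b where ab: "ip ?S e (\<lambda>x. w x - (a * e x + b * e' x)) = 0" "ip ?S e' (\<lambda>x. w x - (a * e x + b * e' x)) = 0"
    using ip_project2[OF S e w] by blast
  define w' where "w' x = w x - (a * e x + b * e' x)" for x
  have w': "sqint ?S w'" unfolding w'_def by (intro sq w e)
  have orth: "ip ?S e w' = 0" "ip ?S e' w' = 0" using ab by (simp_all add: w'_def[abs_def])
  define h where "h x = (if x \<in> ?S then w' x else 0)" for x
  have hS: "sqint ?S h"
    unfolding sqint_def
  proof
    have "h \<in> borel_measurable (lebesgue_on ?S) \<longleftrightarrow> w' \<in> borel_measurable (lebesgue_on ?S)"
      by (rule measurable_cong) (simp add: h_def)
    then show "h \<in> borel_measurable (lebesgue_on ?S)" using w' by (simp add: sqint_def)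
    show "(\<lambda>x. r x * (norm (h x))\<^sup>2) absolutely_integrable_on ?S"
      by (rule absolutely_integrable_spike[where f = "\<lambda>x. r x * (norm (w' x))\<^sup>2", OF _ negligible_empty])
        (use w' in \<open>simp_all add: sqint_def h_def\<close>)
  qed
  have hI: "sqint I h" by (rule sqint_zero_outside[OF hS S]) (auto simp: h_def)
  have eqh: "integral ?S (\<lambda>x. F x * h x) = integral ?S (\<lambda>x. F x * w' x)" for F
    by (rule Henstock_Kurzweil_Integration.integral_cong) (simp add: h_def)
  have o1: "integral ?S (\<lambda>x. of_real (r x) * (u x * h x)) = 0" "integral ?S (\<lambda>x. of_real (r x) * (v x * h x)) = 0"
    using orth eqh[of "\<lambda>x. of_real (r x) * u x"] eqh[of "\<lambda>x. of_real (r x) * v x"] by (simp_all add: ip_def e_def e'_def mult.assoc)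
  have "\<exists>f f1. sl_system f f1 h \<and> f \<in> dom_T_max C \<and> (\<forall>x\<in>I. x \<le> c \<or> d \<le> x \<longrightarrow> f x = 0 \<and> f1 x = 0)"
    by (rule compactly_supported_solution[OF uv cd hI _ o1]) (auto simp: h_def)
  then obtain f f1 where f: "sl_system f f1 h" "f \<in> dom_T_max C"
      and f0: "\<forall>x\<in>I. x \<le> c \<or> d \<le> x \<longrightarrow> f x = 0 \<and> f1 x = 0" by blast
  then have f3: "f x = 0" "f1 x = 0" if "x \<in> I" "x \<le> c \<or> d \<le> x" for x using that by blast+
  have tauf: "AE x in lebesgue_on I. tau C f x = h x" by (rule sl_system_tau[OF f(1)])
  then have "sl_system f f1 (tau C f)"
    by (intro sl_system_cong_AE[OF f(1)]) (auto elim: eventually_mono)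
  then have "ip I g (tau C f) = ip I k f"
    using weak f(2) f0 cd unfolding weak_solution_def by blast
  moreover have "ip I g (tau C f) = ip I g h"
    by (rule ip_cong_right[OF order_refl I_sets]) (use tauf in \<open>simp only: AE_I_negligible\<close>)
  moreover have "ip I g h = ip ?S g h"
    by (rule ip_zero_outside[OF gS hS S]) (auto simp: h_def)
  moreover have "ip I k f = ip ?S k f"
    by (rule ip_zero_outside[OF kS sl_system_sqint_Icc[OF f(1) S(1)] S]) (rule f3, auto)
  \<comment> \<open>The Lagrange identity for \<open>cnj G\<close> and \<open>f\<close>, whose
    boundary terms vanish since \<open>f\<close> and \<open>f1\<close> are zero at \<open>c\<close>
    and \<open>d\<close>.\<close>
  moreover have "ip ?S k f - ip ?S G h = 0"
  proof -
    have "((\<lambda>x. of_real (r x) * (cnj (k x) * f x - cnj (G x) * h x)) has_integral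
       (wronskian C (\<lambda>x. cnj (G x)) f d - wronskian C (\<lambda>x. cnj (G x)) f c)) {c..d}"
      by (rule wronskian_diff(2)[OF sl_system_cnj[OF G] f(1) cd(3,1,2)])
    moreover have "wronskian C (\<lambda>x. cnj (G x)) f d = 0" "wronskian C (\<lambda>x. cnj (G x)) f c = 0"
      using f3[OF cd(1)] f3[OF cd(2)] wronskian_eq[OF sl_system_cnj[OF G] f(1)] cd by simp_all
    ultimately have "integral ?S (\<lambda>x. of_real (r x) * (cnj (k x) * f x - cnj (G x) * h x)) = 0"
      by (simp add: integral_unique)
    then show ?thesis
      unfolding ip_def using Henstock_Kurzweil_Integration.integral_diff[OF ip_integrable[OF S kS sl_system_sqint_Icc[OF f(1) S(1)]] ip_integrable[OF S GS hS]]
      by (simp add: right_diff_distrib)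
  qed
  ultimately have "ip ?S g h = ip ?S G h" by simp
  moreover have "ip ?S w h = ip ?S g h - ip ?S G h"
    unfolding w_def by (rule ip_diff_left[OF S hS gS GS])
  moreover have "ip ?S w h = ip ?S w w'"
  proof (rule ip_cong_right[OF S])
    have "{x \<in> ?S. h x \<noteq> w' x} = {}" by (auto simp: h_def)
    then show "negligible {x \<in> ?S. h x \<noteq> w' x}" by (simp only: negligible_empty)
  qed
  ultimately have "ip ?S w w' = 0" by simp
  moreover have "ip ?S w' w' = ip ?S w w' - ip ?S (\<lambda>x. a * e x + b * e' x) w'"
    using ip_diff_left[OF S w' w, of "\<lambda>x. a * e x + b * e' x"] sq(2)[OF sqint_cmult[OF e(1)] sqint_cmult[OF e(2)], of a b]
    by (simp add: w'_def[abs_def])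
  moreover have "ip ?S (\<lambda>x. a * e x - (- b) * e' x) w' = ip ?S (\<lambda>x. a * e x) w' - ip ?S (\<lambda>x. (- b) * e' x) w'"
    by (rule ip_diff_left[OF S w' sqint_cmult[OF e(1)] sqint_cmult[OF e(2)]])
  then have "ip ?S (\<lambda>x. a * e x + b * e' x) w' = 0"
    using ip_cmult_left[OF S w' e(1), of a] ip_cmult_left[OF S w' e(2), of "- b"] orth by simp
  ultimately have "ip ?S w' w' = 0" by simp
  then have "negligible {x \<in> ?S. w' x \<noteq> 0}" by (rule ip_self_0[OF S w'])
  then show ?thesis
    by (rule exI[of _ a, OF exI[of _ b], OF negligible_subset]) (auto simp: w'_def w_def e_def e'_def algebra_simps)
qed

text \<open>The combination \<open>F\<close> and hence its derivative vanish inside the interval. At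
  a point where \<open>p\<close> is nonzero and the equation holds, the quasi-derivative of
  \<open>F\<close> is zero too, and the determinant of the two equations for \<open>A\<close> and
  \<open>B\<close> is the Wronskian \<open>1\<close>.\<close>

lemma solutions_independent:
  assumes uv: "sl_system u u1 (\<lambda>_. 0)" "sl_system v v1 (\<lambda>_. 0)" "\<And>x. x \<in> I \<Longrightarrow> u x * v1 x - u1 x * v x = 1"
    and cd: "c \<in> I" "d \<in> I" "c < d" and neg: "negligible {x \<in> {c..d}. A * u x + B * v x \<noteq> 0}"
  shows "A = 0 \<and> B = 0"
proof -
  define F F1 where "F x = A * u x + B * v x" and "F1 x = A * u1 x + B * v1 x" for x
  have F: "sl_system F F1 (\<lambda>_. 0)"
    using sl_system_add[OF sl_system_cmult[OF uv(1), of A] sl_system_cmult[OF uv(2), of B]]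
    by (simp add: F_def[abs_def] F1_def[abs_def])
  have sub: "{c..d} \<subseteq> I" by (rule Icc_subset_I[OF cd(1,2)])
  have F0: "F x = 0" if "x \<in> {c<..<d}" for x
  proof (rule continuous_on_AE_eq_imp_eq[of "{c<..<d}" F "\<lambda>_. 0", OF _ _ _ _ that])
    have "{c<..<d} \<subseteq> I" using sub by auto
    then show "continuous_on {c<..<d} F" by (rule continuous_on_subset[OF sl_system_continuous_on(1)[OF F]])
    have "negligible {x \<in> {c<..<d}. F x \<noteq> 0}"
      by (rule negligible_subset[OF neg]) (auto simp: F_def)
    then show "AE x in lebesgue_on {c<..<d}. F x = 0"
      by (subst AE_lebesgue_on_iff_negligible) auto
  qed auto
  have "AE x in lebesgue_on I. (F has_vector_derivative of_real (inverse (p x)) * F1 x - of_real (s x) * F x) (at x)"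
    using F by (simp add: sl_system_def ac_deriv_def)
  with AE_p have "AE x in lebesgue_on I. p x \<noteq> 0 \<and> (F has_vector_derivative of_real (inverse (p x)) * F1 x - of_real (s x) * F x) (at x)"
    by eventually_elim simp
  then have neg2: "negligible {x \<in> I. \<not> (p x \<noteq> 0 \<and> (F has_vector_derivative of_real (inverse (p x)) * F1 x - of_real (s x) * F x) (at x))}"
    by (simp only: AE_I_negligible)
  have "\<not> {c<..<d} \<subseteq> {x \<in> I. \<not> (p x \<noteq> 0 \<and> (F has_vector_derivative of_real (inverse (p x)) * F1 x - of_real (s x) * F x) (at x))}"
    using negligible_subset[OF neg2] open_not_negligible[of "{c<..<d}"] cd(3) by auto
  then obtain x where x1: "x \<in> {c<..<d}" and
      x0: "x \<notin> {x \<in> I. \<not> (p x \<noteq> 0 \<and> (F has_vector_derivative of_real (inverse (p x)) * F1 x - of_real (s x) * F x) (at x))}"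
    by blast
  have "x \<in> {c..d}" using x1 by simp
  then have "x \<in> I" using sub by blast
  with x0 x1 have x: "x \<in> {c<..<d}" "x \<in> I" "p x \<noteq> 0"
      "(F has_vector_derivative of_real (inverse (p x)) * F1 x - of_real (s x) * F x) (at x)"
    by blast+
  have "(F has_vector_derivative 0) (at x)"
    by (rule has_vector_derivative_transform_within_open[OF has_vector_derivative_const[of 0], of "{c<..<d}"]) (use x(1) F0 in auto)
  from vector_derivative_at[OF this] vector_derivative_at[OF x(4)]
  have "of_real (inverse (p x)) * F1 x = 0" using F0[OF x(1)] by simp
  then have F1x: "F1 x = 0" using x(3) by simp
  have "A * u x + B * v x = 0" "A * u1 x + B * v1 x = 0" using F1x F0[OF x(1)] by (simp_all add: F_def F1_def)
  with uv(3)[OF x(2)] have "A = 0" "B = 0" by algebra+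
  then show ?thesis by simp
qed

text \<open>On each compact interval \<open>g\<close> differs from a strong solution by a
  homogeneous one, with constants depending on the interval. By linear independence the constants of
  one reference interval are those of every larger interval, so a single \<open>g'\<close> serves on
  all of \<open>I\<close>.\<close>

theorem weak_solution_imp_dom_T_max:
  assumes g: "sqint I g" and k: "sqint I k" and weak: "weak_solution g k"
  shows "\<exists>g'\<in>dom_T_max C. (AE x in lebesgue_on I. g x = g' x) \<and> (AE x in lebesgue_on I. k x = tau C g' x)"
proof -
  obtain G G1 where G: "sl_system G G1 k" using ex_inhomogeneous_solution[OF k] by blast
  obtain u u1 v v1 where uv: "sl_system u u1 (\<lambda>_. 0)" "sl_system v v1 (\<lambda>_. 0)"
      and "\<forall>x\<in>I. u x * v1 x - u1 x * v x = 1"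
    using ex_fundamental_system by blast
  then have W: "u x * v1 x - u1 x * v x = 1" if "x \<in> I" for x using that by blast
  have loc: "\<exists>a b. negligible {x \<in> {c..d}. g x \<noteq> G x + (a * cnj (u x) + b * cnj (v x))}"
    if "c \<in> I" "d \<in> I" "c \<le> d" for c d
    by (rule weak_solution_on_interval[OF g k weak G uv _ that]) (rule W)
  obtain c0 where "c0 \<in> I" by (rule I_nonempty)
  then obtain d0 where cd0: "c0 \<in> I" "d0 \<in> I" "c0 < d0" using I_extend by blast
  obtain a b where ab: "negligible {x \<in> {c0..d0}. g x \<noteq> G x + (a * cnj (u x) + b * cnj (v x))}"
    using loc[OF cd0(1,2)] cd0(3) by auto
  define g' where "g' x = G x + (a * cnj (u x) + b * cnj (v x))" for x
  have g': "sl_system g' (\<lambda>x. G1 x + (a * cnj (u1 x) + b * cnj (v1 x))) k"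
    using sl_system_add[OF G sl_system_add[OF sl_system_cmult[OF sl_system_cnj[OF uv(1)], of a] sl_system_cmult[OF sl_system_cnj[OF uv(2)], of b]]]
    by (simp add: g'_def[abs_def])
  have eq: "AE x in lebesgue_on I. g x = g' x"
  proof (rule AE_lebesgue_on_openI[OF open_I])
    fix \<alpha> \<beta> :: real assume \<alpha>\<beta>: "\<alpha> < \<beta>" "{\<alpha>..\<beta>} \<subseteq> I"
    \<comment> \<open>The interval is enlarged to contain the reference interval
      \<open>{c0..d0}\<close>, on which both representations of \<open>g\<close> are
      compared.\<close>
    define c d where "c = min \<alpha> c0" and "d = max \<beta> d0"
    have "\<alpha> \<in> {\<alpha>..\<beta>}" "\<beta> \<in> {\<alpha>..\<beta>}" using \<alpha>\<beta>(1) by simp_all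
    then have "\<alpha> \<in> I" "\<beta> \<in> I" using \<alpha>\<beta>(2) by blast+
    then have cd: "c \<in> I" "d \<in> I" "c \<le> d" using cd0 by (simp_all add: c_def d_def min_def max_def)
    obtain a' b' where ab': "negligible {x \<in> {c..d}. g x \<noteq> G x + (a' * cnj (u x) + b' * cnj (v x))}"
      using loc[OF cd] by auto
    have "negligible {x \<in> {c0..d0}. cnj (a - a') * u x + cnj (b - b') * v x \<noteq> 0}"
    proof (rule negligible_subset[OF negligible_Un[OF ab ab']], rule subsetI, rule ccontr)
      fix x assume x: "x \<in> {x \<in> {c0..d0}. cnj (a - a') * u x + cnj (b - b') * v x \<noteq> 0}"
        and nx: "x \<notin> {x \<in> {c0..d0}. g x \<noteq> G x + (a * cnj (u x) + b * cnj (v x))} \<union>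
             {x \<in> {c..d}. g x \<noteq> G x + (a' * cnj (u x) + b' * cnj (v x))}"
      have "x \<in> {c..d}" using x by (auto simp: c_def d_def)
      then have "g x = G x + (a' * cnj (u x) + b' * cnj (v x))" "g x = G x + (a * cnj (u x) + b * cnj (v x))"
        using nx x by blast+
      then have "(a - a') * cnj (u x) + (b - b') * cnj (v x) = 0" by (simp add: algebra_simps)
      then have "cnj ((a - a') * cnj (u x) + (b - b') * cnj (v x)) = 0" by simp
      with x show False by simp
    qed
    from solutions_independent[OF uv _ cd0 this] W have "cnj (a - a') = 0 \<and> cnj (b - b') = 0" by blast
    then have "a' = a" "b' = b" by simp_all
    with ab' show "negligible {x \<in> {\<alpha><..<\<beta>}. g x \<noteq> g' x}"
      by (elim negligible_subset) (auto simp: g'_def c_def d_def)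
  qed
  have "sqint I g'" by (rule sqint_cong_AE[OF g eq])
  note T = dom_T_maxI[OF g' this k]
  from T(2) have "AE x in lebesgue_on I. k x = tau C g' x" by eventually_elim simp
  with T(1) eq show ?thesis by blast
qed

end

section \<open>Density\<close>

text \<open>The weights \<open>2 ^ n\<close> turn square summability of the increments into geometric decay.\<close>

lemma convergent_of_weighted_summable:
  fixes w :: "nat \<Rightarrow> complex"
  assumes "(\<Sum>n. ennreal (2 ^ n * (norm (w (Suc n) - w n))\<^sup>2)) \<noteq> \<infinity>"
  shows "convergent w"
proof -
  let ?a = "\<lambda>n. 2 ^ n * (norm (w (Suc n) - w n))\<^sup>2"
  have "summable ?a"
    by (rule summable_suminf_not_top) (use assms in auto)
  then have "Bseq ?a" by (intro convergent_imp_Bseq convergentI[OF summable_LIMSEQ_zero])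
  then obtain K where K: "K > 0" "\<And>n. norm (?a n) \<le> K" unfolding Bseq_def by auto
  have le: "norm (w (Suc n) - w n) \<le> sqrt K * (1 / sqrt 2) ^ n" for n
  proof -
    have "2 ^ n * (norm (w (Suc n) - w n))\<^sup>2 \<le> K" using K(2)[of n] by simp
    then have "(norm (w (Suc n) - w n))\<^sup>2 \<le> K / 2 ^ n" by (simp add: field_simps)
    then have "norm (w (Suc n) - w n) \<le> sqrt (K / 2 ^ n)" by (rule real_le_rsqrt)
    also have "\<dots> = sqrt K * (1 / sqrt 2) ^ n" by (simp add: real_sqrt_divide real_sqrt_power power_one_over divide_inverse real_sqrt_mult real_sqrt_inverse power_inverse)
    finally show ?thesis .
  qed
  have sg: "summable (\<lambda>n. sqrt K * (1 / sqrt 2) ^ n)"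
    by (intro summable_mult summable_geometric) simp
  have "summable (\<lambda>n. w (Suc n) - w n)"
    by (rule summable_comparison_test'[OF sg le])
  then have "convergent (\<lambda>n. \<Sum>k<n. w (Suc k) - w k)" by (simp add: summable_iff_convergent)
  then have "convergent (\<lambda>n. w n - w 0)" by (simp add: sum_lessThan_telescope)
  from convergent_add[OF this convergent_const[of "w 0"]] show ?thesis by simp
qed

text \<open>Completeness with a rate. Squared distances of order \<open>(1/4) ^ n\<close> remain
  summable after multiplication by the weights \<open>2 ^ n\<close>, so the sequence converges
  almost everywhere, and Fatou's lemma carries the bounds over to the limit.\<close>

lemma L2_limit_exists:
  fixes w :: "nat \<Rightarrow> 'a \<Rightarrow> complex"
  assumes w: "\<And>n. w n \<in> borel_measurable M" and "C \<ge> 0"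
    and cauchy: "\<And>n m. n \<le> m \<Longrightarrow> (\<integral>\<^sup>+x. ennreal ((norm (w m x - w n x))\<^sup>2) \<partial>M) \<le> ennreal (C * (1/4) ^ n)"
  shows "\<exists>g\<in>borel_measurable M. \<forall>n. (\<integral>\<^sup>+x. ennreal ((norm (g x - w n x))\<^sup>2) \<partial>M) \<le> ennreal (C * (1/4) ^ n)"
proof -
  note [measurable] = w
  have "(\<integral>\<^sup>+x. (\<Sum>n. ennreal (2 ^ n * (norm (w (Suc n) x - w n x))\<^sup>2)) \<partial>M)
      = (\<Sum>n. \<integral>\<^sup>+x. ennreal (2 ^ n * (norm (w (Suc n) x - w n x))\<^sup>2) \<partial>M)"
    by (rule nn_integral_suminf) measurable
  also have "\<dots> \<le> (\<Sum>n. ennreal (C * (1/2) ^ n))"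
  proof (intro suminf_le allI)
    fix n
    have "(\<integral>\<^sup>+x. ennreal (2 ^ n * (norm (w (Suc n) x - w n x))\<^sup>2) \<partial>M)
        = ennreal (2 ^ n) * (\<integral>\<^sup>+x. ennreal ((norm (w (Suc n) x - w n x))\<^sup>2) \<partial>M)"
      by (subst nn_integral_cmult[symmetric]) (simp_all add: ennreal_mult)
    also have "\<dots> \<le> ennreal (2 ^ n) * ennreal (C * (1/4) ^ n)"
      by (intro mult_left_mono cauchy) auto
    also have "\<dots> = ennreal (2 ^ n * (C * (1/4) ^ n))" using \<open>C \<ge> 0\<close> by (simp add: ennreal_mult)
    also have "2 ^ n * (C * (1/4) ^ n) = C * (2 * (1/4)) ^ n" by (simp only: power_mult_distrib mult_ac)
    finally show "(\<integral>\<^sup>+x. ennreal (2 ^ n * (norm (w (Suc n) x - w n x))\<^sup>2) \<partial>M) \<le> ennreal (C * (1/2) ^ n)" by simp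
  qed auto
  also have "\<dots> < \<infinity>"
  proof -
    have "summable (\<lambda>n. C * (1/2) ^ n)" by (intro summable_mult summable_geometric) simp
    then have "(\<Sum>n. ennreal (C * (1/2) ^ n)) = ennreal (\<Sum>n. C * (1/2) ^ n)"
      by (rule suminf_ennreal2[rotated]) (use \<open>C \<ge> 0\<close> in simp)
    then show ?thesis by (simp only: infinity_ennreal_def ennreal_less_top)
  qed
  finally have "(\<integral>\<^sup>+x. (\<Sum>n. ennreal (2 ^ n * (norm (w (Suc n) x - w n x))\<^sup>2)) \<partial>M) \<noteq> \<infinity>" by simp
  then have "AE x in M. (\<Sum>n. ennreal (2 ^ n * (norm (w (Suc n) x - w n x))\<^sup>2)) \<noteq> \<infinity>"
    by (rule nn_integral_noteq_infinite[rotated]) measurable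
  then have conv: "AE x in M. convergent (\<lambda>n. w n x)"
    by eventually_elim (rule convergent_of_weighted_summable)
  define g where "g x = lim (\<lambda>n. w n x)" for x
  have g[measurable]: "g \<in> borel_measurable M" unfolding g_def by measurable
  have "(\<integral>\<^sup>+x. ennreal ((norm (g x - w n x))\<^sup>2) \<partial>M) \<le> ennreal (C * (1/4) ^ n)" for n
  proof -
    have "(\<integral>\<^sup>+x. ennreal ((norm (g x - w n x))\<^sup>2) \<partial>M) = (\<integral>\<^sup>+x. liminf (\<lambda>m. ennreal ((norm (w m x - w n x))\<^sup>2)) \<partial>M)"
    proof (rule nn_integral_cong_AE)
      show "AE x in M. ennreal ((norm (g x - w n x))\<^sup>2) = liminf (\<lambda>m. ennreal ((norm (w m x - w n x))\<^sup>2))"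
        using conv
      proof eventually_elim
        case (elim x)
        then have "(\<lambda>m. w m x) \<longlonglongrightarrow> g x" unfolding g_def by (simp add: convergent_LIMSEQ_iff)
        then have "(\<lambda>m. ennreal ((norm (w m x - w n x))\<^sup>2)) \<longlonglongrightarrow> ennreal ((norm (g x - w n x))\<^sup>2)"
          by (intro tendsto_intros)
        from lim_imp_Liminf[OF sequentially_bot this] show ?case by (rule sym)
      qed
    qed
    also have "\<dots> \<le> liminf (\<lambda>m. \<integral>\<^sup>+x. ennreal ((norm (w m x - w n x))\<^sup>2) \<partial>M)"
      by (rule nn_integral_liminf) measurable
    also have "\<dots> \<le> ennreal (C * (1/4) ^ n)"
      by (rule Liminf_le) (use cauchy in \<open>auto simp: eventually_sequentially\<close>)
    finally show ?thesis .
  qed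
  with g show ?thesis by blast
qed

context sl_problem
begin

section \<open>Orthogonal projection onto a subspace\<close>

definition nsq :: "(real \<Rightarrow> complex) \<Rightarrow> real" where
  "nsq f = (L2_norm M f)\<^sup>2"

lemma nsq_eq:
  assumes f: "sqint I f"
  shows "ip I f f = of_real (nsq f)" "(\<integral>\<^sup>+x. ennreal ((norm (f x))\<^sup>2) \<partial>M) = ennreal (nsq f)" "nsq f \<ge> 0"
proof -
  have L2: "f \<in> L2 M" using f by (simp add: L2_iff_sqint)
  have int: "integrable M (\<lambda>x. (norm (f x))\<^sup>2)" using L2 unfolding L2_def by blast
  have n: "nsq f = integral\<^sup>L M (\<lambda>x. (norm (f x))\<^sup>2)" by (simp add: nsq_def L2_norm_def)
  then show "nsq f \<ge> 0" by simp
  show "(\<integral>\<^sup>+x. ennreal ((norm (f x))\<^sup>2) \<partial>M) = ennreal (nsq f)"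
    unfolding n by (rule nn_integral_eq_integral[OF int]) simp
  have "ip I f f = L2_inner M f f" by (simp add: L2_inner_ip f)
  also have "\<dots> = integral\<^sup>L M (\<lambda>x. complex_of_real ((norm (f x))\<^sup>2))"
    unfolding L2_inner_def by (simp only: complex_norm_square mult.commute)
  also have "\<dots> = of_real (nsq f)" unfolding n by (rule integral_of_real[OF int])
  finally show "ip I f f = of_real (nsq f)" .
qed

lemma sqint_of_nn_integral:
  assumes "f \<in> borel_measurable M" "(\<integral>\<^sup>+x. ennreal ((norm (f x))\<^sup>2) \<partial>M) < \<infinity>"
  shows "sqint I f"
proof -
  have "integrable M (\<lambda>x. (norm (f x))\<^sup>2)"
    by (rule integrableI_bounded) (use assms in simp_all)
  with assms(1) have "f \<in> L2 M" unfolding L2_def by blast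
  then show ?thesis by (simp only: L2_iff_sqint)
qed

lemmas ip_rules = ip_diff_right[OF order_refl I_sets] ip_diff_left[OF order_refl I_sets] ip_cnj[OF order_refl I_sets]
  ip_cmult_right[OF order_refl I_sets] ip_cmult_left[OF order_refl I_sets] ip_add_right[OF order_refl I_sets]

lemmas sqint_rules = sqint_diff[OF _ _ order_refl I_sets] sqint_add[OF _ _ order_refl I_sets] sqint_cmult

lemma nsq_diff_cmult:
  assumes v: "sqint I v" and e: "sqint I e"
  shows "nsq (\<lambda>x. v x - (of_real \<tau> * ip I e v) * e x) = nsq v - 2 * \<tau> * (norm (ip I e v))\<^sup>2 + \<tau>\<^sup>2 * (norm (ip I e v))\<^sup>2 * nsq e"
proof -
  let ?z = "ip I e v" let ?t = "of_real \<tau> * ?z"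
  have te: "sqint I (\<lambda>x. ?t * e x)" by (intro sqint_rules e)
  have ve: "ip I v e = cnj ?z" by (rule ip_rules(3)[OF e v])
  have 1: "ip I v (\<lambda>x. ?t * e x) = ?t * cnj ?z" "ip I (\<lambda>x. ?t * e x) v = cnj ?t * ?z"
    "ip I (\<lambda>x. ?t * e x) (\<lambda>x. ?t * e x) = cnj ?t * (?t * ip I e e)"
    using ip_rules(4)[of v ?t e] ip_rules(5)[OF v e, of ?t] ip_rules(5)[OF te e, of ?t] ip_rules(4)[of e ?t e] ve by simp_all
  have "complex_of_real (nsq (\<lambda>x. v x - ?t * e x)) = ip I (\<lambda>x. v x - ?t * e x) (\<lambda>x. v x - ?t * e x)"
    by (rule nsq_eq(1)[symmetric]) (intro sqint_rules v te)
  also have "\<dots> = ip I v v - ip I v (\<lambda>x. ?t * e x) - (ip I (\<lambda>x. ?t * e x) v - ip I (\<lambda>x. ?t * e x) (\<lambda>x. ?t * e x))"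
    using ip_rules(2)[OF sqint_rules(1)[OF v te] v te] ip_rules(1)[OF v v te] ip_rules(1)[OF te v te] by simp
  also have "\<dots> = of_real (nsq v) - 2 * of_real \<tau> * (?z * cnj ?z) + (of_real \<tau>)\<^sup>2 * (?z * cnj ?z) * of_real (nsq e)"
    unfolding 1 nsq_eq(1)[OF v] nsq_eq(1)[OF e] by (simp add: algebra_simps power2_eq_square)
  also have "?z * cnj ?z = of_real ((norm ?z)\<^sup>2)" by (rule complex_norm_square[symmetric])
  finally have "complex_of_real (nsq (\<lambda>x. v x - ?t * e x)) = complex_of_real (nsq v - 2 * \<tau> * (norm ?z)\<^sup>2 + \<tau>\<^sup>2 * (norm ?z)\<^sup>2 * nsq e)"
    by simp
  then show ?thesis by (simp only: of_real_eq_iff)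
qed

text \<open>If subtracting multiples of \<open>e\<close> cannot bring the squared norm of
  \<open>v\<close> below \<open>\<delta>\<close>, the inner product with \<open>e\<close> is
  controlled by the excess of \<open>nsq v\<close> over \<open>\<delta>\<close>. For a
  near-minimiser this is approximate orthogonality; with \<open>\<delta> = 0\<close> it is a weak
  Cauchy-Schwarz inequality.\<close>

lemma norm_ip_le:
  assumes v: "sqint I v" and e: "sqint I e" and \<delta>: "\<And>t. \<delta> \<le> nsq (\<lambda>x. v x - t * e x)"
  shows "(norm (ip I e v))\<^sup>2 \<le> (nsq v - \<delta>) * (nsq e + 1)"
proof -
  \<comment> \<open>the optimal factor \<open>1 / nsq e\<close> is avoided because \<open>nsq e\<close> may vanish\<close>
  define \<tau> where "\<tau> = 1 / (nsq e + 1)"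
  have e0: "nsq e \<ge> 0" by (rule nsq_eq(3)[OF e])
  have \<tau>: "\<tau> > 0" "\<tau> * nsq e \<le> 1" "\<tau> * (nsq e + 1) = 1" using e0 by (simp_all add: \<tau>_def field_simps)
  let ?Z = "(norm (ip I e v))\<^sup>2"
  have "\<delta> \<le> nsq v - 2 * \<tau> * ?Z + \<tau>\<^sup>2 * ?Z * nsq e"
    unfolding nsq_diff_cmult[OF v e, symmetric] by (rule \<delta>)
  moreover have "\<tau>\<^sup>2 * ?Z * nsq e = (\<tau> * ?Z) * (\<tau> * nsq e)" by (simp add: power2_eq_square)
  moreover have "(\<tau> * ?Z) * (\<tau> * nsq e) \<le> (\<tau> * ?Z) * 1" using \<tau> by (intro mult_left_mono) auto
  ultimately have "\<tau> * ?Z \<le> nsq v - \<delta>" by simp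
  then have "(\<tau> * ?Z) * (nsq e + 1) \<le> (nsq v - \<delta>) * (nsq e + 1)" using e0 by (intro mult_right_mono) auto
  moreover have "(\<tau> * ?Z) * (nsq e + 1) = ?Z * (\<tau> * (nsq e + 1))" by (simp only: mult_ac)
  then have "(\<tau> * ?Z) * (nsq e + 1) = ?Z" unfolding \<tau>(3) by simp
  ultimately show ?thesis by simp
qed

lemma parallelogram:
  assumes a: "sqint I a" and b: "sqint I b"
  shows "nsq (\<lambda>x. a x - b x) + nsq (\<lambda>x. a x + b x) = 2 * nsq a + 2 * nsq b"
proof -
  have nb: "sqint I (\<lambda>x. (-1) * b x)" by (rule sqint_cmult[OF b])
  have *: "complex_of_real (nsq (\<lambda>x. a x - c x)) = ip I a a - ip I a c - (ip I c a - ip I c c)" if c: "sqint I c" for c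
    using nsq_eq(1)[OF sqint_rules(1)[OF a c]] ip_rules(2)[OF sqint_rules(1)[OF a c] a c] ip_rules(1)[OF a a c] ip_rules(1)[OF c a c] by simp
  have "complex_of_real (nsq (\<lambda>x. a x - b x) + nsq (\<lambda>x. a x - (-1) * b x)) = of_real (2 * nsq a + 2 * nsq b)"
    unfolding of_real_add *[OF b] *[OF nb]
    using ip_rules(4)[of a "-1" b] ip_rules(5)[OF a b, of "-1"] ip_rules(5)[OF nb b, of "-1"] ip_rules(4)[of b "-1" b] nsq_eq(1)[OF a] nsq_eq(1)[OF b]
    by simp
  then have "nsq (\<lambda>x. a x - b x) + nsq (\<lambda>x. a x - (-1) * b x) = 2 * nsq a + 2 * nsq b" by (simp only: of_real_eq_iff)
  then show ?thesis by simp
qed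

lemma nsq_cmult: "nsq (\<lambda>x. c * f x) = (norm c)\<^sup>2 * nsq f"
proof -
  have "integral\<^sup>L M (\<lambda>x. (norm (c * f x))\<^sup>2) = (norm c)\<^sup>2 * integral\<^sup>L M (\<lambda>x. (norm (f x))\<^sup>2)"
    by (simp add: norm_mult power_mult_distrib)
  then show ?thesis by (simp add: nsq_def L2_norm_def)
qed

text \<open>The projection theorem applied to a subspace that need not be closed. A minimising
  sequence for the distance to \<open>f\<close> is Cauchy; its limit \<open>G\<close> makes
  \<open>f - G\<close> orthogonal to \<open>D\<close>, so \<open>f\<close> equals \<open>G\<close>
  almost everywhere and is approximated by the sequence.\<close>

lemma dense_if_orthogonal_complement_trivial:
  assumes D: "\<And>e. e \<in> D \<Longrightarrow> sqint I e" "d0 \<in> D"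
    and add: "\<And>e e'. e \<in> D \<Longrightarrow> e' \<in> D \<Longrightarrow> (\<lambda>x. e x + e' x) \<in> D"
    and cmult: "\<And>c e. e \<in> D \<Longrightarrow> (\<lambda>x. c * e x) \<in> D"
    and trivial: "\<And>v. sqint I v \<Longrightarrow> (\<And>e. e \<in> D \<Longrightarrow> ip I e v = 0) \<Longrightarrow> AE x in lebesgue_on I. v x = 0"
    and f: "sqint I f" and "\<epsilon> > 0"
  shows "\<exists>g\<in>D. L2_norm M (\<lambda>x. f x - g x) < \<epsilon>"
proof -
  define \<delta> where "\<delta> = (INF g\<in>D. nsq (\<lambda>x. f x - g x))"
  have sqf: "sqint I (\<lambda>x. f x - g x)" if "g \<in> D" for g by (intro sqint_rules f D(1) that)
  have bdd: "bdd_below ((\<lambda>g. nsq (\<lambda>x. f x - g x)) ` D)"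
    by (rule bdd_belowI2[of _ 0]) (rule nsq_eq(3)[OF sqf])
  have \<delta>: "\<delta> \<le> nsq (\<lambda>x. f x - g x)" if "g \<in> D" for g
    unfolding \<delta>_def by (rule cINF_lower[OF bdd that])
  have "\<exists>g\<in>D. nsq (\<lambda>x. f x - g x) < \<delta> + (1/4) ^ n" for n :: nat
  proof -
    have "\<delta> < \<delta> + (1/4) ^ n" by simp
    then show ?thesis unfolding \<delta>_def using cINF_less_iff[OF _ bdd] D(2) by blast
  qed
  then obtain g where g: "\<And>n. g n \<in> D" "\<And>n. nsq (\<lambda>x. f x - g n x) < \<delta> + (1/4) ^ n" by metis
  have gsq: "sqint I (g n)" for n by (rule D(1)[OF g(1)])
  have cauchy: "nsq (\<lambda>x. g m x - g n x) \<le> 4 * (1/4) ^ n" if "n \<le> m" for n m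
  proof -
    let ?a = "\<lambda>x. f x - g n x" and ?b = "\<lambda>x. f x - g m x"
    \<comment> \<open>The midpoint lies in the subspace, so its squared distance from
      \<open>f\<close> is at least \<open>\<delta>\<close>; the parallelogram law then bounds the
      distance between the two terms.\<close>
    have mid: "(\<lambda>x. (1/2) * (g n x + g m x)) \<in> D" by (intro cmult add g)
    have "(\<lambda>x. ?a x + ?b x) = (\<lambda>x. 2 * (f x - (1/2) * (g n x + g m x)))" by (simp add: algebra_simps)
    then have "nsq (\<lambda>x. ?a x + ?b x) = 4 * nsq (\<lambda>x. f x - (1/2) * (g n x + g m x))"
      using nsq_cmult[of 2 "\<lambda>x. f x - (1/2) * (g n x + g m x)"] by simp
    also have "\<dots> \<ge> 4 * \<delta>" using \<delta>[OF mid] by simp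
    finally have "nsq (\<lambda>x. ?a x - ?b x) \<le> 2 * nsq ?a + 2 * nsq ?b - 4 * \<delta>"
      using parallelogram[OF sqf[OF g(1)[of n]] sqf[OF g(1)[of m]]] by simp
    also have "\<dots> \<le> 2 * (1/4) ^ n + 2 * (1/4) ^ m" using g(2)[of n] g(2)[of m] by simp
    also have "\<dots> \<le> 4 * (1/4) ^ n" using power_decreasing[OF that, of "1/4::real"] by simp
    finally show ?thesis by simp
  qed
  have gm: "g n \<in> borel_measurable M" for n using gsq[of n] by (simp add: L2_iff_sqint[symmetric] L2_def)
  have "\<exists>G\<in>borel_measurable M. \<forall>n. (\<integral>\<^sup>+x. ennreal ((norm (G x - g n x))\<^sup>2) \<partial>M) \<le> ennreal (4 * (1/4) ^ n)"
  proof (rule L2_limit_exists[OF gm])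
    fix n m :: nat assume "n \<le> m"
    show "(\<integral>\<^sup>+x. ennreal ((norm (g m x - g n x))\<^sup>2) \<partial>M) \<le> ennreal (4 * (1/4) ^ n)"
      unfolding nsq_eq(2)[OF sqint_rules(1)[OF gsq gsq]] by (rule ennreal_leI[OF cauchy[OF \<open>n \<le> m\<close>]])
  qed simp
  then obtain G where G: "G \<in> borel_measurable M" "\<And>n. (\<integral>\<^sup>+x. ennreal ((norm (G x - g n x))\<^sup>2) \<partial>M) \<le> ennreal (4 * (1/4) ^ n)"
    by blast
  have GgS: "sqint I (\<lambda>x. G x - g n x)" for n
  proof (rule sqint_of_nn_integral)
    show "(\<lambda>x. G x - g n x) \<in> borel_measurable M" using G(1) gm by simp
    show "(\<integral>\<^sup>+x. ennreal ((norm (G x - g n x))\<^sup>2) \<partial>M) < \<infinity>"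
      by (rule le_less_trans[OF G(2)]) simp
  qed
  have Gg: "nsq (\<lambda>x. G x - g n x) \<le> 4 * (1/4) ^ n" for n
    using G(2)[of n] unfolding nsq_eq(2)[OF GgS] by (simp add: ennreal_le_iff)
  have GS: "sqint I G" using sqint_rules(2)[OF GgS[of 0] gsq[of 0]] by simp
  define v where "v x = f x - G x" for x
  have v: "sqint I v" unfolding v_def by (intro sqint_rules f GS)
  have geo: "(\<lambda>n. (1/4::real) ^ n) \<longlonglongrightarrow> 0" by (rule LIMSEQ_power_zero) simp
  have "AE x in lebesgue_on I. v x = 0"
  proof (rule trivial[OF v])
    fix e assume e: "e \<in> D"
    note eS = D(1)[OF e]
    have b1: "(norm (ip I e (\<lambda>x. f x - g n x)))\<^sup>2 \<le> (1/4) ^ n * (nsq e + 1)" for n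
    proof -
      have "(norm (ip I e (\<lambda>x. f x - g n x)))\<^sup>2 \<le> (nsq (\<lambda>x. f x - g n x) - \<delta>) * (nsq e + 1)"
      proof (rule norm_ip_le[OF sqf[OF g(1)] eS])
        fix t
        have "(\<lambda>x. g n x + t * e x) \<in> D" by (intro add cmult g e)
        from \<delta>[OF this] show "\<delta> \<le> nsq (\<lambda>x. f x - g n x - t * e x)" by (simp add: algebra_simps)
      qed
      also have "\<dots> \<le> (1/4) ^ n * (nsq e + 1)" using g(2)[of n] nsq_eq(3)[OF eS] by (intro mult_right_mono) auto
      finally show ?thesis .
    qed
    have b2: "(norm (ip I e (\<lambda>x. G x - g n x)))\<^sup>2 \<le> 4 * (1/4) ^ n * (nsq e + 1)" for n
    proof -
      have "(norm (ip I e (\<lambda>x. G x - g n x)))\<^sup>2 \<le> (nsq (\<lambda>x. G x - g n x) - 0) * (nsq e + 1)"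
        by (rule norm_ip_le[OF GgS eS]) (intro nsq_eq(3) sqint_rules GgS eS)
      also have "\<dots> \<le> 4 * (1/4) ^ n * (nsq e + 1)" using Gg[of n] nsq_eq(3)[OF eS] by (intro mult_right_mono) auto
      finally show ?thesis .
    qed
    have "(\<lambda>n. (norm (ip I e (\<lambda>x. f x - g n x)))\<^sup>2) \<longlonglongrightarrow> 0"
      by (rule tendsto_sandwich[OF _ _ tendsto_const, of _ _ _ "\<lambda>n. (1/4) ^ n * (nsq e + 1)"])
        (use b1 tendsto_mult_left_zero[OF geo] in auto)
    from tendsto_real_sqrt[OF this] have l1: "(\<lambda>n. ip I e (\<lambda>x. f x - g n x)) \<longlonglongrightarrow> 0"
      by (simp add: tendsto_norm_zero_iff)
    have "(\<lambda>n. (norm (ip I e (\<lambda>x. G x - g n x)))\<^sup>2) \<longlonglongrightarrow> 0"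
      by (rule tendsto_sandwich[OF _ _ tendsto_const, of _ _ _ "\<lambda>n. 4 * (1/4) ^ n * (nsq e + 1)"])
        (use b2 tendsto_mult_left_zero[OF tendsto_mult_right_zero[OF geo]] in auto)
    from tendsto_real_sqrt[OF this] have l2: "(\<lambda>n. ip I e (\<lambda>x. G x - g n x)) \<longlonglongrightarrow> 0"
      by (simp add: tendsto_norm_zero_iff)
    \<comment> \<open>Both terms on the right tend to zero, whereas the left side does not depend on
      \<open>n\<close>.\<close>
    have "ip I e v = ip I e (\<lambda>x. f x - g n x) - ip I e (\<lambda>x. G x - g n x)" for n
      using ip_rules(1)[OF eS sqf[OF g(1)] GgS, of n n] by (simp add: v_def[abs_def] algebra_simps)
    then have "(\<lambda>n. ip I e v) \<longlonglongrightarrow> 0 - 0" using tendsto_diff[OF l1 l2] by simp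
    then show "ip I e v = 0" by (simp add: LIMSEQ_const_iff)
  qed
  then have vM: "AE x in M. f x = G x" unfolding AE_M by eventually_elim (simp add: v_def)
  obtain n where n: "4 * (1/4) ^ n < \<epsilon>\<^sup>2"
  proof -
    have "(\<lambda>n. 4 * (1/4::real) ^ n) \<longlonglongrightarrow> 0" using tendsto_mult_right_zero[OF geo] by simp
    from order_tendstoD(2)[OF this, of "\<epsilon>\<^sup>2"] \<open>\<epsilon> > 0\<close> show ?thesis
      using that by (auto simp: eventually_sequentially)
  qed
  have "ennreal (nsq (\<lambda>x. f x - g n x)) = (\<integral>\<^sup>+x. ennreal ((norm (f x - g n x))\<^sup>2) \<partial>M)"
    by (rule nsq_eq(2)[OF sqf[OF g(1)], symmetric])
  also have "\<dots> = (\<integral>\<^sup>+x. ennreal ((norm (G x - g n x))\<^sup>2) \<partial>M)"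
    by (rule nn_integral_cong_AE) (use vM in eventually_elim, simp)
  also have "\<dots> \<le> ennreal (4 * (1/4) ^ n)" by (rule G(2))
  finally have "nsq (\<lambda>x. f x - g n x) \<le> 4 * (1/4) ^ n" by (simp add: ennreal_le_iff)
  then have "(L2_norm M (\<lambda>x. f x - g n x))\<^sup>2 < \<epsilon>\<^sup>2" using n by (simp add: nsq_def)
  then have "L2_norm M (\<lambda>x. f x - g n x) < \<epsilon>" using \<open>\<epsilon> > 0\<close> by (simp add: power2_less_imp_less)
  then show ?thesis using g(1) by blast
qed

end

section \<open>Self-adjoint restrictions\<close>

lemma cnj_fun_cnj_fun: "cnj_fun (cnj_fun f) = f"
  by (simp add: cnj_fun_def)

text \<open>The second assumption makes the ratio \<open>b1 / b2\<close> real, and this ratio is the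
  tangent of the angle. Adding \<open>pi\<close> to the arctangent of a negative ratio brings the
  angle into the required range; \<open>b2 = 0\<close> belongs to \<open>pi/2\<close>.\<close>

lemma ex_angle:
  fixes b1 b2 :: complex
  assumes "b1 \<noteq> 0 \<or> b2 \<noteq> 0" "b1 * cnj b2 - b2 * cnj b1 = 0"
  shows "\<exists>\<phi>. 0 \<le> \<phi> \<and> \<phi> < pi \<and> b1 * of_real (cos \<phi>) = b2 * of_real (sin \<phi>)"
proof (cases "b2 = 0")
  case True
  then show ?thesis by (intro exI[of _ "pi/2"]) simp
next
  case False
  define z where "z = b1 / b2"
  define \<rho> where "\<rho> = Re z"
  have "cnj z = z" using assms(2) False by (simp add: z_def field_simps)
  then have "z = of_real \<rho>" by (simp add: \<rho>_def complex_eq_iff)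
  then have b1: "b1 = of_real \<rho> * b2" using False by (simp add: z_def field_simps)
  obtain \<phi> where \<phi>: "0 \<le> \<phi>" "\<phi> < pi" "\<rho> * cos \<phi> = sin \<phi>"
  proof (cases "\<rho> \<ge> 0")
    case True
    have "\<rho> * cos (arctan \<rho>) = sin (arctan \<rho>)"
      using tan_arctan[of \<rho>] cos_arctan_not_zero[of \<rho>] by (simp add: tan_def field_simps)
    then show ?thesis using that[of "arctan \<rho>"] True arctan_ubound[of \<rho>] pi_gt_zero by simp
  next
    case False
    have "\<rho> * cos (arctan \<rho> + pi) = sin (arctan \<rho> + pi)"
      using tan_arctan[of \<rho>] cos_arctan_not_zero[of \<rho>] by (simp add: tan_def field_simps)
    moreover have "arctan \<rho> < 0" using False by simp
    ultimately show ?thesis using that[of "arctan \<rho> + pi"] arctan_lbound[of \<rho>] pi_gt_zero by simp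
  qed
  have "b1 * of_real (cos \<phi>) = b2 * of_real (\<rho> * cos \<phi>)" by (simp add: b1)
  also have "\<dots> = b2 * of_real (sin \<phi>)" by (simp only: \<phi>(3))
  finally show ?thesis using \<phi>(1,2) by blast
qed

context sl_problem
begin

text \<open>The sign \<open>\<sigma>\<close> is the one with which the limit-circle endpoint enters Green's formula (\<open>-1\<close> at \<open>a\<close>,
  \<open>1\<close> at \<open>b\<close>) when the other endpoint does not contribute.\<close>

definition endpoint :: "real filter \<Rightarrow> real \<Rightarrow> bool" where
  "endpoint F \<sigma> \<longleftrightarrow> F \<noteq> bot \<and> \<sigma> \<noteq> 0 \<and> eventually (\<lambda>x. x \<in> I) F \<and>
     (\<forall>c\<in>I. \<forall>d\<in>I. c \<le> d \<longrightarrow> eventually (\<lambda>x. x \<notin> {c..d}) F) \<and>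
     (\<forall>f\<in>dom_T_max C. \<forall>g\<in>dom_T_max C. (wronskian C f g \<longlongrightarrow> wronskian_lim C F f g) F \<and>
        integral I (\<lambda>x. of_real (r x) * (tau C f x * g x - f x * tau C g x)) = of_real \<sigma> * wronskian_lim C F f g)"

lemma eventually_I: "eventually (\<lambda>x. x \<in> I) (to_a C)" "eventually (\<lambda>x. x \<in> I) (to_b C)"
  unfolding to_a_def to_b_def eventually_filtermap mem_I
proof -
  have ab: "sl_a C < sl_b C" using SL by (simp add: sturm_liouville_def)
  have 1: "eventually (\<lambda>y. sl_a C < y \<and> y < sl_b C) (at_right (sl_a C))"
    using eventually_at_right[OF ab] ab by (metis (mono_tags, lifting))
  have 2: "eventually (\<lambda>y. sl_a C < y \<and> y < sl_b C) (at_left (sl_b C))"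
    using eventually_at_left[OF ab] ab by (metis (mono_tags, lifting))
  have *: "sl_a C < ereal (real_of_ereal y) \<and> ereal (real_of_ereal y) < sl_b C" if "sl_a C < y \<and> y < sl_b C" for y
    using that by (cases y) auto
  show "eventually (\<lambda>y. sl_a C < ereal (real_of_ereal y) \<and> ereal (real_of_ereal y) < sl_b C) (at_right (sl_a C))"
    using 1 by eventually_elim (rule *)
  show "eventually (\<lambda>y. sl_a C < ereal (real_of_ereal y) \<and> ereal (real_of_ereal y) < sl_b C) (at_left (sl_b C))"
    using 2 by eventually_elim (rule *)
qed

lemma endpoint_a:
  assumes "limit_point_b C"
  shows "endpoint (to_a C) (-1)"
  unfolding endpoint_def
proof (intro conjI ballI impI)
  fix c d assume "c \<in> I" "d \<in> I" "c \<le> d"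
  then show "eventually (\<lambda>x. x \<notin> {c..d}) (to_a C)"
    unfolding eventually_to_a by (intro bexI[of _ c]) auto
next
  fix f g assume fg: "f \<in> dom_T_max C" "g \<in> dom_T_max C"
  show "(wronskian C f g \<longlongrightarrow> wronskian_lim C (to_a C) f g) (to_a C)" by (rule wronskian_tendsto(1)[OF fg])
  show "integral I (\<lambda>x. of_real (r x) * (tau C f x * g x - f x * tau C g x)) = of_real (-1) * wronskian_lim C (to_a C) f g"
    using wronskian_tendsto(3)[OF fg] limit_point_b_wronskian_lim[OF assms fg] by simp
qed (simp_all add: to_a_neq_bot eventually_I)

lemma endpoint_b:
  assumes "limit_point_a C"
  shows "endpoint (to_b C) 1"
  unfolding endpoint_def
proof (intro conjI ballI impI)
  fix c d assume "c \<in> I" "d \<in> I" "c \<le> d"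
  then show "eventually (\<lambda>x. x \<notin> {c..d}) (to_b C)"
    unfolding eventually_to_b by (intro bexI[of _ d]) auto
next
  fix f g assume fg: "f \<in> dom_T_max C" "g \<in> dom_T_max C"
  show "(wronskian C f g \<longlongrightarrow> wronskian_lim C (to_b C) f g) (to_b C)" by (rule wronskian_tendsto(2)[OF fg])
  show "integral I (\<lambda>x. of_real (r x) * (tau C f x * g x - f x * tau C g x)) = of_real 1 * wronskian_lim C (to_b C) f g"
    using wronskian_tendsto(3)[OF fg] limit_point_a_wronskian_lim[OF assms fg] by simp
qed (simp_all add: to_b_neq_bot eventually_I)

lemma tau_opI:
  assumes "sqint I f" "sqint I h" "g \<in> D" "AE x in lebesgue_on I. f x = g x" "AE x in lebesgue_on I. h x = tau C g x"
  shows "(f, h) \<in> tau_op C D"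
  unfolding tau_op_def AE_M L2_iff_sqint using assms by blast

lemma tau_opE:
  assumes "(f, h) \<in> tau_op C D"
  obtains g where "sqint I f" "sqint I h" "g \<in> D" "AE x in lebesgue_on I. f x = g x" "AE x in lebesgue_on I. h x = tau C g x"
  using assms unfolding tau_op_def AE_M L2_iff_sqint by blast

lemma quasi_deriv_add:
  assumes "f \<in> dom_T_max C" "g \<in> dom_T_max C" "x \<in> I"
  shows "quasi_deriv C (\<lambda>x. f x + g x) x = quasi_deriv C f x + quasi_deriv C g x"
  by (rule sl_system_quasi_deriv[OF sl_system_add[OF dom_T_max_D(1)[OF assms(1)] dom_T_max_D(1)[OF assms(2)]] assms(3)])

lemma quasi_deriv_cmult:
  assumes "f \<in> dom_T_max C" "x \<in> I"
  shows "quasi_deriv C (\<lambda>x. k * f x) x = k * quasi_deriv C f x"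
  by (rule sl_system_quasi_deriv[OF sl_system_cmult[OF dom_T_max_D(1)[OF assms(1)]] assms(2)])

lemma quasi_deriv_cnj:
  assumes "f \<in> dom_T_max C" "x \<in> I"
  shows "quasi_deriv C (cnj_fun f) x = cnj (quasi_deriv C f x)"
  unfolding cnj_fun_def by (rule sl_system_quasi_deriv[OF sl_system_cnj[OF dom_T_max_D(1)[OF assms(1)]] assms(2)])

lemma ip_tau_diff:
  assumes f: "f \<in> dom_T_max C" and g: "g \<in> dom_T_max C" and E: "endpoint F \<sigma>"
  shows "ip I f (tau C g) - ip I (tau C f) g = of_real \<sigma> * wronskian_lim C F g (cnj_fun f)"
proof -
  note f' = dom_T_max_D[OF f] and g' = dom_T_max_D[OF g] and c = dom_T_max_cnj[OF f]
  note i = order_refl I_sets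
  have "ip I f (tau C g) - ip I (tau C f) g = integral I (\<lambda>x. of_real (r x) * (cnj (f x) * tau C g x) - of_real (r x) * (cnj (tau C f x) * g x))"
    unfolding ip_def
    by (rule Henstock_Kurzweil_Integration.integral_diff[symmetric, OF ip_integrable[OF i f'(2) g'(3)] ip_integrable[OF i f'(3) g'(2)]])
  also have "\<dots> = integral I (\<lambda>x. of_real (r x) * (tau C g x * cnj_fun f x - g x * tau C (cnj_fun f) x))"
    by (rule integral_spike[OF c(2)[unfolded AE_I_negligible]]) (auto simp: cnj_fun_def algebra_simps)
  also have "\<dots> = of_real \<sigma> * wronskian_lim C F g (cnj_fun f)"
    using E g c(1) unfolding endpoint_def by blast
  finally show ?thesis .
qed

text \<open>By continuity \<open>g\<close> is zero on all of \<open>I\<close>, hence solves the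
  system with zero quasi-derivative and zero right-hand side. By linearity this is the
  single-valuedness of the maximal operator.\<close>

lemma tau_eq_0:
  assumes "g \<in> dom_T_max C" "AE x in lebesgue_on I. 0 = g x"
  shows "AE x in lebesgue_on I. tau C g x = 0"
proof -
  have g0: "0 = g x" if "x \<in> I" for x
    by (rule continuous_on_AE_eq_imp_eq[OF open_I continuous_on_const sl_system_continuous_on(1)[OF dom_T_max_D(1)[OF assms(1)]] assms(2) that])
  have "ac_deriv I g (\<lambda>_. 0)" by (rule ac_deriv_cong[OF ac_deriv_const g0 open_I])
  then have "ac_deriv I g (\<lambda>x. of_real (inverse (p x)) * 0 - of_real (s x) * g x)"
  proof (rule ac_deriv_cong_AE)
    have "AE x in lebesgue_on I. x \<in> I" by (rule AE_I2) simp
    then show "AE x in lebesgue_on I. 0 = of_real (inverse (p x)) * 0 - of_real (s x) * g x"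
      by eventually_elim (simp add: g0[symmetric])
  qed
  moreover have "ac_deriv I (\<lambda>_. 0) (\<lambda>x. of_real (s x) * 0 + of_real (q x) * g x - of_real (r x) * 0)"
  proof (rule ac_deriv_cong_AE[OF ac_deriv_const])
    have "AE x in lebesgue_on I. x \<in> I" by (rule AE_I2) simp
    then show "AE x in lebesgue_on I. 0 = of_real (s x) * 0 + of_real (q x) * g x - of_real (r x) * 0"
      by eventually_elim (simp add: g0[symmetric])
  qed
  ultimately have "sl_system g (\<lambda>_. 0) (\<lambda>_. 0)" by (simp only: sl_system_def)
  then show ?thesis by (rule sl_system_tau)
qed

context
  fixes F :: "real filter" and \<sigma> :: real
  assumes E: "endpoint F \<sigma>"
begin

section \<open>Algebra of the boundary Wronskian\<close>

abbreviation "W \<equiv> wronskian_lim C F"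

lemma F_bot: "F \<noteq> bot" and \<sigma>_nz: "\<sigma> \<noteq> 0" and F_I: "eventually (\<lambda>x. x \<in> I) F"
  using E by (simp_all add: endpoint_def)

lemma W_tendsto: "f \<in> dom_T_max C \<Longrightarrow> g \<in> dom_T_max C \<Longrightarrow> (wronskian C f g \<longlongrightarrow> W f g) F"
  using E by (simp add: endpoint_def)

text \<open>Identities between Wronskians hold pointwise on \<open>I\<close>, where the filter lives
  eventually; the rules below carry such identities to the endpoint.\<close>

lemma W_unique:
  fixes h k :: "real \<Rightarrow> complex"
  assumes "(h \<longlongrightarrow> l) F" "(k \<longlongrightarrow> m) F" "\<And>x. x \<in> I \<Longrightarrow> h x = k x"
  shows "l = m"
proof -
  have "eventually (\<lambda>x. h x = k x) F" using F_I by eventually_elim (rule assms(3))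
  then have "(k \<longlongrightarrow> l) F" using assms(1) by (simp add: tendsto_cong)
  then show ?thesis using assms(2) by (rule tendsto_unique[OF F_bot])
qed

lemma W_add_left:
  assumes "f \<in> dom_T_max C" "g \<in> dom_T_max C" "h \<in> dom_T_max C"
  shows "W (\<lambda>x. f x + g x) h = W f h + W g h"
  by (rule W_unique[OF W_tendsto[OF dom_T_max_add(1)[OF assms(1,2)] assms(3)]
        tendsto_add[OF W_tendsto[OF assms(1,3)] W_tendsto[OF assms(2,3)]]])
    (simp add: wronskian_def quasi_deriv_add[OF assms(1,2)] algebra_simps)

lemma W_cmult_left:
  assumes "f \<in> dom_T_max C" "h \<in> dom_T_max C"
  shows "W (\<lambda>x. k * f x) h = k * W f h"
  by (rule W_unique[OF W_tendsto[OF dom_T_max_cmult(1)[OF assms(1)] assms(2)] tendsto_mult[OF tendsto_const W_tendsto[OF assms]]])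
    (simp add: wronskian_def quasi_deriv_cmult[OF assms(1)] algebra_simps)

lemma W_swap:
  assumes "f \<in> dom_T_max C" "g \<in> dom_T_max C"
  shows "W g f = - W f g"
  by (rule W_unique[OF W_tendsto[OF assms(2,1)] tendsto_minus[OF W_tendsto[OF assms]]])
    (simp add: wronskian_def algebra_simps)

lemma W_cnj:
  assumes "f \<in> dom_T_max C" "g \<in> dom_T_max C"
  shows "W (cnj_fun f) (cnj_fun g) = cnj (W f g)"
  by (rule W_unique[OF W_tendsto[OF dom_T_max_cnj(1)[OF assms(1)] dom_T_max_cnj(1)[OF assms(2)]] tendsto_cnj[OF W_tendsto[OF assms]]])
    (simp add: wronskian_def quasi_deriv_cnj assms, simp add: cnj_fun_def)

text \<open>The quadratic relation between the minors of the 2-by-4 matrix formed by the values and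
  quasi-derivatives of four functions.\<close>

lemma W_plucker:
  assumes "f \<in> dom_T_max C" "g \<in> dom_T_max C" "h \<in> dom_T_max C" "k \<in> dom_T_max C"
  shows "W f g * W h k + W f h * W k g + W f k * W g h = 0"
  by (rule W_unique[OF _ tendsto_const, where h = "\<lambda>x. wronskian C f g x * wronskian C h k x +
        wronskian C f h x * wronskian C k g x + wronskian C f k x * wronskian C g h x"])
    (intro tendsto_intros W_tendsto assms, simp add: wronskian_def algebra_simps)

lemma W_compact_support:
  assumes "f \<in> dom_T_max C" "g \<in> dom_T_max C" "c \<in> I" "d \<in> I" "c \<le> d"
    and f: "\<And>x. x \<in> I \<Longrightarrow> x \<notin> {c..d} \<Longrightarrow> f x = 0 \<and> quasi_deriv C f x = 0"
  shows "W f g = 0" "W g f = 0"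
proof -
  have "eventually (\<lambda>x. x \<notin> {c..d}) F" using E assms(3-5) by (simp add: endpoint_def)
  with F_I have "eventually (\<lambda>x. wronskian C f g x = 0) F"
    by eventually_elim (simp add: wronskian_def f)
  then have "(wronskian C f g \<longlongrightarrow> 0) F" by (rule tendsto_eventually)
  then show "W f g = 0" by (rule tendsto_unique[OF F_bot W_tendsto[OF assms(1,2)]])
  then show "W g f = 0" using W_swap[OF assms(1,2)] by simp
qed

context
  fixes w1 w2 :: "real \<Rightarrow> complex"
  assumes bp: "boundary_pair C F w1 w2"
begin

section \<open>The boundary functionals as coordinates\<close>

lemma w_dom: "w1 \<in> dom_T_max C" "w2 \<in> dom_T_max C" "cnj_fun w1 \<in> dom_T_max C" "cnj_fun w2 \<in> dom_T_max C"
  using bp dom_T_max_cnj(1) by (simp_all add: boundary_pair_def)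

lemma w_W: "W w1 (cnj_fun w2) = 1" "W w1 (cnj_fun w1) = 0" "W w2 (cnj_fun w2) = 0" "W (cnj_fun w1) w2 = 1"
proof -
  show "W w1 (cnj_fun w2) = 1" "W w1 (cnj_fun w1) = 0" "W w2 (cnj_fun w2) = 0"
    using bp by (simp_all add: boundary_pair_def)
  then show "W (cnj_fun w1) w2 = 1"
    using W_cnj[OF w_dom(1,4)] by (simp add: cnj_fun_cnj_fun)
qed

abbreviation "B1 \<equiv> BC1 C F w2"
abbreviation "B2 \<equiv> BC2 C F w1"

text \<open>The boundary pair realises the two unit vectors, so by linearity every pair of complex
  numbers occurs as boundary values.\<close>

lemma BC_w: "B1 w1 = 1" "B2 w1 = 0" "B1 w2 = 0" "B2 w2 = 1"
  using w_W W_swap[OF w_dom(1,3)] by (simp_all add: BC1_def BC2_def)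

lemma BC_add:
  assumes "f \<in> dom_T_max C" "g \<in> dom_T_max C"
  shows "B1 (\<lambda>x. f x + g x) = B1 f + B1 g" "B2 (\<lambda>x. f x + g x) = B2 f + B2 g"
proof -
  show "B1 (\<lambda>x. f x + g x) = B1 f + B1 g" unfolding BC1_def by (rule W_add_left[OF assms w_dom(4)])
  show "B2 (\<lambda>x. f x + g x) = B2 f + B2 g"
    unfolding BC2_def
    using W_add_left[OF assms w_dom(3)] W_swap[OF dom_T_max_add(1)[OF assms] w_dom(3)] W_swap[OF assms(1) w_dom(3)] W_swap[OF assms(2) w_dom(3)]
    by simp
qed

lemma BC_cmult:
  assumes "f \<in> dom_T_max C"
  shows "B1 (\<lambda>x. k * f x) = k * B1 f" "B2 (\<lambda>x. k * f x) = k * B2 f"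
proof -
  show "B1 (\<lambda>x. k * f x) = k * B1 f" unfolding BC1_def by (rule W_cmult_left[OF assms w_dom(4)])
  show "B2 (\<lambda>x. k * f x) = k * B2 f"
    unfolding BC2_def
    using W_cmult_left[OF assms w_dom(3)] W_swap[OF dom_T_max_cmult(1)[OF assms] w_dom(3)] W_swap[OF assms w_dom(3)]
    by simp
qed

text \<open>\<open>W w1 (cnj_fun w1) = 0\<close> forces \<open>cnj_fun w1\<close> and \<open>w1\<close> to be proportional at the endpoint, with a factor
  \<open>c\<close> of modulus one; the same \<open>c\<close> serves \<open>w2\<close>.\<close>

lemma W_cnj_eq_BC:
  assumes f: "f \<in> dom_T_max C" and g: "g \<in> dom_T_max C"
  shows "W f (cnj_fun g) = B1 f * cnj (B2 g) - B2 f * cnj (B1 g)"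
proof -
  note g' = dom_T_max_cnj(1)[OF g]
  define c where "c = W (cnj_fun w1) (cnj_fun w2)"
  \<comment> \<open>Pluecker's relation for \<open>w1\<close>, \<open>cnj_fun w2\<close>,
    \<open>cnj_fun w1\<close> and \<open>h\<close>; one product drops out because
    \<open>W w1 (cnj_fun w1) = 0\<close>.\<close>
  have B2f: "W (cnj_fun w1) h = c * W w1 h" if h: "h \<in> dom_T_max C" for h
    using W_plucker[OF w_dom(1,4,3) h] W_swap[OF w_dom(3,4)] w_W by (simp add: c_def algebra_simps)
  have "W w1 w2 = cnj c" using W_cnj[OF w_dom(3,4)] by (simp add: c_def cnj_fun_cnj_fun)
  then have cc: "c * cnj c = 1" using B2f[OF w_dom(2)] w_W(4) by simp
  have "W w2 (cnj_fun w1) = -1" using W_swap[OF w_dom(3,2)] w_W(4) by simp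
  then have h2: "W h (cnj_fun w2) = c * W h w2" if h: "h \<in> dom_T_max C" for h
    using W_plucker[OF w_dom(2,3,4) h] w_W(3) W_swap[OF h w_dom(4)] W_swap[OF h w_dom(2)] by (simp add: c_def[symmetric] algebra_simps)
  have 1: "W w1 (cnj_fun g) = cnj (B2 g)"
    unfolding BC2_def using W_cnj[OF w_dom(3) g] by (simp add: cnj_fun_cnj_fun)
  have 2: "W (cnj_fun g) (cnj_fun w2) = c * cnj (B1 g)"
    unfolding BC1_def using h2[OF g'] W_cnj[OF g w_dom(4)] by (simp add: cnj_fun_cnj_fun)
  have 3: "W w1 f = cnj c * B2 f"
    unfolding BC2_def B2f[OF f] using cc by (simp add: mult.assoc[symmetric] mult.commute)
  \<comment> \<open>Pluecker's relation for \<open>w1\<close>, \<open>cnj_fun w2\<close>,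
    \<open>f\<close> and \<open>cnj_fun g\<close>. As \<open>W w1 (cnj_fun w2) = 1\<close>, it
    expresses the form through Wronskians with the boundary pair.\<close>
  have "W f (cnj_fun g) = - (W w1 f * W (cnj_fun g) (cnj_fun w2)) + W w1 (cnj_fun g) * W f (cnj_fun w2)"
    using W_plucker[OF w_dom(1,4) f g'] w_W(1) W_swap[OF f w_dom(4)] by (simp add: algebra_simps)
  also have "\<dots> = - ((c * cnj c) * (B2 f * cnj (B1 g))) + cnj (B2 g) * B1 f"
    unfolding 1 2 3 by (simp add: BC1_def mult_ac)
  finally show ?thesis using cc by (simp add: mult_ac)
qed

text \<open>Green's formula leaves one boundary term with the nonzero factor
  \<open>\<sigma>\<close>, so symmetry becomes a condition on boundary values alone.\<close>

lemma symmetric_iff: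
  assumes f: "f \<in> dom_T_max C" and g: "g \<in> dom_T_max C"
  shows "ip I f (tau C g) = ip I (tau C f) g \<longleftrightarrow> B1 g * cnj (B2 f) - B2 g * cnj (B1 f) = 0"
  using ip_tau_diff[OF f g E] \<sigma>_nz unfolding W_cnj_eq_BC[OF g f] by auto

lemma tau_op_ip:
  assumes "sqint I f" "sqint I h" "f' \<in> dom_T_max C" "AE x in lebesgue_on I. f x = f' x" "AE x in lebesgue_on I. h x = tau C f' x"
    and g: "sqint I g" "sqint I k" "g' \<in> dom_T_max C" "AE x in lebesgue_on I. g x = g' x" "AE x in lebesgue_on I. k x = tau C g' x"
  shows "L2_inner M f k = ip I f' (tau C g')"
proof -
  note f' = dom_T_max_D[OF assms(3)] and g' = dom_T_max_D[OF g(3)]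
  note i = order_refl I_sets
  have "L2_inner M f k = ip I f k" by (rule L2_inner_ip[OF assms(1) g(2)])
  also have "\<dots> = ip I f (tau C g')" by (rule ip_cong_right[OF i g(5)[unfolded AE_I_negligible]])
  also have "\<dots> = cnj (ip I (tau C g') f)" by (rule ip_cnj[OF i g'(3) assms(1)])
  also have "ip I (tau C g') f = ip I (tau C g') f'" by (rule ip_cong_right[OF i assms(4)[unfolded AE_I_negligible]])
  also have "cnj (ip I (tau C g') f') = ip I f' (tau C g')" by (rule ip_cnj[OF i g'(3) f'(2), symmetric])
  finally show ?thesis .
qed

section \<open>The operators determined by an angle\<close>

abbreviation "D \<phi> \<equiv> dom_BC C F w1 w2 \<phi>"

lemma D_iff: "g \<in> D \<phi> \<longleftrightarrow> g \<in> dom_T_max C \<and> B1 g * of_real (cos \<phi>) = B2 g * of_real (sin \<phi>)"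
  by (auto simp: dom_BC_def)

text \<open>\<open>t\<close> is the component of the boundary vector along the unit vector
  \<open>(sin \<phi>, cos \<phi>)\<close>; the boundary condition says that the orthogonal component
  is zero.\<close>

lemma D_multiple:
  assumes "g \<in> D \<phi>"
  shows "\<exists>t. B1 g = t * of_real (sin \<phi>) \<and> B2 g = t * of_real (cos \<phi>)"
proof -
  define s c where "s = complex_of_real (sin \<phi>)" and "c = complex_of_real (cos \<phi>)"
  have sc: "s * s + c * c = 1"
    unfolding s_def c_def using sin_cos_squared_add[of \<phi>] by (simp add: power2_eq_square flip: of_real_mult of_real_add)
  have eq: "B1 g * c = B2 g * s" using assms by (simp add: D_iff s_def c_def)
  have "B1 g = (B1 g * s + B2 g * c) * s" "B2 g = (B1 g * s + B2 g * c) * c"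
    using sc eq by algebra+
  then show ?thesis unfolding s_def c_def by blast
qed

lemma D_symmetric:
  assumes "f \<in> D \<phi>" "g \<in> D \<phi>"
  shows "B1 g * cnj (B2 f) - B2 g * cnj (B1 f) = 0"
proof -
  obtain t u where "B1 f = t * of_real (sin \<phi>)" "B2 f = t * of_real (cos \<phi>)" "B1 g = u * of_real (sin \<phi>)" "B2 g = u * of_real (cos \<phi>)"
    using D_multiple[OF assms(1)] D_multiple[OF assms(2)] by blast
  then show ?thesis by simp
qed

lemma D_linear:
  shows "f \<in> D \<phi> \<Longrightarrow> g \<in> D \<phi> \<Longrightarrow> (\<lambda>x. f x + g x) \<in> D \<phi>" "f \<in> D \<phi> \<Longrightarrow> (\<lambda>x. k * f x) \<in> D \<phi>"
  by (simp_all add: D_iff dom_T_max_add(1) dom_T_max_cmult(1) BC_add BC_cmult distrib_right mult.assoc)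

text \<open>This function has the spanning vector of the line as its boundary values, so pairing
  with it alone decides the boundary condition.\<close>

lemma generator_in_D:
  shows "(\<lambda>x. of_real (sin \<phi>) * w1 x + of_real (cos \<phi>) * w2 x) \<in> D \<phi>"
    "B1 (\<lambda>x. of_real (sin \<phi>) * w1 x + of_real (cos \<phi>) * w2 x) = of_real (sin \<phi>)"
    "B2 (\<lambda>x. of_real (sin \<phi>) * w1 x + of_real (cos \<phi>) * w2 x) = of_real (cos \<phi>)"
proof -
  note d = dom_T_max_cmult(1)[OF w_dom(1), of "of_real (sin \<phi>)"] dom_T_max_cmult(1)[OF w_dom(2), of "of_real (cos \<phi>)"]
  show b: "B1 (\<lambda>x. of_real (sin \<phi>) * w1 x + of_real (cos \<phi>) * w2 x) = of_real (sin \<phi>)"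
    "B2 (\<lambda>x. of_real (sin \<phi>) * w1 x + of_real (cos \<phi>) * w2 x) = of_real (cos \<phi>)"
    using BC_add[OF d] BC_cmult[OF w_dom(1)] BC_cmult[OF w_dom(2)] BC_w by simp_all
  show "(\<lambda>x. of_real (sin \<phi>) * w1 x + of_real (cos \<phi>) * w2 x) \<in> D \<phi>"
    unfolding D_iff b using dom_T_max_add(1)[OF d] by (simp add: mult.commute)
qed

lemma compact_support_in_D:
  assumes "f \<in> dom_T_max C" "sl_system f f1 (tau C f)" "c \<in> I" "d \<in> I" "c \<le> d"
    "\<forall>x\<in>I. x \<le> c \<or> d \<le> x \<longrightarrow> f x = 0 \<and> f1 x = 0"
  shows "f \<in> D \<phi>"
proof -
  have "f x = 0 \<and> quasi_deriv C f x = 0" if "x \<in> I" "x \<notin> {c..d}" for x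
    using assms(6) that sl_system_quasi_deriv[OF assms(2) that(1)] by auto
  note W0 = W_compact_support[OF assms(1) _ assms(3-5) this]
  have "B1 f = 0" "B2 f = 0"
    unfolding BC1_def BC2_def by (rule W0(1)[OF w_dom(4)], assumption, assumption, rule W0(2)[OF w_dom(3)])
  then show ?thesis using assms(1) by (simp add: D_iff)
qed

text \<open>One inclusion holds because multiples of a real vector pair to zero. For the other, the
  adjoint yields a weak solution and hence an element \<open>g'\<close> of the maximal domain;
  testing with the generator reveals its boundary condition.\<close>

lemma adjoint_tau_op_D: "adjoint_op M (tau_op C (D \<phi>)) = tau_op C (D \<phi>)"
proof (intro set_eqI iffI; clarify)
  fix g k assume gk: "(g, k) \<in> tau_op C (D \<phi>)"
  then obtain g' where g: "sqint I g" "sqint I k" "g' \<in> D \<phi>" "AE x in lebesgue_on I. g x = g' x" "AE x in lebesgue_on I. k x = tau C g' x"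
    by (rule tau_opE)
  have gd: "g' \<in> dom_T_max C" using g(3) by (simp add: D_iff)
  have "L2_inner M g h = L2_inner M k f" if fh: "(f, h) \<in> tau_op C (D \<phi>)" for f h
  proof -
    obtain f' where f: "sqint I f" "sqint I h" "f' \<in> D \<phi>" "AE x in lebesgue_on I. f x = f' x" "AE x in lebesgue_on I. h x = tau C f' x"
      using fh by (rule tau_opE)
    have fd: "f' \<in> dom_T_max C" using f(3) by (simp add: D_iff)
    note i = order_refl I_sets
    have "L2_inner M g h = ip I g' (tau C f')"
      by (rule tau_op_ip[OF g(1,2) gd g(4,5) f(1,2) fd f(4,5)])
    also have "\<dots> = ip I (tau C g') f'"
      using symmetric_iff[OF gd fd] D_symmetric[OF g(3) f(3)] by simp
    also have "\<dots> = cnj (ip I f' (tau C g'))"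
      by (rule ip_cnj[OF i dom_T_max_D(2)[OF fd] dom_T_max_D(3)[OF gd]])
    also have "ip I f' (tau C g') = L2_inner M f k"
      by (rule tau_op_ip[OF f(1,2) fd f(4,5) g(1,2) gd g(4,5), symmetric])
    also have "cnj (L2_inner M f k) = L2_inner M k f"
      unfolding L2_inner_ip[OF f(1) g(2)] L2_inner_ip[OF g(2) f(1)] by (rule ip_cnj[OF i f(1) g(2), symmetric])
    finally show ?thesis .
  qed
  then show "(g, k) \<in> adjoint_op M (tau_op C (D \<phi>))"
    unfolding adjoint_op_def L2_iff_sqint using g(1,2) by blast
next
  fix g k assume gk: "(g, k) \<in> adjoint_op M (tau_op C (D \<phi>))"
  then have g: "sqint I g" and k: "sqint I k"
    and adj: "\<And>f h. (f, h) \<in> tau_op C (D \<phi>) \<Longrightarrow> L2_inner M g h = L2_inner M k f"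
    unfolding adjoint_op_def L2_iff_sqint by blast+
  have in_op: "(f, tau C f) \<in> tau_op C (D \<phi>)" if "f \<in> D \<phi>" for f
  proof (rule tau_opI[OF _ _ that])
    have "f \<in> dom_T_max C" using that by (simp add: D_iff)
    then show "sqint I f" "sqint I (tau C f)" by (rule dom_T_max_D)+
  qed simp_all
  have adj': "ip I g (tau C f) = ip I k f" if "f \<in> D \<phi>" for f
  proof -
    have fd: "f \<in> dom_T_max C" using that by (simp add: D_iff)
    show ?thesis
      using adj[OF in_op[OF that]] unfolding L2_inner_ip[OF g dom_T_max_D(3)[OF fd]] L2_inner_ip[OF k dom_T_max_D(2)[OF fd]] .
  qed
  have "weak_solution g k"
    unfolding weak_solution_def
  proof (intro allI impI, elim conjE)
    fix f f1 c d assume "f \<in> dom_T_max C" "sl_system f f1 (tau C f)" "c \<in> I" "d \<in> I" "c \<le> d"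
      "\<forall>x\<in>I. x \<le> c \<or> d \<le> x \<longrightarrow> f x = 0 \<and> f1 x = 0"
    then show "ip I g (tau C f) = ip I k f" by (intro adj' compact_support_in_D)
  qed
  from weak_solution_imp_dom_T_max[OF g k this] obtain g' where g': "g' \<in> dom_T_max C"
      "AE x in lebesgue_on I. g x = g' x" "AE x in lebesgue_on I. k x = tau C g' x" by blast
  let ?f = "\<lambda>x. of_real (sin \<phi>) * w1 x + of_real (cos \<phi>) * w2 x"
  have fd: "?f \<in> dom_T_max C" using generator_in_D(1)[of \<phi>] by (simp add: D_iff)
  note i = order_refl I_sets
  note f' = dom_T_max_D[OF fd]
  have "ip I g (tau C ?f) = ip I g' (tau C ?f)" "ip I k ?f = ip I (tau C g') ?f"
    using ip_cong_right[OF i g'(2)[unfolded AE_I_negligible], of "tau C ?f"] ip_cong_right[OF i g'(3)[unfolded AE_I_negligible], of ?f]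
      ip_cnj[OF i f'(3) g] ip_cnj[OF i f'(3) dom_T_max_D(2)[OF g'(1)]] ip_cnj[OF i f'(2) k] ip_cnj[OF i f'(2) dom_T_max_D(3)[OF g'(1)]]
    by simp_all
  with adj'[OF generator_in_D(1)] have "ip I g' (tau C ?f) = ip I (tau C g') ?f" by simp
  then have "of_real (sin \<phi>) * cnj (B2 g') - of_real (cos \<phi>) * cnj (B1 g') = 0"
    unfolding symmetric_iff[OF g'(1) fd] generator_in_D .
  \<comment> \<open>Sine and cosine are real, so conjugation brings the condition into the form that
    defines \<open>D \<phi>\<close>.\<close>
  then have "cnj (of_real (sin \<phi>) * cnj (B2 g') - of_real (cos \<phi>) * cnj (B1 g')) = 0" by simp
  then have "g' \<in> D \<phi>" using g'(1) by (simp add: D_iff mult.commute)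
  then show "(g, k) \<in> tau_op C (D \<phi>)" by (rule tau_opI[OF g k _ g'(2,3)])
qed

lemma densely_defined_tau_op_D: "densely_defined M (tau_op C (D \<phi>))"
  unfolding densely_defined_def
proof (intro ballI allI impI)
  fix f and \<epsilon> :: real assume f: "f \<in> L2 M" and "\<epsilon> > 0"
  have "\<exists>g\<in>D \<phi>. L2_norm M (\<lambda>x. f x - g x) < \<epsilon>"
  proof (rule dense_if_orthogonal_complement_trivial[OF _ generator_in_D(1) D_linear _ _ \<open>\<epsilon> > 0\<close>])
    show "sqint I e" if "e \<in> D \<phi>" for e using that dom_T_max_D(2)[of e] by (simp add: D_iff)
    show "sqint I f" using f by (simp only: L2_iff_sqint)
    fix v assume v: "sqint I v" and orth: "\<And>e. e \<in> D \<phi> \<Longrightarrow> ip I e v = 0"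
    have 0: "sqint I (\<lambda>_. 0)" using sqint_cmult[OF v, of 0] by simp
    have "weak_solution (\<lambda>_. 0) v"
      unfolding weak_solution_def
    proof (intro allI impI, elim conjE)
      fix e e1 c d assume e: "e \<in> dom_T_max C" "sl_system e e1 (tau C e)" "c \<in> I" "d \<in> I" "c \<le> d"
        "\<forall>x\<in>I. x \<le> c \<or> d \<le> x \<longrightarrow> e x = 0 \<and> e1 x = 0"
      have "ip I e v = 0" by (rule orth[OF compact_support_in_D[OF e]])
      then have "ip I v e = 0" using ip_cnj[OF order_refl I_sets dom_T_max_D(2)[OF e(1)] v] by simp
      then show "ip I (\<lambda>_. 0) (tau C e) = ip I v e" by (simp add: ip_def)
    qed
    from weak_solution_imp_dom_T_max[OF 0 v this] obtain g' where g': "g' \<in> dom_T_max C"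
      "AE x in lebesgue_on I. 0 = g' x" "AE x in lebesgue_on I. v x = tau C g' x" by blast
    from tau_eq_0[OF g'(1,2)] g'(3) show "AE x in lebesgue_on I. v x = 0" by eventually_elim simp
  qed
  then obtain g where g: "g \<in> D \<phi>" "L2_norm M (\<lambda>x. f x - g x) < \<epsilon>" by blast
  have gd: "g \<in> dom_T_max C" using g(1) by (simp add: D_iff)
  have "(g, tau C g) \<in> tau_op C (D \<phi>)"
    by (rule tau_opI[OF dom_T_max_D(2,3)[OF gd] g(1)]) simp_all
  with g(2) show "\<exists>(g, h)\<in>tau_op C (D \<phi>). L2_norm M (\<lambda>x. f x - g x) < \<epsilon>" by blast
qed

text \<open>\<open>sym\<close> expresses that \<open>S\<close> is contained in its adjoint,
  \<open>max\<close> that the adjoint is contained in \<open>S\<close>. With a nonzero boundary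
  vector of some \<open>u\<close>, the first confines all boundary values to the line through it,
  and the second fills the line.\<close>

lemma self_adjoint_restriction_is_D:
  assumes lin: "linear_operator M S" and adj: "adjoint_op M S = S" and sub: "S \<subseteq> T_max C"
  shows "\<exists>\<phi>. 0 \<le> \<phi> \<and> \<phi> < pi \<and> S = tau_op C (D \<phi>)"
proof -
  \<comment> \<open>Boundary values make sense only for locally absolutely continuous
    representatives; \<open>D'\<close> collects those belonging to the operator.\<close>
  define D' where "D' = {g \<in> dom_T_max C. (g, tau C g) \<in> S}"
  have inv: "(f', h') \<in> S" if "(f, h) \<in> S" "sqint I f'" "sqint I h'" "AE x in lebesgue_on I. f' x = f x" "AE x in lebesgue_on I. h' x = h x" for f h f' h'
  proof -
    from lin have "\<forall>f h f' h'. (f, h) \<in> S \<and> f' \<in> L2 M \<and> h' \<in> L2 M \<and>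
        (AE x in M. f' x = f x) \<and> (AE x in M. h' x = h x) \<longrightarrow> (f', h') \<in> S"
      unfolding linear_operator_def by (elim conjE)
    then show ?thesis using that unfolding L2_iff_sqint AE_M by blast
  qed
  have S_eq: "S = tau_op C D'"
  proof (intro set_eqI iffI; clarify)
    fix f h assume fh: "(f, h) \<in> S"
    then have "(f, h) \<in> tau_op C (dom_T_max C)" using sub by (auto simp: T_max_def)
    then obtain g where g: "sqint I f" "sqint I h" "g \<in> dom_T_max C" "AE x in lebesgue_on I. f x = g x" "AE x in lebesgue_on I. h x = tau C g x"
      by (rule tau_opE)
    have "(g, tau C g) \<in> S"
      by (rule inv[OF fh dom_T_max_D(2,3)[OF g(3)]]) (use g(4,5) in \<open>eventually_elim, simp\<close>)+
    then show "(f, h) \<in> tau_op C D'" using g by (intro tau_opI[of f h g]) (simp_all add: D'_def)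
  next
    fix f h assume "(f, h) \<in> tau_op C D'"
    then obtain g where g: "sqint I f" "sqint I h" "g \<in> D'" "AE x in lebesgue_on I. f x = g x" "AE x in lebesgue_on I. h x = tau C g x"
      by (rule tau_opE)
    then show "(f, h) \<in> S" using inv[of g "tau C g" f h] by (simp add: D'_def)
  qed
  have sym: "B1 g * cnj (B2 f) - B2 g * cnj (B1 f) = 0" if f: "f \<in> D'" and g: "g \<in> D'" for f g
  proof -
    have fd: "f \<in> dom_T_max C" and gd: "g \<in> dom_T_max C" using f g by (simp_all add: D'_def)
    have "(f, tau C f) \<in> adjoint_op M S" "(g, tau C g) \<in> S" using f g adj by (simp_all add: D'_def)
    then have "L2_inner M f (tau C g) = L2_inner M (tau C f) g" unfolding adjoint_op_def by blast
    then have "ip I f (tau C g) = ip I (tau C f) g"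
      by (simp only: L2_inner_ip[OF dom_T_max_D(2)[OF fd] dom_T_max_D(3)[OF gd]] L2_inner_ip[OF dom_T_max_D(3)[OF fd] dom_T_max_D(2)[OF gd]])
    then show ?thesis unfolding symmetric_iff[OF fd gd] .
  qed
  have max: "g \<in> D'" if g: "g \<in> dom_T_max C" and o: "\<And>f. f \<in> D' \<Longrightarrow> B1 f * cnj (B2 g) - B2 f * cnj (B1 g) = 0" for g
  proof -
    have "L2_inner M g h = L2_inner M (tau C g) f" if fh: "(f, h) \<in> S" for f h
    proof -
      obtain f' where f: "sqint I f" "sqint I h" "f' \<in> D'" "AE x in lebesgue_on I. f x = f' x" "AE x in lebesgue_on I. h x = tau C f' x"
        using fh unfolding S_eq by (rule tau_opE)
      have fd: "f' \<in> dom_T_max C" using f(3) by (simp add: D'_def)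
      have "L2_inner M g h = ip I g (tau C f')"
        unfolding L2_inner_ip[OF dom_T_max_D(2)[OF g] f(2)]
        by (rule ip_cong_right[OF order_refl I_sets f(5)[unfolded AE_I_negligible]])
      also have "\<dots> = ip I (tau C g) f'" using symmetric_iff[OF g fd] o[OF f(3)] by simp
      also have "\<dots> = L2_inner M (tau C g) f"
        unfolding L2_inner_ip[OF dom_T_max_D(3)[OF g] f(1)]
        by (rule ip_cong_right[OF order_refl I_sets f(4)[unfolded AE_I_negligible], symmetric])
      finally show ?thesis .
    qed
    then have "(g, tau C g) \<in> adjoint_op M S"
      unfolding adjoint_op_def L2_iff_sqint using dom_T_max_D(2,3)[OF g] by blast
    then show ?thesis using adj g by (simp add: D'_def)
  qed
  obtain u where u: "u \<in> D'" "B1 u \<noteq> 0 \<or> B2 u \<noteq> 0"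
  proof (rule ccontr)
    \<comment> \<open>If all boundary values of \<open>D'\<close> were zero, the condition in
      \<open>max\<close> would hold trivially for \<open>w1\<close>, whose first boundary value is
      \<open>1\<close>.\<close>
    assume "\<not> thesis"
    then have z: "B1 f = 0" "B2 f = 0" if "f \<in> D'" for f using that \<open>\<And>u. u \<in> D' \<Longrightarrow> B1 u \<noteq> 0 \<or> B2 u \<noteq> 0 \<Longrightarrow> thesis\<close> by blast+
    have "w1 \<in> D'" by (rule max[OF w_dom(1)]) (simp add: z)
    from z(1)[OF this] show False by (simp add: BC_w)
  qed
  obtain \<phi> where \<phi>: "0 \<le> \<phi>" "\<phi> < pi" "B1 u * of_real (cos \<phi>) = B2 u * of_real (sin \<phi>)"
    using ex_angle[OF u(2) sym[OF u(1) u(1)]] by blast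
  have uD: "u \<in> D \<phi>" using u(1) \<phi>(3) by (simp add: D_iff D'_def)
  obtain t where t: "B1 u = t * of_real (sin \<phi>)" "B2 u = t * of_real (cos \<phi>)" using D_multiple[OF uD] by blast
  then have "t \<noteq> 0" using u(2) by auto
  have D'D: "g \<in> D \<phi>" if g: "g \<in> D'" for g
  proof -
    \<comment> \<open>This is the pairing with \<open>u\<close>, whose boundary vector is
      \<open>t\<close> times a real one; the nonzero factor \<open>cnj t\<close> is cancelled
      next.\<close>
    have "cnj t * (B1 g * of_real (cos \<phi>) - B2 g * of_real (sin \<phi>)) = 0"
      using sym[OF u(1) g] unfolding t by (simp add: algebra_simps)
    then show ?thesis using \<open>t \<noteq> 0\<close> g by (simp add: D_iff D'_def)
  qed
  have "D' = D \<phi>"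
  proof (intro set_eqI iffI)
    fix g assume g: "g \<in> D \<phi>"
    show "g \<in> D'"
      by (rule max) (use g D_symmetric[OF g D'D] in \<open>simp_all add: D_iff\<close>)
  qed (rule D'D)
  then show ?thesis using S_eq \<phi>(1,2) by blast
qed

lemma self_adjoint_restriction_iff:
  assumes lin: "linear_operator M S"
  shows "self_adjoint M S \<and> S \<subseteq> T_max C \<longleftrightarrow> (\<exists>\<phi>. 0 \<le> \<phi> \<and> \<phi> < pi \<and> S = tau_op C (D \<phi>))"
proof
  assume "self_adjoint M S \<and> S \<subseteq> T_max C"
  then show "\<exists>\<phi>. 0 \<le> \<phi> \<and> \<phi> < pi \<and> S = tau_op C (D \<phi>)"
    by (intro self_adjoint_restriction_is_D[OF lin]) (simp_all add: self_adjoint_def)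
next
  assume "\<exists>\<phi>. 0 \<le> \<phi> \<and> \<phi> < pi \<and> S = tau_op C (D \<phi>)"
  then obtain \<phi> where S: "S = tau_op C (D \<phi>)" by blast
  have "D \<phi> \<subseteq> dom_T_max C" by (auto simp: D_iff)
  then have "S \<subseteq> T_max C" unfolding S T_max_def tau_op_def by blast
  moreover have "self_adjoint M S"
    unfolding self_adjoint_def using lin densely_defined_tau_op_D adjoint_tau_op_D unfolding S by blast
  ultimately show "self_adjoint M S \<and> S \<subseteq> T_max C" by blast
qed

end

end

end

theorem theorem6p2:
  fixes C :: sl_expr
  assumes "sturm_liouville C"
  shows "(limit_circle_a C \<and> limit_point_b C \<longrightarrow>
           (\<forall>w1 w2 S. boundary_pair C (to_a C) w1 w2 \<and> linear_operator (sl_measure C) S \<longrightarrow>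
              (self_adjoint (sl_measure C) S \<and> S \<subseteq> T_max C \<longleftrightarrow>
               (\<exists>\<phi>. 0 \<le> \<phi> \<and> \<phi> < pi \<and> S = tau_op C (dom_BC C (to_a C) w1 w2 \<phi>)))))
       \<and> (limit_circle_b C \<and> limit_point_a C \<longrightarrow>
           (\<forall>w1 w2 S. boundary_pair C (to_b C) w1 w2 \<and> linear_operator (sl_measure C) S \<longrightarrow>
              (self_adjoint (sl_measure C) S \<and> S \<subseteq> T_max C \<longleftrightarrow>
               (\<exists>\<phi>. 0 \<le> \<phi> \<and> \<phi> < pi \<and> S = tau_op C (dom_BC C (to_b C) w1 w2 \<phi>)))))"
proof -
  interpret sl_problem C by unfold_locales (rule assms)
  show ?thesis
    using self_adjoint_restriction_iff[OF endpoint_a] self_adjoint_restriction_iff[OF endpoint_b]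
    by blast
qed

end
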